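(* Let $N\ge3$ and $2^*:=\frac{2N}{N-2}$. There exists $\varepsilon_0=\varepsilon_0(N)>0$ such that, for every $\alpha$ with $2^*<\alpha<2^*+\varepsilon_0$, the optimal constant $C_{N,\alpha}$ is attained by a nonnegative Schwarz symmetric function; that is, there is $u_0\in X\setminus\{0\}$ with $u_0\ge0$, $u_0=u_0^*$ and $$J(u_0)=C_{N,\alpha}\Big(\sum_{x\in\mathbb Z^N}|u_0(x)|^\alpha\Big)^{\frac{N}{N+\alpha}} .$$
   Context: $\mathbb Z^N$ is the integer lattice graph: $x\sim y$ iff $\sum_{i=1}^N|x^{(i)}-y^{(i)}|=1$, with graph distance $d$. For $u:\mathbb Z^N\to\mathbb R$ and $x\sim y$ write $\nabla_{xy}u:=u(y)-u(x)$. $\ell^q(\mathbb Z^N)$ is the usual space with norm $\|u\|_{\ell^q}=(\sum_x|u(x)|^q)^{1/q}$. Put $\|u\|_{D^{1,2}(\mathbb Z^N)}:=\big(\frac12\sum_{x}\sum_{y\sim x}|\nabla_{xy}u|^2\big)^{1/2}$. $D^{1,2}(\mathbb Z^N)$ is the completion of the finitely supported functions in this norm; by the discrete Sobolev inequality ($\|u\|_{\ell^{q}}\le C\|u\|_{D^{1,2}}$ for $q\ge 2^*$) it is realized as the set of $u\in\ell^{2^*}(\mathbb Z^N)$ for which there are finitely supported $\varphi_k$ with $\|u-\varphi_k\|_{D^{1,2}}\to0$. $X:=\{u\in D^{1,2}(\mathbb Z^N): |\nabla_{xy}u|\le 1 \text{ for every } x\sim y\}$ and, for $u\in X$, $J(u):=\frac12\sum_{x}\sum_{y\sim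 x}\big(1-\sqrt{1-|\nabla_{xy}u|^2}\big)$. For $\alpha>2$, $C_{N,\alpha}:=\inf_{u\in (X\cap\ell^\alpha(\mathbb Z^N))\setminus\{0\}} J(u)\big/\big(\sum_{x}|u(x)|^\alpha\big)^{\frac{N}{N+\alpha}}$ (for $\alpha\ge 2^*$ one has $X\subset\ell^\alpha$). Discrete Schwarz rearrangement. Let $C_0^+(\mathbb Z^N)$ be the set of $u:\mathbb Z^N\to[0,\infty)$ such that $\{u>s\}$ is finite for every $s>0$. The discrete Schwarz rearrangement (Hajaiej, Han and Hua) is a map $u\mapsto u^*$ from $C_0^+(\mathbb Z^N)$ to itself, extended to real-valued $u\in D^{1,2}(\mathbb Z^N)$ by $u^*:=|u|^*$. A nonnegative $u$ is called Schwarz symmetric if $u=u^*$. It is to be understood here as a fixed operator with the following known properties. (R1) It is induced by a map $A\mapsto A^*$ on finite subsets of $\mathbb Z^N$ that preserves cardinality and inclusions, through $\{u^*>s\}=\{u>s\}^*$ for all $s>0$; in particular $\|u^*\|_{\ell^q}=\|u\|_{\ell^q}$ for $1\le q\le\infty$, and $((u-c)_+)^*=(u^*-c)_+$ for $c>0$. (R2) $(u^* )^*=u^*$. (R3) (Riesz-type inequality) If $G:[0,\infty)^2\to\mathbb R$ is continuous and supermodular ($G(a,b)+G(a',b')\ge G(a,b')+G(a',b)$ for $a\le a'$, $b\le b'$) with $G(0,0)=0$, and $u,v\ge0$ are finitely supported, then $\sum_{d(x,y)\le1}G(u(x),v(y))\le\sum_{d(x,y)\le1}G(u^*(x),v^*(y))$,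 the sums being over ordered pairs $(x,y)\in\mathbb Z^N\times\mathbb Z^N$. (R4) If $u_n$ are nonnegative Schwarz symmetric and $u_n\to u$ in $\ell^q(\mathbb Z^N)$ for some $q<\infty$, then $u$ is nonnegative and Schwarz symmetric. (R5) Every sequence of nonnegative Schwarz symmetric functions bounded in $\ell^{2^*}(\mathbb Z^N)$ has a subsequence converging in $\ell^q(\mathbb Z^N)$ for every $q>2^*$. *)

theory Defs
  imports "HOL-Analysis.Analysis"
begin

section \<open>The lattice graph \<open>\<int>\<^sup>N\<close>, with \<open>N = CARD('n)\<close>\<close>

definition adj :: "int ^ 'n::finite \<Rightarrow> int ^ 'n \<Rightarrow> bool" where
  "adj x y \<longleftrightarrow> (\<Sum>i\<in>UNIV. \<bar>x $ i - y $ i\<bar>) = 1"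

definition gdist :: "int ^ 'n::finite \<Rightarrow> int ^ 'n \<Rightarrow> nat" where
  "gdist x y = (LEAST k. (x, y) \<in> {(a, b). adj a b} ^^ k)"

definition grad :: "(int ^ 'n::finite \<Rightarrow> real) \<Rightarrow> int ^ 'n \<Rightarrow> int ^ 'n \<Rightarrow> real" where
  "grad u x y = u y - u x"

section \<open>Function spaces\<close>

text \<open>The value of \<open>infsum\<close> at a family that is not summable is \<open>0\<close>; the spaces below therefore
  carry their summability conditions explicitly.\<close>

definition lq :: "real \<Rightarrow> ('a \<Rightarrow> real) set" where
  "lq q = {u. (\<lambda>x. \<bar>u x\<bar> powr q) summable_on UNIV}"

definition lq_norm :: "real \<Rightarrow> ('a \<Rightarrow> real) \<Rightarrow> real" where
  "lq_norm q u = (\<Sum>\<^sub>\<infinity>x. \<bar>u x\<bar> powr q) powr (1 / q)"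

definition lq_converges :: "real \<Rightarrow> (nat \<Rightarrow> 'a \<Rightarrow> real) \<Rightarrow> ('a \<Rightarrow> real) \<Rightarrow> bool" where
  "lq_converges q f u \<longleftrightarrow>
     (\<forall>k. f k \<in> lq q) \<and> u \<in> lq q \<and> (\<lambda>k. lq_norm q (\<lambda>x. f k x - u x)) \<longlonglongrightarrow> 0"

definition fin_supp :: "('a \<Rightarrow> real) \<Rightarrow> bool" where
  "fin_supp u \<longleftrightarrow> finite {x. u x \<noteq> 0}"

definition crit_exp :: "nat \<Rightarrow> real" where
  "crit_exp N = 2 * real N / (real N - 2)"

definition finite_energy :: "(int ^ 'n::finite \<Rightarrow> real) \<Rightarrow> bool" where
  "finite_energy u \<longleftrightarrow> (\<lambda>x. \<Sum>y | adj x y. \<bar>grad u x y\<bar>\<^sup>2) summable_on UNIV"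

definition D12_norm :: "(int ^ 'n::finite \<Rightarrow> real) \<Rightarrow> real" where
  "D12_norm u = sqrt (1 / 2 * (\<Sum>\<^sub>\<infinity>x. \<Sum>y | adj x y. \<bar>grad u x y\<bar>\<^sup>2))"

definition D12 :: "(int ^ 'n::finite \<Rightarrow> real) set" where
  "D12 = {u. u \<in> lq (crit_exp CARD('n)) \<and>
     (\<exists>\<phi>. (\<forall>k. fin_supp (\<phi> k) \<and> finite_energy (\<lambda>x. u x - \<phi> k x)) \<and>
          (\<lambda>k. D12_norm (\<lambda>x. u x - \<phi> k x)) \<longlonglongrightarrow> 0)}"

section \<open>The variational problem\<close>

definition X_space :: "(int ^ 'n::finite \<Rightarrow> real) set" where
  "X_space = {u \<in> D12. \<forall>x y. adj x y \<longrightarrow> \<bar>grad u x y\<bar> \<le> 1}"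

definition J :: "(int ^ 'n::finite \<Rightarrow> real) \<Rightarrow> real" where
  "J u = 1 / 2 * (\<Sum>\<^sub>\<infinity>x. \<Sum>y | adj x y. 1 - sqrt (1 - \<bar>grad u x y\<bar>\<^sup>2))"

definition alpha_term :: "real \<Rightarrow> (int ^ 'n::finite \<Rightarrow> real) \<Rightarrow> real" where
  "alpha_term \<alpha> u = (\<Sum>\<^sub>\<infinity>x. \<bar>u x\<bar> powr \<alpha>) powr (real CARD('n) / (real CARD('n) + \<alpha>))"

definition opt_const :: "'n::finite itself \<Rightarrow> real \<Rightarrow> real" where
  "opt_const _ \<alpha> =
     (INF u \<in> (X_space \<inter> lq \<alpha>) - {\<lambda>_ :: int ^ 'n. 0}. J u / alpha_term \<alpha> u)"

section \<open>Discrete Schwarz rearrangement\<close>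

definition C0_plus :: "('a \<Rightarrow> real) set" where
  "C0_plus = {u. (\<forall>x. 0 \<le> u x) \<and> (\<forall>s>0. finite {x. u x > s})}"

definition schwarz_symmetric ::
    "(('a \<Rightarrow> real) \<Rightarrow> ('a \<Rightarrow> real)) \<Rightarrow> ('a \<Rightarrow> real) \<Rightarrow> bool" where
  "schwarz_symmetric star u \<longleftrightarrow> u \<in> C0_plus \<and> u = star u"

text \<open>The rearrangement of Hajaiej, Han and Hua enters only through the following properties.
  \<open>set_star\<close> is the map \<open>A \<mapsto> A\<^sup>*\<close> on finite sets and \<open>star\<close> the map \<open>u \<mapsto> u\<^sup>*\<close> on \<open>C0_plus\<close>;
  their values elsewhere are irrelevant. Invariance of the \<open>\<ell>\<^sup>q\<close> norms and compatibility with the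
  truncations \<open>(u - c)\<^sub>+\<close> follow from the level set property. In \<open>riesz\<close> only finitely
  many terms of the sums are nonzero.\<close>

locale schwarz_rearrangement =
  fixes set_star :: "(int ^ 'n::finite) set \<Rightarrow> (int ^ 'n) set"
    and star :: "(int ^ 'n \<Rightarrow> real) \<Rightarrow> (int ^ 'n \<Rightarrow> real)"
  assumes finite_set_star: "finite A \<Longrightarrow> finite (set_star A)"
    and card_set_star: "finite A \<Longrightarrow> card (set_star A) = card A"
    and set_star_mono: "finite B \<Longrightarrow> A \<subseteq> B \<Longrightarrow> set_star A \<subseteq> set_star B"
    and star_C0_plus: "u \<in> C0_plus \<Longrightarrow> star u \<in> C0_plus"
    and level_sets: "u \<in> C0_plus \<Longrightarrow> s > 0 \<Longrightarrow> {x. star u x > s} = set_star {x. u x > s}"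
    and star_idem: "u \<in> C0_plus \<Longrightarrow> star (star u) = star u"
    and riesz:
      "\<lbrakk>continuous_on ({0..} \<times> {0..}) (\<lambda>(a, b). G a b);
        \<And>a a' b b'. 0 \<le> a \<Longrightarrow> a \<le> a' \<Longrightarrow> 0 \<le> b \<Longrightarrow> b \<le> b' \<Longrightarrow>
          G a b + G a' b' \<ge> G a b' + G a' b;
        G 0 0 = 0;
        \<And>x. 0 \<le> u x; \<And>x. 0 \<le> v x; fin_supp u; fin_supp v\<rbrakk> \<Longrightarrow>
       (\<Sum>\<^sub>\<infinity>(x, y)\<in>{(x, y). gdist x y \<le> 1}. G (u x) (v y))
         \<le> (\<Sum>\<^sub>\<infinity>(x, y)\<in>{(x, y). gdist x y \<le> 1}. (G (star u x) (star v y) :: real))"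
    and symmetric_closed:
      "\<lbrakk>\<And>k. schwarz_symmetric star (f k); 1 \<le> q; lq_converges q f u\<rbrakk> \<Longrightarrow>
       schwarz_symmetric star u"
    and symmetric_compact:
      "\<lbrakk>\<And>k. schwarz_symmetric star (f k); \<And>k. f k \<in> lq (crit_exp CARD('n));
        \<And>k. lq_norm (crit_exp CARD('n)) (f k) \<le> M\<rbrakk> \<Longrightarrow>
       \<exists>r u. strict_mono r \<and> (\<forall>q > crit_exp CARD('n). lq_converges q (f \<circ> r) u)"

end

theory Submission
  imports Defs
begin

text \<open>
  A minimizing sequence can only lose compactness by spreading out, and this is repaired by coarse
  graining. For \<open>r \<in> {0, 1}\<^sup>N\<close> put \<open>v\<^sub>r(x) = u(2x + r) / 2\<close>. With \<open>F(u) = \<Sum> |u|\<^sup>\<alpha>\<close> and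
  \<open>A = N / (N + \<alpha>)\<close> one has \<open>\<Sum>\<^sub>r F(v\<^sub>r) = 2\<^sup>-\<^sup>\<alpha> F(u)\<close>, whereas uniform convexity of
  \<open>1 - \<surd>(1 - t\<^sup>2)\<close> gives \<open>\<Sum>\<^sub>r J(v\<^sub>r) \<le> J(u) - G / 8\<close>, where \<open>G\<close> is the sum of the squared pure second
  differences of \<open>u\<close>. The scaling is that of the quotient \<open>J / F\<^sup>A\<close>, so some \<open>v\<^sub>r\<close> has a quotient
  not larger than \<open>u\<close> as soon as the concavity loss caused by unequal \<open>F(v\<^sub>r)\<close> is at most the gain
  \<open>G / 8\<close>. That loss is quadratic in the differences of the \<open>F(v\<^sub>r)\<close>, and these are alternating
  sums which, after a summation by parts, are bounded by \<open>(G \<Sum> u\<^sup>2\<^sup>\<alpha>\<^sup>-\<^sup>2)\<^sup>1\<^sup>/\<^sup>2\<close>. Because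
  the slope of \<open>u\<close> is at most 1, the loss is at most \<open>C F(u)\<^sup>-\<^sup>2\<^sup>/\<^sup>(\<^sup>N\<^sup>+\<^sup>\<alpha>\<^sup>) G\<close>, which is dominated by the gain
  when \<open>F(u)\<close> is large. Iterating, one obtains a minimizing sequence with bounded \<open>F\<close>, hence bounded
  \<open>J\<close>. Rearrangement, the Sobolev inequality and the compactness of symmetric functions then yield
  a minimizer.
\<close>

section \<open>The Born--Infeld integrand and power functions\<close>

text \<open>On R^N the rescaling u(k x) / k preserves slopes, divides J by k^N and F by
  k^(N+\<alpha>), so minimizing sequences may spread at no cost; halving the resolution is the
  lattice version of this symmetry. The power -2/(N+\<alpha>) in the loss comes from a cone: slope
  at most 1 forces a function of height h to have F at least of order h^(N+\<alpha>), which bounds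
  the height and hence the sum of u^(2\<alpha>-2) in terms of F. Spreading is not the only danger,
  since F could also tend to 0. Here Sobolev's inequality yields a positive lower bound, and
  \<alpha> above the critical exponent is what makes the powers of F compare in the right direction.
  Coarse graining has no reason to preserve Schwarz symmetry, so the descent is completed before
  rearranging. Up to the limit everything takes place in the class \<open>admissible\<close>: all
  sums are finite there, \<open>riesz\<close> applies, coarse graining and rearrangement preserve
  the class, and truncation maps competitors into it.\<close>

definition born_infeld :: "real \<Rightarrow> real" where
  "born_infeld t = 1 - sqrt (1 - t\<^sup>2)"

lemma born_infeld_0 [simp]: "born_infeld 0 = 0"
  by (simp add: born_infeld_def)

lemma born_infeld_minus [simp]: "born_infeld (- t) = born_infeld t"
  by (simp add: born_infeld_def)

lemma born_infeld_mono:
  assumes "\<bar>s\<bar> \<le> \<bar>t\<bar>"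
  shows "born_infeld s \<le> born_infeld t"
proof -
  have "s\<^sup>2 \<le> t\<^sup>2" using assms by (simp add: abs_le_square_iff)
  then show ?thesis by (simp add: born_infeld_def)
qed

lemma born_infeld_nonneg: "0 \<le> born_infeld t"
  using born_infeld_mono[of 0 t] by simp

lemma born_infeld_le_square:
  assumes "\<bar>t\<bar> \<le> 1"
  shows "born_infeld t \<le> t\<^sup>2"
proof -
  have t: "0 \<le> 1 - t\<^sup>2" "1 - t\<^sup>2 \<le> 1" using assms by (auto simp: abs_square_le_1)
  have "(1 - t\<^sup>2)\<^sup>2 \<le> 1 - t\<^sup>2"
    using t by (simp add: power2_eq_square mult_left_le_one_le)
  then have "1 - t\<^sup>2 \<le> sqrt (1 - t\<^sup>2)" by (rule real_le_rsqrt)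
  then show ?thesis by (simp add: born_infeld_def)
qed

lemma born_infeld_ge_half_square:
  assumes "\<bar>t\<bar> \<le> 1"
  shows "t\<^sup>2 / 2 \<le> born_infeld t"
proof -
  have t: "0 \<le> 1 - t\<^sup>2" "t\<^sup>2 \<le> 1" using assms by (auto simp: abs_square_le_1)
  have "1 - t\<^sup>2 \<le> (1 - t\<^sup>2 / 2)\<^sup>2"
    using zero_le_power2[of "t\<^sup>2"] by (simp add: power2_eq_square algebra_simps)
  then have "sqrt (1 - t\<^sup>2) \<le> 1 - t\<^sup>2 / 2"
    using t by (intro real_le_lsqrt) auto
  then show ?thesis by (simp add: born_infeld_def)
qed

text \<open>The unit vectors \<open>(a, \<surd>(1 - a\<^sup>2))\<close> and \<open>(b, \<surd>(1 - b\<^sup>2))\<close> have a midpoint whose distance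
  to the unit circle is controlled by the parallelogram law.\<close>

lemma born_infeld_midpoint:
  assumes "\<bar>a\<bar> \<le> 1" "\<bar>b\<bar> \<le> 1"
  shows "born_infeld ((a + b) / 2) \<le> (born_infeld a + born_infeld b) / 2 - (a - b)\<^sup>2 / 8"
proof -
  define p q m h where "p = sqrt (1 - a\<^sup>2)" and "q = sqrt (1 - b\<^sup>2)"
    and "m = (a + b) / 2" and "h = (p + q) / 2"
  have a: "a\<^sup>2 \<le> 1" and b: "b\<^sup>2 \<le> 1" using assms by (auto simp: abs_square_le_1)
  have pq: "0 \<le> p" "0 \<le> q" "p \<le> 1" "q \<le> 1" "p\<^sup>2 = 1 - a\<^sup>2" "q\<^sup>2 = 1 - b\<^sup>2"
    using a b by (auto simp: p_def q_def)
  have "h\<^sup>2 + m\<^sup>2 + (a - b)\<^sup>2 / 4 + (p - q)\<^sup>2 / 4 = 1"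
    unfolding h_def m_def using pq(5,6) by (simp add: power2_eq_square field_simps)
  then have key: "h\<^sup>2 + (a - b)\<^sup>2 / 4 \<le> 1 - m\<^sup>2"
    using zero_le_power2[of "p - q"] by linarith
  have h: "0 \<le> h" "h \<le> 1" using pq by (auto simp: h_def)
  define P where "P = sqrt (1 - m\<^sup>2)"
  have nn: "0 \<le> 1 - m\<^sup>2" using key zero_le_power2[of h] zero_le_power2[of "a - b"] by linarith
  have P: "0 \<le> P" "P \<le> 1" "P\<^sup>2 = 1 - m\<^sup>2" using nn by (auto simp: P_def)
  have "h\<^sup>2 \<le> P\<^sup>2" using key P(3) zero_le_power2[of "a - b"] by linarith
  then have hP: "h \<le> P" using P(1) by (rule power2_le_imp_le)
  have "(a - b)\<^sup>2 / 4 \<le> P\<^sup>2 - h\<^sup>2" using key P by linarith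
  also have "\<dots> = (P - h) * (P + h)" by (simp add: power2_eq_square algebra_simps)
  also have "\<dots> \<le> (P - h) * 2" using hP P h by (intro mult_left_mono) auto
  finally have "(a - b)\<^sup>2 / 8 \<le> P - h" by simp
  then show ?thesis
    unfolding born_infeld_def P_def h_def m_def p_def q_def by (simp add: field_simps)
qed

text \<open>Quantifies the concavity loss on all of [0, infinity) with a remainder independent of A.
  With B = 1 - A and q = p - 1, Young's inequality gives p^B <= 1 + B q, so p^A = p / p^B is at
  least the rational function (1 + q) / (1 + B q), which dominates the quadratic.\<close>

lemma powr_ge_tangent_minus_square:
  fixes p A :: real
  assumes "0 \<le> p" "0 < A" "A < 1"
  shows "1 + A * (p - 1) - (p - 1)\<^sup>2 \<le> p powr A"
proof (cases "p = 0")
  case True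
  then show ?thesis using assms by simp
next
  case False
  then have p: "0 < p" using assms by simp
  define B q where "B = 1 - A" and "q = p - 1"
  have B: "0 < B" "B < 1" using assms by (auto simp: B_def)
  have "p powr B * 1 powr (1 - B) \<le> B * p + (1 - B) * 1"
    using B p by (intro Youngs_inequality_0) auto
  then have Young: "p powr B \<le> 1 + B * q" by (simp add: q_def algebra_simps)
  have d: "A \<le> 1 + B * q" using p B by (simp add: q_def B_def algebra_simps)
  have "(1 + A * q - q\<^sup>2) * (1 + B * q) \<le> 1 + q"
  proof -
    have "(1 + q) - (1 + A * q - q\<^sup>2) * (1 + B * q) = q\<^sup>2 * (1 + B * q - A * B)"
      by (simp add: B_def power2_eq_square algebra_simps)
    moreover have "A * B \<le> A" using assms B by simp
    ultimately show ?thesis using d by (smt (verit) zero_le_mult_iff zero_le_power2)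
  qed
  then have "1 + A * q - q\<^sup>2 \<le> (1 + q) / (1 + B * q)"
    using d assms by (simp add: pos_le_divide_eq)
  also have "\<dots> \<le> p / p powr B"
    using Young p d assms by (auto simp: q_def intro!: divide_left_mono)
  also have "\<dots> = p powr A" using p by (simp add: B_def powr_diff)
  finally show ?thesis by (simp add: q_def)
qed

text \<open>Convexity of the power, taken from Young's inequality with exponents \<alpha> and
  \<alpha> / (\<alpha> - 1); this covers the end point 0 without derivatives.\<close>

lemma powr_ge_tangent:
  fixes b c \<alpha> :: real
  assumes "0 \<le> b" "0 \<le> c" "1 < \<alpha>"
  shows "b powr \<alpha> + \<alpha> * b powr (\<alpha> - 1) * (c - b) \<le> c powr \<alpha>"
proof -
  have eq: "b * b powr (\<alpha> - 1) = b powr \<alpha>"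
    by (cases "b = 0") (use assms in \<open>auto simp: powr_diff\<close>)
  have "c * b powr (\<alpha> - 1) \<le> c powr \<alpha> / \<alpha> + (b powr (\<alpha> - 1)) powr (\<alpha> / (\<alpha> - 1)) / (\<alpha> / (\<alpha> - 1))"
    using assms by (intro Youngs_inequality) (auto simp: field_simps)
  also have "(b powr (\<alpha> - 1)) powr (\<alpha> / (\<alpha> - 1)) = b powr \<alpha>"
    using assms by (simp add: powr_powr)
  finally have "\<alpha> * (c * b powr (\<alpha> - 1)) \<le> c powr \<alpha> + (\<alpha> - 1) * b powr \<alpha>"
    using assms by (simp add: field_simps)
  then show ?thesis using eq by (simp add: algebra_simps)
qed

text \<open>Tangents at \<open>b\<close> show that the nonlinear remainder \<open>D\<close> is
  nonnegative; tangents at \<open>a\<close> and \<open>c\<close> bound it by products of increments,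
  a form suited to summation by parts.\<close>

lemma powr_second_difference:
  fixes a b c \<alpha> :: real
  assumes "0 \<le> a" "0 \<le> b" "0 \<le> c" "1 < \<alpha>"
  shows "\<bar>2 * b powr \<alpha> - a powr \<alpha> - c powr \<alpha>\<bar> \<le> \<alpha> * (b powr (\<alpha> - 1) * \<bar>2 * b - a - c\<bar>
     + (c - b) * (c powr (\<alpha> - 1) - b powr (\<alpha> - 1)) + (a - b) * (a powr (\<alpha> - 1) - b powr (\<alpha> - 1)))"
proof -
  note t = powr_ge_tangent[OF assms(2,3,4)] powr_ge_tangent[OF assms(3,2,4)]
    powr_ge_tangent[OF assms(2,1,4)] powr_ge_tangent[OF assms(1,2,4)]
  define E where "E = b powr (\<alpha> - 1) * (2 * b - a - c)"
  have E: "\<bar>\<alpha> * E\<bar> = \<alpha> * (b powr (\<alpha> - 1) * \<bar>2 * b - a - c\<bar>)"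
    using assms by (simp add: E_def abs_mult)
  define D where "D = (c powr \<alpha> - b powr \<alpha> - \<alpha> * b powr (\<alpha> - 1) * (c - b))
    + (a powr \<alpha> - b powr \<alpha> - \<alpha> * b powr (\<alpha> - 1) * (a - b))"
  have "2 * b powr \<alpha> - a powr \<alpha> - c powr \<alpha> = \<alpha> * E - D"
    by (simp add: D_def E_def algebra_simps)
  moreover have "0 \<le> D" unfolding D_def using t by linarith
  moreover have "D \<le> \<alpha> * ((c - b) * (c powr (\<alpha> - 1) - b powr (\<alpha> - 1))
     + (a - b) * (a powr (\<alpha> - 1) - b powr (\<alpha> - 1)))"
    unfolding D_def using t by (simp add: algebra_simps)
  ultimately show ?thesis using E by (simp add: distrib_left)
qed

section \<open>The lattice graph\<close>

abbreviation unit_vec :: "'n::finite \<Rightarrow> int ^ 'n" where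
  "unit_vec i \<equiv> axis i 1"

lemma adj_sym: "adj x y \<longleftrightarrow> adj y x"
  by (simp add: adj_def abs_minus_commute)

lemma adj_plus_unit_vec: "adj x (x + unit_vec i)"
proof -
  have "(\<Sum>k\<in>UNIV. \<bar>x $ k - (x + unit_vec i) $ k\<bar>) = (\<Sum>k\<in>UNIV. if k = i then 1 else 0)"
    by (intro sum.cong) (auto simp: axis_def)
  then show ?thesis by (simp add: adj_def)
qed

lemma adj_minus_unit_vec: "adj x (x - unit_vec i)"
  using adj_plus_unit_vec[of "x - unit_vec i" i] by (simp add: adj_sym)

lemma adj_iff: "adj x y \<longleftrightarrow> (\<exists>i. y = x + unit_vec i \<or> y = x - unit_vec i)"
proof
  assume "adj x y"
  then have s: "(\<Sum>k\<in>UNIV. \<bar>x $ k - y $ k\<bar>) = 1" by (simp add: adj_def)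
  then obtain i where i: "x $ i \<noteq> y $ i" by fastforce
  have "\<bar>x $ i - y $ i\<bar> + (\<Sum>k\<in>UNIV - {i}. \<bar>x $ k - y $ k\<bar>) = 1"
    using s by (simp add: sum.remove[of UNIV i])
  moreover have "0 \<le> (\<Sum>k\<in>UNIV - {i}. \<bar>x $ k - y $ k\<bar>)" by (intro sum_nonneg) auto
  ultimately have *: "\<bar>x $ i - y $ i\<bar> = 1" "(\<Sum>k\<in>UNIV - {i}. \<bar>x $ k - y $ k\<bar>) = 0"
    using i by linarith+
  then have "\<forall>k\<in>UNIV - {i}. x $ k = y $ k" by (subst (asm) sum_nonneg_eq_0_iff) auto
  then have "y = x + unit_vec i \<or> y = x - unit_vec i"
    using * by (auto simp: vec_eq_iff axis_def)
  then show "\<exists>i. y = x + unit_vec i \<or> y = x - unit_vec i" by blast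
qed (auto simp: adj_plus_unit_vec adj_minus_unit_vec)

lemma unit_vec_inject [simp]: "unit_vec i = unit_vec j \<longleftrightarrow> i = j"
  by (auto simp: axis_eq_axis)

lemma unit_vec_neq_minus [simp]: "unit_vec i \<noteq> - unit_vec j"
proof
  assume "unit_vec i = - unit_vec j"
  then have "unit_vec i $ i = (- unit_vec j) $ i" by simp
  then show False by (auto simp: axis_def split: if_splits)
qed

lemma neighbours_eq:
  "{y. adj x y} = (\<lambda>i. x + unit_vec i) ` UNIV \<union> (\<lambda>i. x - unit_vec i) ` UNIV"
  by (auto simp: adj_iff)

lemma finite_neighbours [simp]: "finite {y. adj x y}"
  by (simp add: neighbours_eq)

lemma sum_neighbours:
  fixes f :: "int ^ 'n::finite \<Rightarrow> 'a::comm_monoid_add"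
  shows "(\<Sum>y | adj x y. f y) = (\<Sum>i\<in>UNIV. f (x + unit_vec i)) + (\<Sum>i\<in>UNIV. f (x - unit_vec i))"
proof -
  have d: "(\<lambda>i. x + unit_vec i) ` UNIV \<inter> (\<lambda>i. x - unit_vec i) ` UNIV = {}"
  proof -
    have "x + unit_vec i \<noteq> x - unit_vec j" for i j
      using unit_vec_neq_minus[of i j] by (metis add_left_cancel diff_conv_add_uminus)
    then show ?thesis by blast
  qed
  have "inj (\<lambda>i. x + unit_vec i)" "inj (\<lambda>i. x - unit_vec i)" by (auto simp: inj_def)
  then show ?thesis
    unfolding neighbours_eq by (subst sum.union_disjoint) (use d in \<open>auto simp: sum.reindex o_def\<close>)
qed

definition l1_dist :: "int ^ 'n::finite \<Rightarrow> int ^ 'n \<Rightarrow> nat" where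
  "l1_dist x y = nat (\<Sum>i\<in>UNIV. \<bar>x $ i - y $ i\<bar>)"

text \<open>Moving one coordinate a unit towards \<open>y\<close> lowers the l1 distance by one. A
  walk therefore joins any two points, without which the \<open>LEAST\<close> in
  \<open>gdist\<close> would carry no information.\<close>

lemma relpow_adj_l1_dist: "(x, y) \<in> {(a, b). adj a b} ^^ l1_dist x y"
proof (induction "l1_dist x y" arbitrary: x)
  case 0
  have "(\<Sum>i\<in>UNIV. \<bar>x $ i - y $ i\<bar>) = 0"
    using 0 by (intro antisym sum_nonneg) (auto simp: l1_dist_def)
  then have "x = y" by (subst (asm) sum_nonneg_eq_0_iff) (auto simp: vec_eq_iff)
  then show ?case using 0 by simp
next
  case (Suc n)
  have S: "(\<Sum>i\<in>UNIV. \<bar>x $ i - y $ i\<bar>) = int n + 1" using Suc.hyps(2) by (simp add: l1_dist_def)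
  then obtain i where i: "x $ i \<noteq> y $ i" by fastforce
  define z where "z = x + (if x $ i < y $ i then unit_vec i else - unit_vec i)"
  have z: "z $ k = x $ k" if "k \<noteq> i" for k using that by (simp add: z_def axis_def)
  have zi: "\<bar>z $ i - y $ i\<bar> = \<bar>x $ i - y $ i\<bar> - 1" using i by (auto simp: z_def)
  have "(\<Sum>k\<in>UNIV. \<bar>z $ k - y $ k\<bar>) = \<bar>z $ i - y $ i\<bar> + (\<Sum>k\<in>UNIV - {i}. \<bar>x $ k - y $ k\<bar>)"
    by (simp add: sum.remove[of UNIV i] z)
  also have "\<dots> = int n" using S zi by (simp add: sum.remove[of UNIV i])
  finally have n: "n = l1_dist z y" by (simp add: l1_dist_def)
  have "adj x z" by (simp add: z_def adj_plus_unit_vec adj_minus_unit_vec)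
  then have "(x, y) \<in> {(a, b). adj a b} ^^ Suc n"
    using Suc.hyps(1)[OF n] n by (intro relpow_Suc_I2) auto
  then show ?case by (simp add: Suc.hyps(2))
qed

text \<open>Identifies the index set of \<open>riesz\<close> as the diagonal together with the
  ordered edges.\<close>

lemma gdist_le_1_iff: "gdist x y \<le> 1 \<longleftrightarrow> x = y \<or> adj x y"
proof
  have *: "(x, y) \<in> {(a, b). adj a b} ^^ gdist x y"
    unfolding gdist_def by (rule LeastI) (rule relpow_adj_l1_dist)
  assume "gdist x y \<le> 1"
  then consider "gdist x y = 0" | "gdist x y = 1" by linarith
  then show "x = y \<or> adj x y"
  proof cases
    case 1
    then show ?thesis using * by simp
  next
    case 2
    then show ?thesis using * by simp
  qed
next
  assume "x = y \<or> adj x y"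
  then show "gdist x y \<le> 1"
  proof
    assume "x = y"
    then have "gdist x y \<le> 0" unfolding gdist_def by (intro Least_le) auto
    then show ?thesis by simp
  next
    assume "adj x y"
    then show ?thesis unfolding gdist_def by (intro Least_le) auto
  qed
qed

text \<open>Used for functions of slope at most 1, and also for coset sums regarded as functions of
  their offset.\<close>

lemma unit_steps_lipschitz:
  fixes f :: "int ^ 'n::finite \<Rightarrow> real"
  assumes step: "\<And>x i. \<bar>f (x + unit_vec i) - f x\<bar> \<le> c"
  shows "\<bar>f x - f y\<bar> \<le> c * l1_dist x y"
proof -
  have adj: "\<bar>f a - f b\<bar> \<le> c" if "adj a b" for a b
  proof -
    from that obtain i where "b = a + unit_vec i \<or> b = a - unit_vec i" by (auto simp: adj_iff)
    then show ?thesis using step[of a i] step[of b i] by (auto simp: abs_minus_commute)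
  qed
  have "\<bar>f x - f y\<bar> \<le> c * real k" if "(x, y) \<in> {(a, b). adj a b} ^^ k" for k
    using that
  proof (induction k arbitrary: y)
    case (Suc k)
    then obtain z where z: "(x, z) \<in> {(a, b). adj a b} ^^ k" "adj z y" by auto
    show ?case using Suc.IH[OF z(1)] adj[OF z(2)] by (simp add: algebra_simps)
  qed simp
  then show ?thesis using relpow_adj_l1_dist by blast
qed

lemma card_vec_interval:
  "card {z :: int ^ 'n::finite. \<forall>i. z $ i \<in> S} = card S ^ CARD('n)"
proof -
  have "bij_betw vec_nth {z :: int ^ 'n. \<forall>i. z $ i \<in> S} (PiE UNIV (\<lambda>_. S))"
    by (rule bij_betwI[where g = vec_lambda]) auto
  then have "card {z :: int ^ 'n. \<forall>i. z $ i \<in> S} = card (PiE (UNIV :: 'n set) (\<lambda>_. S))"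
    by (rule bij_betw_same_card)
  also have "\<dots> = card S ^ CARD('n)" by (simp add: card_PiE)
  finally show ?thesis .
qed

lemma finite_vec_interval:
  assumes "finite S"
  shows "finite {z :: int ^ 'n::finite. \<forall>i. z $ i \<in> S}"
proof -
  have "{z :: int ^ 'n. \<forall>i. z $ i \<in> S} \<subseteq> vec_lambda ` PiE UNIV (\<lambda>_. S)"
  proof
    fix z :: "int ^ 'n" assume "z \<in> {z. \<forall>i. z $ i \<in> S}"
    then show "z \<in> vec_lambda ` PiE UNIV (\<lambda>_. S)"
      by (intro image_eqI[of _ _ "vec_nth z"]) auto
  qed
  then show ?thesis using assms by (meson finite_PiE finite_imageI finite_subset finite)
qed

section \<open>Finitely supported functions\<close>

lemma fin_supp_summable:
  assumes "fin_supp f"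
  shows "f summable_on A"
  using assms unfolding fin_supp_def
  by (intro finite_nonzero_values_imp_summable_on) (auto elim: rev_finite_subset)

lemma fin_supp_zero [simp]: "fin_supp (\<lambda>_. 0)"
  by (simp add: fin_supp_def)

lemma fin_supp_map:
  assumes "fin_supp f" "\<phi> 0 = 0"
  shows "fin_supp (\<lambda>x. \<phi> (f x))"
  using assms unfolding fin_supp_def by (auto elim!: rev_finite_subset)

lemma fin_supp_map2:
  assumes "fin_supp f" "fin_supp g" "\<phi> 0 0 = 0"
  shows "fin_supp (\<lambda>x. \<phi> (f x) (g x))"
proof -
  have "{x. \<phi> (f x) (g x) \<noteq> 0} \<subseteq> {x. f x \<noteq> 0} \<union> {x. g x \<noteq> 0}" using assms(3) by auto
  then show ?thesis using assms(1,2) unfolding fin_supp_def by (meson finite_Un finite_subset)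
qed

lemma fin_supp_sum:
  assumes "finite I" "\<And>i. i \<in> I \<Longrightarrow> fin_supp (f i)"
  shows "fin_supp (\<lambda>x. \<Sum>i\<in>I. f i x)"
  using assms
proof (induction I)
  case (insert i I)
  then show ?case by (simp add: fin_supp_map2[where \<phi> = "(+)"])
qed simp

lemma fin_supp_comp_inj:
  assumes "fin_supp f" "inj h"
  shows "fin_supp (\<lambda>x. f (h x))"
  using finite_vimageI[OF assms[unfolded fin_supp_def]] by (simp add: fin_supp_def vimage_def)

lemma fin_supp_shift:
  fixes f :: "'a::group_add \<Rightarrow> real"
  assumes "fin_supp f"
  shows "fin_supp (\<lambda>x. f (x + a))" "fin_supp (\<lambda>x. f (x - a))"
  by (rule fin_supp_comp_inj[OF assms], simp add: inj_def)+

lemma infsum_shift: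
  fixes f :: "'a::group_add \<Rightarrow> real"
  shows "(\<Sum>\<^sub>\<infinity>x. f (x + a)) = (\<Sum>\<^sub>\<infinity>x. f x)" "(\<Sum>\<^sub>\<infinity>x. f (x - a)) = (\<Sum>\<^sub>\<infinity>x. f x)"
proof -
  have "bij (\<lambda>x. x + a)" "bij (\<lambda>x. x - a)"
    by (rule bij_betw_byWitness[where f' = "\<lambda>x. x - a"] bij_betw_byWitness[where f' = "\<lambda>x. x + a"]; simp)+
  from this[THEN infsum_reindex_bij_betw, of f]
  show "(\<Sum>\<^sub>\<infinity>x. f (x + a)) = (\<Sum>\<^sub>\<infinity>x. f x)" "(\<Sum>\<^sub>\<infinity>x. f (x - a)) = (\<Sum>\<^sub>\<infinity>x. f x)"
    by simp_all
qed

lemma infsum_eq_sum_supp: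
  fixes f :: "'a \<Rightarrow> real"
  assumes "finite S" "\<And>x. x \<notin> S \<Longrightarrow> f x = 0"
  shows "(\<Sum>\<^sub>\<infinity>x. f x) = sum f S"
proof -
  have "(\<Sum>\<^sub>\<infinity>x. f x) = (\<Sum>\<^sub>\<infinity>x\<in>S. f x)" using assms by (intro infsum_cong_neutral) auto
  then show ?thesis using assms by simp
qed

lemma infsum_sum:
  fixes f :: "'i \<Rightarrow> 'a \<Rightarrow> real"
  assumes "finite I" "\<And>i. i \<in> I \<Longrightarrow> f i summable_on A"
  shows "(\<Sum>\<^sub>\<infinity>x\<in>A. \<Sum>i\<in>I. f i x) = (\<Sum>i\<in>I. \<Sum>\<^sub>\<infinity>x\<in>A. f i x)"
proof -
  have "(\<Sum>\<^sub>\<infinity>x\<in>A. \<Sum>i\<in>I. f i x) = (\<Sum>i\<in>I. \<Sum>\<^sub>\<infinity>x\<in>A. f i x)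
      \<and> (\<lambda>x. \<Sum>i\<in>I. f i x) summable_on A"
    using assms by (induction I) (auto simp: infsum_add summable_on_add)
  then show ?thesis by blast
qed

lemma infsum_mono_fin_supp:
  assumes "fin_supp f" "fin_supp g" "\<And>x. f x \<le> g x"
  shows "(\<Sum>\<^sub>\<infinity>x. f x) \<le> (\<Sum>\<^sub>\<infinity>x. g x)"
  using assms by (intro infsum_mono fin_supp_summable) auto

lemma infsum_Cauchy_Schwarz:
  assumes "fin_supp f" "fin_supp g"
  shows "(\<Sum>\<^sub>\<infinity>x. f x * g x)\<^sup>2 \<le> (\<Sum>\<^sub>\<infinity>x. (f x)\<^sup>2) * (\<Sum>\<^sub>\<infinity>x. (g x)\<^sup>2)"
proof -
  have fin: "finite ({x. f x \<noteq> 0} \<union> {x. g x \<noteq> 0})" using assms by (simp add: fin_supp_def)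
  have "(\<Sum>\<^sub>\<infinity>x. f x * g x) = (\<Sum>x\<in>{x. f x \<noteq> 0} \<union> {x. g x \<noteq> 0}. f x * g x)"
       "(\<Sum>\<^sub>\<infinity>x. (f x)\<^sup>2) = (\<Sum>x\<in>{x. f x \<noteq> 0} \<union> {x. g x \<noteq> 0}. (f x)\<^sup>2)"
       "(\<Sum>\<^sub>\<infinity>x. (g x)\<^sup>2) = (\<Sum>x\<in>{x. f x \<noteq> 0} \<union> {x. g x \<noteq> 0}. (g x)\<^sup>2)"
    by (rule infsum_eq_sum_supp[OF fin]; simp)+
  then show ?thesis by (simp add: Cauchy_Schwarz_ineq_sum)
qed

text \<open>Translation turns a backward difference into a forward one up to sign, so by evenness
  each edge counts twice. The factor 2 cancels the 1/2 in \<open>J\<close>.\<close>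

lemma infsum_neighbours:
  fixes u :: "int ^ 'n::finite \<Rightarrow> real"
  assumes u: "fin_supp u" and \<phi>: "\<phi> 0 = (0::real)" "\<And>t. \<phi> (- t) = \<phi> t"
  shows "(\<Sum>\<^sub>\<infinity>x. \<Sum>y | adj x y. \<phi> (grad u x y))
    = 2 * (\<Sum>\<^sub>\<infinity>x. \<Sum>i\<in>UNIV. \<phi> (u (x + unit_vec i) - u x))"
proof -
  define p m where "p = (\<lambda>i x. \<phi> (u (x + unit_vec i) - u x))"
    and "m = (\<lambda>i x. \<phi> (u (x - unit_vec i) - u x))"
  have p: "fin_supp (p i)" and m: "fin_supp (m i)" for i
    unfolding p_def m_def
    by (intro fin_supp_map2[where \<phi> = "\<lambda>a b. \<phi> (a - b)"] fin_supp_shift u; simp add: \<phi>)+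
  have "(\<Sum>\<^sub>\<infinity>x. m i x) = (\<Sum>\<^sub>\<infinity>x. p i x)" for i
  proof -
    have "m i (x + unit_vec i) = p i x" for x
      using \<phi>(2)[of "u (x + unit_vec i) - u x"] by (simp add: m_def p_def)
    then show ?thesis using infsum_shift(1)[of "m i" "unit_vec i"] by simp
  qed
  moreover have "(\<Sum>\<^sub>\<infinity>x. \<Sum>y | adj x y. \<phi> (grad u x y))
      = (\<Sum>\<^sub>\<infinity>x. (\<Sum>i\<in>UNIV. p i x) + (\<Sum>i\<in>UNIV. m i x))"
    unfolding sum_neighbours grad_def p_def m_def ..
  moreover have "\<dots> = (\<Sum>\<^sub>\<infinity>x. \<Sum>i\<in>UNIV. p i x) + (\<Sum>\<^sub>\<infinity>x. \<Sum>i\<in>UNIV. m i x)"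
    by (intro infsum_add fin_supp_summable fin_supp_sum p m) auto
  moreover have "(\<Sum>\<^sub>\<infinity>x. \<Sum>i\<in>UNIV. p i x) = (\<Sum>i\<in>UNIV. \<Sum>\<^sub>\<infinity>x. p i x)"
    "(\<Sum>\<^sub>\<infinity>x. \<Sum>i\<in>UNIV. m i x) = (\<Sum>i\<in>UNIV. \<Sum>\<^sub>\<infinity>x. m i x)"
    by (intro infsum_sum fin_supp_summable p m; simp)+
  ultimately show ?thesis by (simp add: p_def)
qed

lemma fin_supp_grad:
  fixes u :: "int ^ 'n::finite \<Rightarrow> real"
  assumes "fin_supp u" "\<phi> 0 = (0::real)"
  shows "fin_supp (\<lambda>x. \<phi> (u (x + unit_vec i) - u x))"
  by (intro fin_supp_map2[where \<phi> = "\<lambda>a b. \<phi> (a - b)"] fin_supp_shift assms) (simp add: assms)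

lemma J_fin_supp:
  assumes "fin_supp u"
  shows "J u = (\<Sum>i\<in>UNIV. \<Sum>\<^sub>\<infinity>x. born_infeld (u (x + unit_vec i) - u x))"
proof -
  have "J u = 1 / 2 * (\<Sum>\<^sub>\<infinity>x. \<Sum>y | adj x y. born_infeld (grad u x y))"
    by (simp add: J_def born_infeld_def)
  also have "\<dots> = (\<Sum>\<^sub>\<infinity>x. \<Sum>i\<in>UNIV. born_infeld (u (x + unit_vec i) - u x))"
    using infsum_neighbours[OF assms, of born_infeld] by simp
  also have "\<dots> = (\<Sum>i\<in>UNIV. \<Sum>\<^sub>\<infinity>x. born_infeld (u (x + unit_vec i) - u x))"
    by (intro infsum_sum fin_supp_summable fin_supp_grad assms) auto
  finally show ?thesis .
qed

lemma J_nonneg: "0 \<le> J u"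
proof -
  have "J u = 1 / 2 * (\<Sum>\<^sub>\<infinity>x. \<Sum>y | adj x y. born_infeld (grad u x y))"
    by (simp add: J_def born_infeld_def)
  also have "0 \<le> \<dots>" by (intro mult_nonneg_nonneg infsum_nonneg sum_nonneg born_infeld_nonneg) auto
  finally show ?thesis .
qed

section \<open>Coarse graining\<close>

definition slope_bounded :: "(int ^ 'n::finite \<Rightarrow> real) \<Rightarrow> bool" where
  "slope_bounded u \<longleftrightarrow> (\<forall>x i. \<bar>u (x + unit_vec i) - u x\<bar> \<le> 1)"

lemma slope_boundedD: "slope_bounded u \<Longrightarrow> \<bar>u (x + unit_vec i) - u x\<bar> \<le> 1"
  by (simp add: slope_bounded_def)

definition second_diff :: "'n::finite \<Rightarrow> (int ^ 'n \<Rightarrow> real) \<Rightarrow> int ^ 'n \<Rightarrow> real" where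
  "second_diff i u x = 2 * u x - u (x - unit_vec i) - u (x + unit_vec i)"

definition power_sum :: "real \<Rightarrow> ('a \<Rightarrow> real) \<Rightarrow> real" where
  "power_sum \<alpha> u = (\<Sum>\<^sub>\<infinity>x. \<bar>u x\<bar> powr \<alpha>)"

lemma power_sum_nonneg: "0 \<le> power_sum \<alpha> u"
  unfolding power_sum_def by (intro infsum_nonneg) auto

definition parity_classes :: "(int ^ 'n::finite) set" where
  "parity_classes = {r. \<forall>i. r $ i \<in> {0, 1}}"

lemma finite_parity_classes [simp]: "finite parity_classes"
  unfolding parity_classes_def by (intro finite_vec_interval) auto

lemma card_parity_classes: "card (parity_classes :: (int ^ 'n::finite) set) = 2 ^ CARD('n)"
  unfolding parity_classes_def card_vec_interval by (simp add: numeral_2_eq_2)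

lemma inj_double_shift: "inj (\<lambda>x :: int ^ 'n::finite. x + x + r)"
proof (rule injI)
  fix x y :: "int ^ 'n" assume "x + x + r = y + y + r"
  then have "(x + x + r) $ i = (y + y + r) $ i" for i by simp
  then show "x = y" by (simp add: vec_eq_iff)
qed

lemma sum_parity_classes:
  fixes f :: "int ^ 'n::finite \<Rightarrow> real"
  assumes "fin_supp f"
  shows "(\<Sum>r\<in>parity_classes. \<Sum>\<^sub>\<infinity>x. f (x + x + r)) = (\<Sum>\<^sub>\<infinity>x. f x)"
proof -
  define B where "B r = range (\<lambda>x :: int ^ 'n. x + x + r)" for r
  have "(\<Sum>\<^sub>\<infinity>x. f (x + x + r)) = infsum f (B r)" for r
    unfolding B_def by (subst infsum_reindex[OF inj_double_shift]) (simp add: o_def)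
  then have "(\<Sum>r\<in>parity_classes. \<Sum>\<^sub>\<infinity>x. f (x + x + r)) = (\<Sum>r\<in>parity_classes. infsum f (B r))"
    by simp
  also have "\<dots> = infsum f (\<Union>r\<in>parity_classes. B r)"
  proof (rule sum_infsum)
    fix r s :: "int ^ 'n"
    assume rs: "r \<in> parity_classes" "s \<in> parity_classes" "r \<noteq> s"
    then obtain i where i: "r $ i \<noteq> s $ i" by (auto simp: vec_eq_iff)
    have "r $ i \<in> {0, 1}" "s $ i \<in> {0, 1}" using rs by (auto simp: parity_classes_def)
    then have "x + x + r \<noteq> y + y + s" for x y
    proof -
      have "x $ i + x $ i + r $ i \<noteq> y $ i + y $ i + s $ i"
        using i \<open>r $ i \<in> {0, 1}\<close> \<open>s $ i \<in> {0, 1}\<close> by auto presburger+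
      then show ?thesis by (metis vector_add_component)
    qed
    then show "B r \<inter> B s = {}" by (auto simp: B_def)
  qed (use assms in \<open>auto intro: fin_supp_summable\<close>)
  also have "(\<Union>r\<in>parity_classes. B r) = UNIV"
  proof -
    have "y \<in> (\<Union>r\<in>parity_classes. B r)" for y
    proof (rule UN_I)
      show "(\<chi> i. y $ i mod 2) \<in> parity_classes" by (auto simp add: parity_classes_def)
      show "y \<in> B (\<chi> i. y $ i mod 2)"
        unfolding B_def by (rule image_eqI[of _ _ "\<chi> i. y $ i div 2"]) (simp_all add: vec_eq_iff)
    qed
    then show ?thesis by blast
  qed
  finally show ?thesis .
qed

definition coarse :: "int ^ 'n::finite \<Rightarrow> (int ^ 'n \<Rightarrow> real) \<Rightarrow> int ^ 'n \<Rightarrow> real" where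
  "coarse r u x = u (x + x + r) / 2"

lemma fin_supp_coarse:
  assumes "fin_supp u"
  shows "fin_supp (coarse r u)"
  unfolding coarse_def
  by (rule fin_supp_map[where \<phi> = "\<lambda>t. t / 2"], rule fin_supp_comp_inj[OF assms inj_double_shift]) simp

lemma slope_bounded_coarse:
  assumes "slope_bounded u"
  shows "slope_bounded (coarse r u)"
  unfolding slope_bounded_def
proof (intro allI)
  fix x i
  define y where "y = x + x + r"
  have "\<bar>u (z + unit_vec i) - u z\<bar> \<le> 1" for z
    by (rule slope_boundedD[OF assms])
  note step = this[of "y + unit_vec i"] this[of y]
  have E: "x + unit_vec i + (x + unit_vec i) + r = y + unit_vec i + unit_vec i"
    by (simp add: y_def algebra_simps)
  show "\<bar>coarse r u (x + unit_vec i) - coarse r u x\<bar> \<le> 1"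
    unfolding coarse_def E y_def[symmetric] using step by linarith
qed

text \<open>A unit difference of \<open>coarse r u\<close> is the mean of two consecutive
  differences of \<open>u\<close>, so the midpoint inequality applies. Summing over all offsets
  visits each point once, and the two halves of the mean add up to \<open>J u\<close>.\<close>

lemma sum_J_coarse:
  fixes u :: "int ^ 'n::finite \<Rightarrow> real"
  assumes u: "fin_supp u" "slope_bounded u"
  shows "(\<Sum>r\<in>parity_classes. J (coarse r u))
    \<le> J u - (\<Sum>i\<in>UNIV. \<Sum>\<^sub>\<infinity>x. (second_diff i u x)\<^sup>2) / 8"
proof -
  define h b g where "h i y = born_infeld ((u (y + unit_vec i + unit_vec i) - u y) / 2)"
    and "b i y = born_infeld (u (y + unit_vec i) - u y)"
    and "g i y = (second_diff i u y)\<^sup>2" for i y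
  have u2: "fin_supp (\<lambda>y. u (y + unit_vec i + unit_vec i))" for i
    using fin_supp_shift(1)[OF u(1), of "unit_vec i + unit_vec i"] by (simp add: add.assoc)
  have fh: "fin_supp (h i)" for i unfolding h_def
    by (intro fin_supp_map2[where \<phi> = "\<lambda>a b. born_infeld ((a - b) / 2)"] u2 u) simp
  have fb: "fin_supp (b i)" for i unfolding b_def by (intro fin_supp_grad u) simp
  have fg: "fin_supp (g i)" for i
    unfolding g_def second_diff_def diff_diff_eq
    by (intro fin_supp_map2[where \<phi> = "\<lambda>a b. (2 * a - b)\<^sup>2"]
        fin_supp_map2[where \<phi> = "(+)"] fin_supp_shift u) auto
  have "J (coarse r u) = (\<Sum>i\<in>UNIV. \<Sum>\<^sub>\<infinity>x. h i (x + x + r))" for r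
  proof -
    have "x + unit_vec i + (x + unit_vec i) + r = x + x + r + unit_vec i + unit_vec i" for x i
      by (simp add: algebra_simps)
    then show ?thesis
      unfolding J_fin_supp[OF fin_supp_coarse[OF u(1)]] coarse_def h_def
      by (simp only: diff_divide_distrib)
  qed
  then have "(\<Sum>r\<in>parity_classes. J (coarse r u)) = (\<Sum>i\<in>UNIV. \<Sum>r\<in>parity_classes. \<Sum>\<^sub>\<infinity>x. h i (x + x + r))"
    by (simp add: sum.swap[of _ UNIV])
  also have "\<dots> = (\<Sum>i\<in>UNIV. \<Sum>\<^sub>\<infinity>x. h i x)" by (simp only: sum_parity_classes fh)
  also have "\<dots> \<le> (\<Sum>i\<in>UNIV. (\<Sum>\<^sub>\<infinity>x. b i x) - (\<Sum>\<^sub>\<infinity>x. g i x) / 8)"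
  proof (rule sum_mono)
    fix i
    have le: "h i y \<le> b i (y + unit_vec i) / 2 + (b i y / 2 + (- 1 / 8) * g i (y + unit_vec i))" for y
    proof -
      \<comment> \<open>Two consecutive differences along the same direction; they differ by the
        second difference at their common point, hence the shifted argument of
        \<open>g\<close>.\<close>
      define p q where "p = u (y + unit_vec i + unit_vec i) - u (y + unit_vec i)"
        and "q = u (y + unit_vec i) - u y"
      have "born_infeld ((p + q) / 2) \<le> (born_infeld p + born_infeld q) / 2 - (p - q)\<^sup>2 / 8"
        unfolding p_def q_def by (intro born_infeld_midpoint slope_boundedD u)
      moreover have "p - q = - second_diff i u (y + unit_vec i)"
        by (simp add: p_def q_def second_diff_def)
      then have "(p - q)\<^sup>2 = g i (y + unit_vec i)" by (simp only: g_def power2_minus)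
      ultimately show ?thesis
        by (simp add: h_def b_def p_def q_def add_divide_distrib)
    qed
    have s1: "fin_supp (\<lambda>y. b i (y + unit_vec i) / 2)"
      by (rule fin_supp_map[where \<phi> = "\<lambda>t. t / 2"]) (auto intro: fin_supp_shift fb)
    have s2: "fin_supp (\<lambda>y. b i y / 2)"
      by (rule fin_supp_map[where \<phi> = "\<lambda>t. t / 2"]) (auto intro: fb)
    have s3: "fin_supp (\<lambda>y. (- 1 / 8) * g i (y + unit_vec i))"
      by (rule fin_supp_map[where \<phi> = "\<lambda>t. (- 1 / 8) * t"]) (auto intro: fin_supp_shift fg)
    have s4: "fin_supp (\<lambda>y. b i y / 2 + (- 1 / 8) * g i (y + unit_vec i))"
      by (rule fin_supp_map2[where \<phi> = "(+)", OF s2 s3]) simp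
    have "(\<Sum>\<^sub>\<infinity>y. h i y) \<le> (\<Sum>\<^sub>\<infinity>y. b i (y + unit_vec i) / 2 + (b i y / 2 + (- 1 / 8) * g i (y + unit_vec i)))"
      by (intro infsum_mono_fin_supp le fh fin_supp_map2[where \<phi> = "(+)", OF s1 s4]) simp
    also have "\<dots> = (\<Sum>\<^sub>\<infinity>y. b i (y + unit_vec i) / 2) + ((\<Sum>\<^sub>\<infinity>y. b i y / 2) + (\<Sum>\<^sub>\<infinity>y. (- 1 / 8) * g i (y + unit_vec i)))"
      by (subst infsum_add, (intro fin_supp_summable s1 s4)+, subst infsum_add)
        (intro fin_supp_summable s2 s3 refl)+
    also have "(\<Sum>\<^sub>\<infinity>y. b i (y + unit_vec i) / 2) = (\<Sum>\<^sub>\<infinity>y. b i y / 2)"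
      by (rule infsum_shift(1)[of "\<lambda>y. b i y / 2"])
    also have "(\<Sum>\<^sub>\<infinity>y. (- 1 / 8) * g i (y + unit_vec i)) = (\<Sum>\<^sub>\<infinity>y. (- 1 / 8) * g i y)"
      by (rule infsum_shift(1)[of "\<lambda>y. (- 1 / 8) * g i y"])
    finally show "(\<Sum>\<^sub>\<infinity>x. h i x) \<le> (\<Sum>\<^sub>\<infinity>x. b i x) - (\<Sum>\<^sub>\<infinity>x. g i x) / 8"
      using infsum_cmult_right'[of "- 1 / 8" "g i" UNIV] infsum_cmult_left'[of "b i" "1 / 2" UNIV] by simp
  qed
  also have "\<dots> = J u - (\<Sum>i\<in>UNIV. \<Sum>\<^sub>\<infinity>x. (second_diff i u x)\<^sup>2) / 8"
    unfolding J_fin_supp[OF u(1)] b_def g_def by (simp add: sum_subtractf sum_divide_distrib)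
  finally show ?thesis .
qed

section \<open>Variation of the power sum between cosets\<close>

lemma
  fixes f g :: "'a \<Rightarrow> real"
  assumes "f summable_on A" "g summable_on A"
  shows infsum_diff: "(\<Sum>\<^sub>\<infinity>x\<in>A. f x - g x) = infsum f A - infsum g A"
    and summable_on_diff: "(\<lambda>x. f x - g x) summable_on A"
proof -
  have g: "(\<lambda>x. - g x) summable_on A" using assms by (simp add: summable_on_uminus)
  show "(\<Sum>\<^sub>\<infinity>x\<in>A. f x - g x) = infsum f A - infsum g A"
    using infsum_add[OF assms(1) g] by (simp add: infsum_uminus)
  show "(\<lambda>x. f x - g x) summable_on A" using summable_on_add[OF assms(1) g] by simp
qed

lemma fin_supp_second_diff:
  assumes "fin_supp u"
  shows "fin_supp (second_diff i u)"
  unfolding second_diff_def diff_diff_eq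
  by (intro fin_supp_map2[where \<phi> = "\<lambda>a b. 2 * a - b"]
      fin_supp_map2[where \<phi> = "(+)"] fin_supp_shift assms) auto

text \<open>Convexity bounds the remainder of \<open>u\<^sup>\<alpha>\<close> beyond its linear part by
  \<open>(u(y) - u(x)) (u(y)\<^sup>\<alpha>\<^sup>-\<^sup>1 - u(x)\<^sup>\<alpha>\<^sup>-\<^sup>1)\<close>, which sums by parts to the linear part again.\<close>

lemma infsum_second_diff_powr:
  fixes u :: "int ^ 'n::finite \<Rightarrow> real"
  assumes u: "fin_supp u" "\<And>x. 0 \<le> u x" and \<alpha>: "1 < \<alpha>"
  shows "(\<Sum>\<^sub>\<infinity>x. \<bar>second_diff i (\<lambda>x. u x powr \<alpha>) x\<bar>)
    \<le> 3 * \<alpha> * (\<Sum>\<^sub>\<infinity>x. u x powr (\<alpha> - 1) * \<bar>second_diff i u x\<bar>)"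
proof -
  define w where "w x = u x powr (\<alpha> - 1)" for x
  define P m q V where "P x = (u (x + unit_vec i) - u x) * (w (x + unit_vec i) - w x)"
    and "m x = w x * (u x - u (x - unit_vec i))"
    and "q x = w x * (u (x + unit_vec i) - u x)"
    and "V x = w x * \<bar>second_diff i u x\<bar>" for x
  have fw: "fin_supp w" unfolding w_def by (rule fin_supp_map[OF u(1)]) simp
  have fg: "fin_supp (\<lambda>x. u x powr \<alpha>)" by (rule fin_supp_map[OF u(1)]) simp
  have fP: "fin_supp P" unfolding P_def
    by (intro fin_supp_map2[where \<phi> = "(*)"] fin_supp_grad[where \<phi> = "\<lambda>t. t"] u fw) auto
  have fm: "fin_supp m" unfolding m_def
    by (intro fin_supp_map2[where \<phi> = "(*)"] fin_supp_map2[where \<phi> = "(-)"] fin_supp_shift u fw) auto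
  have fq: "fin_supp q" unfolding q_def
    by (intro fin_supp_map2[where \<phi> = "(*)"] fin_supp_grad[where \<phi> = "\<lambda>t. t"] u fw) auto
  have fV: "fin_supp V" unfolding V_def
    by (intro fin_supp_map2[where \<phi> = "\<lambda>a b. a * \<bar>b\<bar>"] fin_supp_second_diff u fw) auto
  \<comment> \<open>Summation by parts: \<open>m\<close> pairs \<open>w\<close> with the backward
    and \<open>q\<close> with the forward difference, so translating \<open>m\<close> leaves
    \<open>w\<close> times the second difference.\<close>
  have "(\<Sum>\<^sub>\<infinity>x. P x) = (\<Sum>\<^sub>\<infinity>x. m (x + unit_vec i) - q x)"
    by (rule infsum_cong) (simp add: P_def m_def q_def algebra_simps)
  also have "\<dots> = (\<Sum>\<^sub>\<infinity>x. m (x + unit_vec i)) - (\<Sum>\<^sub>\<infinity>x. q x)"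
    by (intro infsum_diff fin_supp_summable fin_supp_shift fm fq)
  also have "\<dots> = (\<Sum>\<^sub>\<infinity>x. m x) - (\<Sum>\<^sub>\<infinity>x. q x)" by (simp add: infsum_shift)
  also have "\<dots> = (\<Sum>\<^sub>\<infinity>x. m x - q x)"
    by (intro infsum_diff[symmetric] fin_supp_summable fin_supp_shift fm fq)
  also have "\<dots> \<le> (\<Sum>\<^sub>\<infinity>x. V x)"
  proof (rule infsum_mono_fin_supp)
    fix x
    have "m x - q x = w x * second_diff i u x"
      by (simp add: m_def q_def second_diff_def algebra_simps)
    then show "m x - q x \<le> V x" by (simp add: V_def w_def mult_left_mono)
  qed (intro fin_supp_map2[where \<phi> = "(-)"] fm fq fV; simp)+
  finally have PV: "(\<Sum>\<^sub>\<infinity>x. P x) \<le> (\<Sum>\<^sub>\<infinity>x. V x)" .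
  have fPs: "fin_supp (\<lambda>x. P x + P (x - unit_vec i))"
    by (intro fin_supp_map2[where \<phi> = "(+)"] fin_supp_shift fP) simp
  have "(\<Sum>\<^sub>\<infinity>x. \<bar>second_diff i (\<lambda>x. u x powr \<alpha>) x\<bar>) \<le> (\<Sum>\<^sub>\<infinity>x. \<alpha> * (V x + (P x + P (x - unit_vec i))))"
  proof (rule infsum_mono_fin_supp)
    show "fin_supp (\<lambda>x. \<bar>second_diff i (\<lambda>x. u x powr \<alpha>) x\<bar>)"
      by (intro fin_supp_map[where \<phi> = abs] fin_supp_second_diff fg) simp
    show "fin_supp (\<lambda>x. \<alpha> * (V x + (P x + P (x - unit_vec i))))"
      by (rule fin_supp_map2[where \<phi> = "\<lambda>a b. \<alpha> * (a + b)", OF fV fPs]) simp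
    show "\<bar>second_diff i (\<lambda>x. u x powr \<alpha>) x\<bar> \<le> \<alpha> * (V x + (P x + P (x - unit_vec i)))" for x
      using powr_second_difference[of "u (x - unit_vec i)" "u x" "u (x + unit_vec i)" \<alpha>] u \<alpha>
      by (simp add: second_diff_def V_def P_def w_def algebra_simps)
  qed
  also have "\<dots> = \<alpha> * ((\<Sum>\<^sub>\<infinity>x. V x) + ((\<Sum>\<^sub>\<infinity>x. P x) + (\<Sum>\<^sub>\<infinity>x. P (x - unit_vec i))))"
    unfolding infsum_cmult_right'
    by (subst infsum_add, (intro fin_supp_summable fV fPs)+, subst infsum_add)
      (intro fin_supp_summable fP fin_supp_shift refl)+
  \<comment> \<open>The 3 counts \<open>V\<close> itself, \<open>P\<close>, and the translate of
    \<open>P\<close>, which has the same sum.\<close>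
  also have "\<dots> \<le> 3 * \<alpha> * (\<Sum>\<^sub>\<infinity>x. V x)"
    using PV \<alpha> by (simp add: infsum_shift algebra_simps)
  finally show ?thesis by (simp add: V_def w_def)
qed

text \<open>Shifting \<open>r\<close> by \<open>2 e\<^sub>i\<close> does not change the sum, so the difference below is half a sum of
  second differences along a sublattice.\<close>

lemma sublattice_sum_step:
  fixes g :: "int ^ 'n::finite \<Rightarrow> real"
  assumes g: "fin_supp g"
  shows "\<bar>(\<Sum>\<^sub>\<infinity>x. g (x + x + (r + unit_vec i))) - (\<Sum>\<^sub>\<infinity>x. g (x + x + r))\<bar>
    \<le> (\<Sum>\<^sub>\<infinity>x. \<bar>second_diff i g x\<bar>) / 2"
proof -
  define F where "F r = (\<Sum>\<^sub>\<infinity>x. g (x + x + r))" for r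
  define d where "d x = second_diff i g x" for x
  have fd: "fin_supp d" unfolding d_def by (rule fin_supp_second_diff[OF g])
  have s: "(\<lambda>x. g (x + x + r)) summable_on UNIV" for r
    by (intro fin_supp_summable fin_supp_comp_inj[OF g] inj_double_shift)
  have "F (r - unit_vec i) = (\<Sum>\<^sub>\<infinity>x. g ((x + unit_vec i) + (x + unit_vec i) + (r - unit_vec i)))"
    unfolding F_def by (rule infsum_shift(1)[symmetric])
  also have "\<dots> = F (r + unit_vec i)"
    unfolding F_def by (rule infsum_cong) (simp add: algebra_simps)
  finally have F: "F (r - unit_vec i) = F (r + unit_vec i)" .
  have "(\<Sum>\<^sub>\<infinity>x. d (x + x + r)) = (\<Sum>\<^sub>\<infinity>x. (2 * g (x + x + r) - g (x + x + (r - unit_vec i))) - g (x + x + (r + unit_vec i)))"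
    by (rule infsum_cong) (simp add: d_def second_diff_def algebra_simps)
  also have "\<dots> = 2 * F r - F (r - unit_vec i) - F (r + unit_vec i)"
    unfolding F_def
    by (subst infsum_diff, (intro summable_on_diff summable_on_cmult_right s)+,
        subst infsum_diff, (intro summable_on_cmult_right s)+) (simp add: infsum_cmult_right')
  finally have "\<bar>2 * (F (r + unit_vec i) - F r)\<bar> = \<bar>\<Sum>\<^sub>\<infinity>x. d (x + x + r)\<bar>"
    using F by simp
  also have "\<dots> \<le> (\<Sum>\<^sub>\<infinity>x. \<bar>d (x + x + r)\<bar>)"
  proof -
    have "fin_supp (\<lambda>x. \<bar>d (x + x + r)\<bar>)"
      by (rule fin_supp_map[where \<phi> = abs], rule fin_supp_comp_inj[OF fd inj_double_shift]) simp
    then show ?thesis using norm_infsum_bound[of "\<lambda>x. d (x + x + r)" UNIV]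
      by (simp add: fin_supp_summable)
  qed
  also have "\<dots> = infsum (\<lambda>y. \<bar>d y\<bar>) (range (\<lambda>x. x + x + r))"
    by (subst infsum_reindex[OF inj_double_shift]) (simp add: o_def)
  also have "\<dots> \<le> (\<Sum>\<^sub>\<infinity>x. \<bar>d x\<bar>)"
    by (intro infsum_mono2 fin_supp_summable fin_supp_map[where \<phi> = abs] fd) auto
  finally have "2 * \<bar>F (r + unit_vec i) - F r\<bar> \<le> (\<Sum>\<^sub>\<infinity>x. \<bar>d x\<bar>)"
    by (simp only: abs_mult abs_numeral)
  then have "\<bar>F (r + unit_vec i) - F r\<bar> \<le> (\<Sum>\<^sub>\<infinity>x. \<bar>d x\<bar>) / 2" by (simp only: pos_le_divide_eq zero_less_numeral mult.commute)
  then show ?thesis by (simp only: F_def d_def)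
qed

lemma l1_dist_parity_classes:
  assumes "r \<in> parity_classes" "s \<in> parity_classes"
  shows "l1_dist r (s :: int ^ 'n::finite) \<le> CARD('n)"
proof -
  have "\<bar>r $ i - s $ i\<bar> \<le> 1" for i
    using assms by (auto simp: parity_classes_def abs_le_iff) (smt (verit))+
  then have "(\<Sum>i\<in>UNIV. \<bar>r $ i - s $ i\<bar>) \<le> (\<Sum>i\<in>(UNIV :: 'n set). 1)" by (intro sum_mono)
  then show ?thesis by (simp add: l1_dist_def)
qed

text \<open>Offsets in {0, 1}^N are joined by at most N unit steps, each changing the coset sum by
  at most \<open>d\<close>. The constant collects 9/4 from the squared factor 3/2 of a step, N^2
  from the path length and one more N from Cauchy--Schwarz over the directions; a second
  Cauchy--Schwarz splits each \<open>W i\<close> into \<open>V\<close> and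
  \<open>G i\<close>.\<close>

lemma sublattice_power_sum_deviation:
  fixes u :: "int ^ 'n::finite \<Rightarrow> real"
  assumes u: "fin_supp u" "\<And>x. 0 \<le> u x" and \<alpha>: "1 < \<alpha>"
    and rs: "r \<in> parity_classes" "s \<in> parity_classes"
  shows "((\<Sum>\<^sub>\<infinity>x. u (x + x + r) powr \<alpha>) - (\<Sum>\<^sub>\<infinity>x. u (x + x + s) powr \<alpha>))\<^sup>2
    \<le> 9 / 4 * \<alpha>\<^sup>2 * real CARD('n) ^ 3 * (\<Sum>\<^sub>\<infinity>x. u x powr (2 * \<alpha> - 2))
      * (\<Sum>i\<in>UNIV. \<Sum>\<^sub>\<infinity>x. (second_diff i u x)\<^sup>2)"
proof -
  define N where "N = real CARD('n)"
  define V where "V = (\<Sum>\<^sub>\<infinity>x. u x powr (2 * \<alpha> - 2))"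
  define G where "G i = (\<Sum>\<^sub>\<infinity>x. (second_diff i u x)\<^sup>2)" for i
  define W where "W i = (\<Sum>\<^sub>\<infinity>x. u x powr (\<alpha> - 1) * \<bar>second_diff i u x\<bar>)" for i
  define F where "F r = (\<Sum>\<^sub>\<infinity>x. u (x + x + r) powr \<alpha>)" for r
  define d where "d = 3 / 2 * \<alpha> * (\<Sum>i\<in>UNIV. W i)"
  have W: "0 \<le> W i" for i unfolding W_def by (intro infsum_nonneg) auto
  have fg: "fin_supp (\<lambda>x. u x powr a)" for a by (rule fin_supp_map[OF u(1)]) simp
  have "\<bar>F (r + unit_vec i) - F r\<bar> \<le> d" for r i
  proof -
    have "\<bar>F (r + unit_vec i) - F r\<bar> \<le> 3 * \<alpha> * W i / 2"
      unfolding F_def W_def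
      by (rule order_trans[OF sublattice_sum_step[OF fg[of \<alpha>]] divide_right_mono[OF infsum_second_diff_powr]])
        (use u \<alpha> in auto)
    also have "\<dots> = 3 / 2 * \<alpha> * W i" by simp
    also have "\<dots> \<le> d" unfolding d_def
      using W \<alpha> by (intro mult_left_mono member_le_sum) auto
    finally show ?thesis .
  qed
  then have "\<bar>F r - F s\<bar> \<le> d * l1_dist r s" by (rule unit_steps_lipschitz)
  also have "\<dots> \<le> d * N"
    using l1_dist_parity_classes[OF rs] W \<alpha> unfolding N_def d_def
    by (intro mult_left_mono mult_nonneg_nonneg sum_nonneg) auto
  finally have "\<bar>F r - F s\<bar> \<le> d * N" .
  then have "(F r - F s)\<^sup>2 \<le> (d * N)\<^sup>2" by (metis abs_ge_zero power2_abs power_mono)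
  also have "\<dots> = 9 / 4 * \<alpha>\<^sup>2 * N\<^sup>2 * (\<Sum>i\<in>UNIV. W i)\<^sup>2"
    by (simp add: d_def power_mult_distrib power_divide)
  also have "\<dots> \<le> 9 / 4 * \<alpha>\<^sup>2 * N\<^sup>2 * (N * (\<Sum>i\<in>UNIV. (W i)\<^sup>2))"
    using Cauchy_Schwarz_ineq_sum[of "\<lambda>_. 1" W UNIV] unfolding N_def by (intro mult_left_mono) auto
  also have "\<dots> \<le> 9 / 4 * \<alpha>\<^sup>2 * N\<^sup>2 * (N * (\<Sum>i\<in>UNIV. V * G i))"
  proof (intro mult_left_mono sum_mono)
    fix i
    have "(W i)\<^sup>2 \<le> (\<Sum>\<^sub>\<infinity>x. (u x powr (\<alpha> - 1))\<^sup>2) * (\<Sum>\<^sub>\<infinity>x. \<bar>second_diff i u x\<bar>\<^sup>2)"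
      unfolding W_def
      by (intro infsum_Cauchy_Schwarz fg fin_supp_map[where \<phi> = abs] fin_supp_second_diff u) simp
    also have "(\<lambda>x. (u x powr (\<alpha> - 1))\<^sup>2) = (\<lambda>x. u x powr (2 * \<alpha> - 2))"
      by (simp add: power2_eq_square flip: powr_add)
    finally show "(W i)\<^sup>2 \<le> V * G i" by (simp add: V_def G_def)
  qed (auto simp: N_def)
  also have "\<dots> = 9 / 4 * \<alpha>\<^sup>2 * N ^ 3 * V * (\<Sum>i\<in>UNIV. G i)"
    by (simp add: power2_eq_square power3_eq_cube flip: sum_distrib_left)
  finally show ?thesis by (simp add: F_def G_def V_def N_def)
qed

section \<open>One step of the descent\<close>

definition admissible :: "(int ^ 'n::finite \<Rightarrow> real) \<Rightarrow> bool" where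
  "admissible u \<longleftrightarrow> fin_supp u \<and> (\<forall>x. 0 \<le> u x) \<and> slope_bounded u"

lemma power_sum_coarse:
  assumes "\<And>x. 0 \<le> u x"
  shows "power_sum \<alpha> (coarse r u) = 2 powr (- \<alpha>) * (\<Sum>\<^sub>\<infinity>x. u (x + x + r) powr \<alpha>)"
proof -
  have "\<bar>coarse r u x\<bar> powr \<alpha> = 2 powr (- \<alpha>) * u (x + x + r) powr \<alpha>" for x
    unfolding coarse_def using assms[of "x + x + r"] by (simp add: powr_divide powr_minus_divide)
  then show ?thesis by (simp only: power_sum_def infsum_cmult_right')
qed

lemma admissible_coarse: "admissible u \<Longrightarrow> admissible (coarse r u)"
  by (simp add: admissible_def fin_supp_coarse slope_bounded_coarse) (simp add: coarse_def)

text \<open>If every coset of positive mass had a quotient above q, adding up would make q times the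
  sum of the f^A smaller than J u - G / 8. That sum also equals q s^A up to the concavity loss, so
  the loss would exceed the gain, against \<open>small\<close>. The halving comes from 2^(-\<alpha>)
  <= 1/2 and makes the iteration finite.\<close>

lemma coarse_descent:
  fixes u :: "int ^ 'n::finite \<Rightarrow> real"
  defines "N \<equiv> real CARD('n)"
  assumes u: "admissible u" and \<alpha>: "1 < \<alpha>" and A: "A = N / (N + \<alpha>)"
    and s: "s = power_sum \<alpha> u" "0 < s" and q: "J u \<le> q * s powr A"
    and small: "18 * (2 ^ CARD('n))\<^sup>2 * N ^ 3 * \<alpha>\<^sup>2 * (q * s powr A) * (\<Sum>\<^sub>\<infinity>x. u x powr (2 * \<alpha> - 2)) \<le> s\<^sup>2"
  obtains v :: "int ^ 'n \<Rightarrow> real" where "admissible v" "0 < power_sum \<alpha> v" "power_sum \<alpha> v \<le> s / 2"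
    "J v \<le> q * power_sum \<alpha> v powr A"
proof -
  have u': "fin_supp u" "\<And>x. 0 \<le> u x" "slope_bounded u" using u by (auto simp: admissible_def)
  have N: "0 < N" by (simp add: N_def)
  have A01: "0 < A" "A < 1" using N \<alpha> by (auto simp: A field_simps)
  have qs: "0 \<le> q * s powr A" using q J_nonneg[of u] by linarith
  then have q0: "0 \<le> q" using s by (simp add: zero_le_mult_iff)
  define n :: real where "n = 2 ^ CARD('n)"
  have n: "0 < n" "n = 2 powr N" "n = real (card (parity_classes :: (int ^ 'n) set))"
    by (auto simp: n_def N_def powr_realpow card_parity_classes)
  define F where "F r = (\<Sum>\<^sub>\<infinity>x. u (x + x + r) powr \<alpha>)" for r
  define f where "f r = power_sum \<alpha> (coarse r u)" for r
  have fF: "f r = 2 powr (- \<alpha>) * F r" for r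
    unfolding f_def F_def by (rule power_sum_coarse) (rule u')
  have F0: "0 \<le> F r" for r unfolding F_def by (intro infsum_nonneg) auto
  have sumF: "(\<Sum>r\<in>parity_classes. F r) = s"
  proof -
    have "(\<Sum>r\<in>parity_classes. F r) = (\<Sum>\<^sub>\<infinity>x. u x powr \<alpha>)"
      unfolding F_def by (rule sum_parity_classes[OF fin_supp_map[OF u'(1)]]) simp
    then show ?thesis using u'(2) by (simp add: s power_sum_def)
  qed
  have "\<exists>r\<in>parity_classes. 0 < f r \<and> J (coarse r u) \<le> q * f r powr A"
  proof (rule ccontr)
    assume "\<not> ?thesis"
    then have bad: "q * f r powr A < J (coarse r u)" if "r \<in> parity_classes" "0 < f r" for r
      using that by force
    define V G where "V = (\<Sum>\<^sub>\<infinity>x. u x powr (2 * \<alpha> - 2))"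
      and "G = (\<Sum>i\<in>UNIV. \<Sum>\<^sub>\<infinity>x. (second_diff i u x)\<^sup>2)"
    define K where "K = 9 / 4 * \<alpha>\<^sup>2 * N ^ 3 * V * G"
    \<comment> \<open>The mass of a coset relative to the mean \<open>s / n\<close>. Its average is
      1, so the linear term A (p - 1) cancels in the sum and only squared deviations remain.\<close>
    define p where "p r = n * F r / s" for r
    have K: "(F r - F r')\<^sup>2 \<le> K" if "r \<in> parity_classes" "r' \<in> parity_classes" for r r'
      unfolding F_def K_def V_def G_def N_def
      by (rule sublattice_power_sum_deviation[OF u'(1,2) \<alpha> that])
    have dev: "(p r - 1)\<^sup>2 \<le> n\<^sup>2 * K / s\<^sup>2" if r: "r \<in> parity_classes" for r
    proof -
      have "p r - 1 = (\<Sum>r'\<in>parity_classes. F r - F r') / s"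
        using s(2) sumF n(3) by (simp add: p_def sum_subtractf field_simps)
      then have "(p r - 1)\<^sup>2 = (\<Sum>r'\<in>parity_classes. 1 * (F r - F r'))\<^sup>2 / s\<^sup>2"
        by (simp add: power_divide)
      also have "\<dots> \<le> (n * (\<Sum>r'\<in>parity_classes. (F r - F r')\<^sup>2)) / s\<^sup>2"
        using Cauchy_Schwarz_ineq_sum[of "\<lambda>_. 1" "\<lambda>r'. F r - F r'" parity_classes] n(3)
        by (intro divide_right_mono) auto
      also have "\<dots> \<le> (n * (\<Sum>r'\<in>(parity_classes :: (int ^ 'n) set). K)) / s\<^sup>2"
        using n(1) by (intro divide_right_mono mult_left_mono sum_mono K r) auto
      also have "\<dots> = n\<^sup>2 * K / s\<^sup>2" using n(3) by (simp add: power2_eq_square)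
      finally show ?thesis .
    qed
    have p0: "0 \<le> p r" for r using n F0 s by (simp add: p_def)
    have sump: "(\<Sum>r\<in>parity_classes. p r) = n"
      unfolding p_def sum_divide_distrib[symmetric] sum_distrib_left[symmetric] sumF using s by simp
    \<comment> \<open>The value of A enters here: (N + \<alpha>) A = N turns the factor
      2^(-N-\<alpha>) into 1 / n, exactly compensating the number of cosets.\<close>
    have fp: "f r powr A = s powr A / n * p r powr A" for r
    proof -
      have "f r = s * (2 powr (- (N + \<alpha>)) * p r)"
        using s by (simp add: fF p_def n(2) powr_minus powr_diff field_simps)
      also have "\<dots> powr A = s powr A * ((2 powr (- (N + \<alpha>))) powr A * p r powr A)"
        using s p0 by (simp add: powr_mult)
      also have "(2 powr (- (N + \<alpha>))) powr A = 1 / n"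
      proof -
        have "(N + \<alpha>) * A = N" using N \<alpha> by (simp add: A)
        then have "- (N + \<alpha>) * A = - N" by (simp only: mult_minus_left)
        with powr_powr[of 2 "- (N + \<alpha>)" A] have "(2 powr (- (N + \<alpha>))) powr A = 2 powr (- N)" by (simp only:)
        then show ?thesis by (simp only: n(2) powr_minus_divide)
      qed
      finally show ?thesis by simp
    qed
    have cancel: "s powr A / n * (n - n * Y) = s powr A * (1 - Y)" for Y
      using n(1) by (simp add: field_simps)
    have "s powr A / n * (n - n * (n\<^sup>2 * K / s\<^sup>2))
        = (\<Sum>r\<in>parity_classes. s powr A / n * (1 + A * (p r - 1) - n\<^sup>2 * K / s\<^sup>2))"
      unfolding sum_distrib_left[symmetric]
      by (simp add: sum.distrib sum_subtractf sump flip: sum_distrib_left n(3))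
    also have "\<dots> \<le> (\<Sum>r\<in>parity_classes. f r powr A)"
      unfolding fp
    proof (intro sum_mono mult_left_mono)
      fix r :: "int ^ 'n" assume r: "r \<in> parity_classes"
      show "1 + A * (p r - 1) - n\<^sup>2 * K / s\<^sup>2 \<le> p r powr A"
        using powr_ge_tangent_minus_square[OF p0[of r] A01] dev[OF r] by linarith
    qed (use s n in auto)
    finally have "s powr A * (1 - n\<^sup>2 * K / s\<^sup>2) \<le> (\<Sum>r\<in>parity_classes. f r powr A)"
      by (simp only: cancel)
    then have "q * (s powr A * (1 - n\<^sup>2 * K / s\<^sup>2)) \<le> q * (\<Sum>r\<in>parity_classes. f r powr A)"
      using q0 by (rule mult_left_mono)
    also have "\<dots> = (\<Sum>r\<in>parity_classes. q * f r powr A)" by (simp add: sum_distrib_left)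
    also have "\<dots> < (\<Sum>r\<in>parity_classes. J (coarse r u))"
    proof (rule sum_strict_mono_ex1)
      show "\<forall>r\<in>parity_classes. q * f r powr A \<le> J (coarse r u)"
      proof
        fix r :: "int ^ 'n" assume r: "r \<in> parity_classes"
        show "q * f r powr A \<le> J (coarse r u)"
        proof (cases "0 < f r")
          case True
          then show ?thesis using bad[OF r] by simp
        next
          \<comment> \<open>A coset without mass is not covered by \<open>bad\<close>; there 0 powr
            A = 0. Strictness will come from some coset that does carry mass.\<close>
          case False
          then have "f r = 0" using F0[of r] fF[of r] by (simp add: not_less mult_le_0_iff)
          then show ?thesis by (simp add: J_nonneg)
        qed
      qed
      obtain r :: "int ^ 'n" where "r \<in> parity_classes" "0 < F r"
        using sumF s(2) by (metis linorder_not_less sum_nonpos)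
      then show "\<exists>r\<in>parity_classes. q * f r powr A < J (coarse r u)"
        using bad[of r] fF[of r] by (intro bexI[of _ r]) simp_all
    qed simp
    also have "\<dots> \<le> J u - G / 8" unfolding G_def by (rule sum_J_coarse) (rule u')+
    also have "q * (s powr A * (1 - n\<^sup>2 * K / s\<^sup>2)) = q * s powr A - q * s powr A * (n\<^sup>2 * K / s\<^sup>2)"
      by (simp add: right_diff_distrib)
    finally have strict: "G / 8 < q * s powr A * (n\<^sup>2 * K / s\<^sup>2)"
      using q by linarith
    have G: "0 \<le> G" unfolding G_def by (intro sum_nonneg infsum_nonneg) auto
    \<comment> \<open>The 18 in \<open>small\<close> is 8 times 9/4: the 8 matches the gain G / 8,
      and 9/4 is the factor in \<open>K\<close>.\<close>
    have "q * s powr A * (n\<^sup>2 * K / s\<^sup>2) = (18 * n\<^sup>2 * N ^ 3 * \<alpha>\<^sup>2 * (q * s powr A) * V) / s\<^sup>2 * (G / 8)"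
      by (simp add: K_def)
    also have "\<dots> \<le> 1 * (G / 8)"
      using small G s(2) by (intro mult_right_mono) (auto simp: n_def V_def)
    finally show False using strict by simp
  qed
  then obtain r where r: "r \<in> parity_classes" "0 < f r" "J (coarse r u) \<le> q * f r powr A" by blast
  have "f r \<le> s / 2"
  proof -
    have "F r \<le> s" unfolding sumF[symmetric] using r F0 by (intro member_le_sum) auto
    moreover have "2 powr (- \<alpha>) \<le> 2 powr (- 1 :: real)" using \<alpha> by (intro powr_mono) auto
    then have "2 powr (- \<alpha>) \<le> 1 / 2" by (simp add: powr_minus)
    ultimately have "2 powr (- \<alpha>) * F r \<le> 1 / 2 * s" using F0 by (intro mult_mono) auto
    then show ?thesis by (simp add: fF)
  qed
  with r show thesis using admissible_coarse[OF u, of r] by (intro that[of "coarse r u"]) (auto simp: f_def)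
qed

text \<open>By the slope bound \<open>u\<close> stays above h / 2 on the cube x + {0..m}^N with m
  the integer part of h / (2 N), since its points have l1 distance at most N m <= h / 2 from x. The
  cube has (m + 1)^N points; the + 1 makes the estimate valid for small heights as well.\<close>

lemma power_sum_ge_height:
  fixes u :: "int ^ 'n::finite \<Rightarrow> real"
  defines "N \<equiv> real CARD('n)"
  assumes u: "admissible u" and \<alpha>: "0 < \<alpha>"
  shows "(1 / 2) powr \<alpha> * (1 / (2 * N)) powr N * u x powr (N + \<alpha>) \<le> power_sum \<alpha> u"
proof -
  have u': "fin_supp u" "0 \<le> u y" "slope_bounded u" for y using u by (auto simp: admissible_def)
  have N: "0 < N" by (simp add: N_def)
  define h m where "h = u x" and "m = nat \<lfloor>h / (2 * N)\<rfloor>"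
  have h: "0 \<le> h" by (simp add: h_def u')
  have "0 \<le> \<lfloor>h / (2 * N)\<rfloor>" using h N by simp
  then have "real m = of_int \<lfloor>h / (2 * N)\<rfloor>" unfolding m_def by simp
  then have m: "real m \<le> h / (2 * N)" "h / (2 * N) \<le> real (Suc m)" by linarith+
  define B :: "(int ^ 'n) set" where "B = {z. \<forall>i. z $ i \<in> {0..int m}}"
  have B: "finite B" unfolding B_def by (intro finite_vec_interval) simp
  have card_B: "card B = Suc m ^ CARD('n)"
    unfolding B_def card_vec_interval by (simp add: nat_add_distrib)
  have low: "h / 2 \<le> u (x + z)" if z: "z \<in> B" for z
  proof -
    have "(\<Sum>i\<in>UNIV. \<bar>x $ i - (x + z) $ i\<bar>) \<le> (\<Sum>i\<in>(UNIV :: 'n set). int m)"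
      using z by (intro sum_mono) (auto simp: B_def)
    then have "l1_dist x (x + z) \<le> CARD('n) * m"
      unfolding l1_dist_def by (subst nat_le_iff) simp
    then have l1: "real (l1_dist x (x + z)) \<le> N * real m"
      unfolding N_def of_nat_mult[symmetric] of_nat_le_iff .
    have "\<bar>u x - u (x + z)\<bar> \<le> 1 * real (l1_dist x (x + z))"
      by (rule unit_steps_lipschitz) (rule slope_boundedD[OF u'(3)])
    moreover have "N * real m \<le> h / 2" using m(1) N by (simp add: field_simps)
    ultimately show ?thesis using l1 by (simp add: h_def)
  qed
  have "(1 / 2) powr \<alpha> * (1 / (2 * N)) powr N * h powr (N + \<alpha>) = (h / (2 * N)) powr N * (h / 2) powr \<alpha>"
    using h N by (simp add: powr_divide powr_add)
  also have "\<dots> \<le> real (Suc m) powr N * (h / 2) powr \<alpha>"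
    using m N h by (intro mult_right_mono powr_mono2) auto
  also have "\<dots> = (\<Sum>z\<in>B. (h / 2) powr \<alpha>)"
    by (simp add: card_B N_def powr_realpow del: of_nat_Suc)
  also have "\<dots> \<le> (\<Sum>z\<in>B. \<bar>u (x + z)\<bar> powr \<alpha>)"
    using h \<alpha> low u' by (intro sum_mono powr_mono2) auto
  also have "\<dots> = (\<Sum>y\<in>(+) x ` B. \<bar>u y\<bar> powr \<alpha>)" by (subst sum.reindex) auto
  also have "\<dots> \<le> power_sum \<alpha> u"
    unfolding power_sum_def using B
    by (intro finite_sum_le_infsum fin_supp_summable fin_supp_map[OF u'(1)]) auto
  finally show ?thesis by (simp add: h_def)
qed

text \<open>Split 2 \<alpha> - 2 = (\<alpha> - 2) + \<alpha> and bound the first power by the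
  maximal height.\<close>

lemma infsum_powr_le_height:
  fixes u :: "int ^ 'n::finite \<Rightarrow> real"
  defines "N \<equiv> real CARD('n)"
  assumes u: "admissible u" and \<alpha>: "2 < \<alpha>"
    and c: "c = (1 / 2) powr \<alpha> * (1 / (2 * N)) powr N"
  shows "(\<Sum>\<^sub>\<infinity>x. u x powr (2 * \<alpha> - 2)) \<le> (power_sum \<alpha> u / c) powr ((\<alpha> - 2) / (N + \<alpha>)) * power_sum \<alpha> u"
proof -
  have u': "fin_supp u" "0 \<le> u y" for y using u by (auto simp: admissible_def)
  have N: "0 < N" by (simp add: N_def)
  then have c0: "0 < c" by (simp add: c)
  define s where "s = power_sum \<alpha> u"
  have le: "u x powr (\<alpha> - 2) \<le> (s / c) powr ((\<alpha> - 2) / (N + \<alpha>))" for x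
  proof -
    have "c * u x powr (N + \<alpha>) \<le> s"
      unfolding c s_def N_def using \<alpha> by (intro power_sum_ge_height[OF u]) auto
    then have "u x powr (N + \<alpha>) \<le> s / c" using c0 by (simp add: pos_le_divide_eq mult.commute)
    then have "(u x powr (N + \<alpha>)) powr ((\<alpha> - 2) / (N + \<alpha>)) \<le> (s / c) powr ((\<alpha> - 2) / (N + \<alpha>))"
      using \<alpha> N by (intro powr_mono2) auto
    then show ?thesis using \<alpha> N by (simp add: powr_powr)
  qed
  have f: "fin_supp (\<lambda>x. u x powr a)" for a by (rule fin_supp_map[OF u'(1)]) simp
  have "(\<Sum>\<^sub>\<infinity>x. u x powr (2 * \<alpha> - 2)) \<le> (\<Sum>\<^sub>\<infinity>x. (s / c) powr ((\<alpha> - 2) / (N + \<alpha>)) * u x powr \<alpha>)"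
  proof (rule infsum_mono_fin_supp[OF f])
    show "fin_supp (\<lambda>x. (s / c) powr ((\<alpha> - 2) / (N + \<alpha>)) * u x powr \<alpha>)"
      by (rule fin_supp_map[OF f]) simp
    have "u x powr (2 * \<alpha> - 2) = u x powr (\<alpha> - 2) * u x powr \<alpha>" for x
      by (simp flip: powr_add)
    then show "u x powr (2 * \<alpha> - 2) \<le> (s / c) powr ((\<alpha> - 2) / (N + \<alpha>)) * u x powr \<alpha>" for x
      using le[of x] by (simp add: mult_right_mono)
  qed
  also have "\<dots> = (s / c) powr ((\<alpha> - 2) / (N + \<alpha>)) * s"
    unfolding infsum_cmult_right' s_def power_sum_def using u'(2) by simp
  finally show ?thesis by (simp add: s_def)
qed

text \<open>\<open>M\<close> is chosen before \<open>q\<close> and \<open>u\<close>, so the bound is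
  uniform along a minimizing sequence whose \<open>q\<close> tends to the infimum.\<close>

lemma descend_to_bounded_power_sum:
  fixes Q \<alpha> :: real
  defines "N \<equiv> real CARD('n::finite)"
  assumes \<alpha>: "2 < \<alpha>" and Q: "0 \<le> Q" and A: "A = N / (N + \<alpha>)"
  shows "\<exists>M. \<forall>q. \<forall>u :: int ^ 'n \<Rightarrow> real. 0 \<le> q \<longrightarrow> q \<le> Q \<longrightarrow> admissible u \<longrightarrow> 0 < power_sum \<alpha> u \<longrightarrow> J u \<le> q * power_sum \<alpha> u powr A \<longrightarrow>
    (\<exists>v :: int ^ 'n \<Rightarrow> real. admissible v \<and> 0 < power_sum \<alpha> v \<and> power_sum \<alpha> v \<le> M
        \<and> J v \<le> q * power_sum \<alpha> v powr A)"
proof -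
  have N: "0 < N" by (simp add: N_def)
  define c where "c = (1 / 2) powr \<alpha> * (1 / (2 * N)) powr N"
  define C where "C = 18 * (2 ^ CARD('n))\<^sup>2 * N ^ 3 * \<alpha>\<^sup>2 * Q / c powr ((\<alpha> - 2) / (N + \<alpha>))"
  \<comment> \<open>The descent needs C s^(2 - 2/(N+\<alpha>)) <= s^2, that is, s at least
    C^((N+\<alpha>)/2). The maximum with 1 keeps \<open>M\<close> positive when \<open>C\<close> is
    0.\<close>
  define M where "M = max 1 (C powr ((N + \<alpha>) / 2))"
  have c: "0 < c" using N by (simp add: c_def)
  have C: "0 \<le> C" using N c Q by (simp add: C_def)
  have M: "0 < M" by (simp add: M_def)
  have step: "\<exists>v :: int ^ 'n \<Rightarrow> real. admissible v \<and> 0 < power_sum \<alpha> v \<and> power_sum \<alpha> v \<le> power_sum \<alpha> u / 2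
      \<and> J v \<le> q * power_sum \<alpha> v powr A"
    if q: "0 \<le> q" "q \<le> Q" and u: "admissible u" "M \<le> power_sum \<alpha> u" "J u \<le> q * power_sum \<alpha> u powr A"
    for q and u :: "int ^ 'n \<Rightarrow> real"
  proof -
    define s where "s = power_sum \<alpha> u"
    have s: "M \<le> s" "0 < s" using u M by (auto simp: s_def)
    define k where "k = 18 * (2 ^ CARD('n))\<^sup>2 * N ^ 3 * \<alpha>\<^sup>2 * (q * s powr A)"
    have k: "0 \<le> k" using N q by (simp add: k_def)
    have "k * (\<Sum>\<^sub>\<infinity>x. u x powr (2 * \<alpha> - 2)) \<le> k * ((s / c) powr ((\<alpha> - 2) / (N + \<alpha>)) * s)"
      unfolding s_def by (intro mult_left_mono k infsum_powr_le_height[OF u(1) \<alpha>, folded N_def] c_def)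
    also have "\<dots> \<le> 18 * (2 ^ CARD('n))\<^sup>2 * N ^ 3 * \<alpha>\<^sup>2 * (Q * s powr A) * ((s / c) powr ((\<alpha> - 2) / (N + \<alpha>)) * s)"
      unfolding k_def using N q s by (intro mult_right_mono mult_left_mono) auto
    also have "\<dots> = C * (s powr A * s powr ((\<alpha> - 2) / (N + \<alpha>)) * s powr 1)"
      using s c by (simp add: C_def powr_divide)
    also have "s powr A * s powr ((\<alpha> - 2) / (N + \<alpha>)) * s powr 1 = s powr (2 - 2 / (N + \<alpha>))"
    proof -
      \<comment> \<open>The exponents fall short of 2 by 2 / (N + \<alpha>); this deficit is what
        lets large power sums descend.\<close>
      have "A + (\<alpha> - 2) / (N + \<alpha>) + 1 = 2 - 2 / (N + \<alpha>)"
      proof -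
        have D: "N + \<alpha> \<noteq> 0" using N \<alpha> by simp
        then have "A + (\<alpha> - 2) / (N + \<alpha>) + 1 = (2 * (N + \<alpha>) - 2) / (N + \<alpha>)"
          by (simp add: A add_divide_eq_iff divide_add_eq_iff flip: add_divide_distrib)
        also have "\<dots> = 2 - 2 / (N + \<alpha>)" by (simp only: diff_divide_distrib nonzero_mult_div_cancel_right[OF D])
        finally show ?thesis .
      qed
      then show ?thesis by (simp only: flip: powr_add)
    qed
    also have "C * s powr (2 - 2 / (N + \<alpha>)) \<le> s powr (2 / (N + \<alpha>)) * s powr (2 - 2 / (N + \<alpha>))"
    proof (rule mult_right_mono)
      have "C = (C powr ((N + \<alpha>) / 2)) powr (2 / (N + \<alpha>))"
      proof -
        have "(N + \<alpha>) / 2 * (2 / (N + \<alpha>)) = 1" using N \<alpha> by simp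
        then show ?thesis using C by (simp only: powr_powr powr_one)
      qed
      also have "\<dots> \<le> s powr (2 / (N + \<alpha>))"
        using s(1) N \<alpha> by (intro powr_mono2) (auto simp: M_def)
      finally show "C \<le> s powr (2 / (N + \<alpha>))" .
    qed simp
    also have "\<dots> = s powr 2" by (simp flip: powr_add)
    also have "\<dots> = s\<^sup>2" using s by (simp add: powr_numeral)
    finally have small: "k * (\<Sum>\<^sub>\<infinity>x. u x powr (2 * \<alpha> - 2)) \<le> s\<^sup>2" .
    show ?thesis
      by (rule coarse_descent[OF u(1) _ A[unfolded N_def] s_def[symmetric, THEN sym] s(2) u(3)[folded s_def] small[unfolded k_def N_def]])
        (use \<alpha> in \<open>auto simp: s_def\<close>)
  qed
  \<comment> \<open>Induction on the number of halvings: from below M 2^k, at most k descents lead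
    below M.\<close>
  have "\<exists>v :: int ^ 'n \<Rightarrow> real. admissible v \<and> 0 < power_sum \<alpha> v \<and> power_sum \<alpha> v \<le> M \<and> J v \<le> q * power_sum \<alpha> v powr A"
    if q: "0 \<le> q" "q \<le> Q" and "admissible u" "0 < power_sum \<alpha> u" "J u \<le> q * power_sum \<alpha> u powr A" "power_sum \<alpha> u \<le> M * 2 ^ k"
    for q and u :: "int ^ 'n \<Rightarrow> real" and k :: nat
    using that(3-)
  proof (induction k arbitrary: u)
    case 0
    then show ?case by auto
  next
    case (Suc k)
    show ?case
    proof (cases "power_sum \<alpha> u \<le> M")
      case True
      then show ?thesis using Suc.prems by auto
    next
      case False
      then obtain v :: "int ^ 'n \<Rightarrow> real" where v: "admissible v" "0 < power_sum \<alpha> v"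
          "power_sum \<alpha> v \<le> power_sum \<alpha> u / 2" "J v \<le> q * power_sum \<alpha> v powr A"
        using step[OF q Suc.prems(1) _ Suc.prems(3)] by auto
      show ?thesis using Suc.prems(4) v by (intro Suc.IH[of v]) auto
    qed
  qed
  moreover have "\<exists>k. power_sum \<alpha> u \<le> M * 2 ^ k" for u :: "int ^ 'n \<Rightarrow> real"
  proof -
    obtain k where "power_sum \<alpha> u / M < 2 ^ k" using real_arch_pow[of 2 "power_sum \<alpha> u / M"] by auto
    then show ?thesis using M by (intro exI[of _ k]) (simp add: pos_divide_less_eq mult.commute)
  qed
  ultimately show ?thesis by (intro exI[of _ M]) blast
qed

section \<open>The Gagliardo--Nirenberg and Sobolev inequalities\<close>

text \<open>Hoelder's inequality with equal exponents: divide each factor by its sum and apply the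
  arithmetic-geometric mean inequality pointwise. A factor with sum 0 vanishes identically and is
  treated apart.\<close>

lemma sum_prod_powr_le:
  fixes f :: "'k \<Rightarrow> 'a \<Rightarrow> real"
  assumes K: "finite K" "K \<noteq> {}" and f: "\<And>k t. k \<in> K \<Longrightarrow> t \<in> S \<Longrightarrow> 0 \<le> f k t" and S: "finite S"
  shows "(\<Sum>t\<in>S. \<Prod>k\<in>K. f k t powr (1 / card K)) \<le> (\<Prod>k\<in>K. (\<Sum>t\<in>S. f k t) powr (1 / card K))"
proof -
  define F where "F k = (\<Sum>t\<in>S. f k t)" for k
  have F0: "0 \<le> F k" if "k \<in> K" for k unfolding F_def using f that by (intro sum_nonneg) auto
  have m: "0 < card K" using K by (simp add: card_gt_0_iff)
  show ?thesis
  proof (cases "\<exists>k\<in>K. F k = 0")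
    case True
    then obtain k where k: "k \<in> K" "F k = 0" by blast
    then have "\<forall>t\<in>S. f k t = 0" using f S unfolding F_def by (subst (asm) sum_nonneg_eq_0_iff) auto
    then have "(\<Sum>t\<in>S. \<Prod>k\<in>K. f k t powr (1 / card K)) = 0"
      using k K by (intro sum.neutral ballI prod_zero) (auto intro!: bexI[of _ k])
    then show ?thesis by (simp add: prod_nonneg)
  next
    case False
    then have F: "0 < F k" if "k \<in> K" for k using F0[OF that] that by fastforce
    have "(\<Sum>t\<in>S. \<Prod>k\<in>K. f k t powr (1 / card K))
      = (\<Sum>t\<in>S. (\<Prod>k\<in>K. F k powr (1 / card K)) * (\<Prod>k\<in>K. f k t / F k) powr (1 / card K))"
    proof (rule sum.cong)
      fix t assume t: "t \<in> S"
      have "(\<Prod>k\<in>K. f k t powr (1 / card K)) = (\<Prod>k\<in>K. F k powr (1 / card K) * (f k t / F k) powr (1 / card K))"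
        using F f[OF _ t] by (intro prod.cong) (auto simp: powr_divide dest!: F)
      also have "\<dots> = (\<Prod>k\<in>K. F k powr (1 / card K)) * (\<Prod>k\<in>K. (f k t / F k) powr (1 / card K))"
        by (rule prod.distrib)
      also have "(\<Prod>k\<in>K. (f k t / F k) powr (1 / card K)) = (\<Prod>k\<in>K. f k t / F k) powr (1 / card K)"
        using F0 f[OF _ t] by (simp add: prod_powr_distrib)
      finally show "(\<Prod>k\<in>K. f k t powr (1 / card K)) = (\<Prod>k\<in>K. F k powr (1 / card K)) * (\<Prod>k\<in>K. f k t / F k) powr (1 / card K)" .
    qed simp
    also have "\<dots> \<le> (\<Sum>t\<in>S. (\<Prod>k\<in>K. F k powr (1 / card K)) * (\<Sum>k\<in>K. (f k t / F k) / card K))"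
      using F0 f by (intro sum_mono mult_left_mono arith_geom_mean[OF K] prod_nonneg) auto
    also have "\<dots> = (\<Prod>k\<in>K. F k powr (1 / card K)) * (\<Sum>k\<in>K. (\<Sum>t\<in>S. f k t) / F k / card K)"
      unfolding sum_distrib_left[symmetric] by (subst sum.swap) (simp add: sum_divide_distrib)
    also have "(\<Sum>k\<in>K. (\<Sum>t\<in>S. f k t) / F k / card K) = (\<Sum>k\<in>K. 1 / card K)"
      unfolding F_def[symmetric] using F by (intro sum.cong) (auto dest!: F)
    also have "\<dots> = 1" using m by simp
    finally show ?thesis by (simp add: F_def)
  qed
qed

lemma telescoping_abs_le:
  fixes h :: "int \<Rightarrow> real"
  assumes "a \<le> b"
  shows "\<bar>h b - h a\<bar> \<le> (\<Sum>t\<in>{a..<b}. \<bar>h (t + 1) - h t\<bar>)"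
  using assms
proof (induction b rule: int_ge_induct)
  case (step b)
  have "{a..<b + 1} = insert b {a..<b}" using step.hyps by auto
  then show ?case using step.IH by simp
qed simp

section \<open>Sums over coordinate slices of a box\<close>

definition coord_update :: "int ^ 'n::finite \<Rightarrow> 'n \<Rightarrow> int \<Rightarrow> int ^ 'n" where
  "coord_update x i t = (\<chi> k. if k = i then t else x $ k)"

definition box :: "int set \<Rightarrow> (int ^ 'n::finite) set" where
  "box S = {z. \<forall>i. z $ i \<in> S}"

text \<open>The coordinates in \<open>T\<close> are summed, the others frozen at \<open>x\<close>.
  This interpolates between the value \<open>f x\<close> for empty \<open>T\<close> and the sum over
  the whole box, so that inequalities can be proved by induction on \<open>T\<close>.\<close>

definition slice_sum ::
    "int set \<Rightarrow> 'n::finite set \<Rightarrow> (int ^ 'n \<Rightarrow> real) \<Rightarrow> int ^ 'n \<Rightarrow> real" where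
  "slice_sum S T f x = (\<Sum>z | z \<in> box S \<and> (\<forall>k. k \<notin> T \<longrightarrow> z $ k = x $ k). f z)"

lemma finite_box: "finite S \<Longrightarrow> finite (box S)"
  unfolding box_def by (rule finite_vec_interval)

lemma coord_update_box: "x \<in> box S \<Longrightarrow> t \<in> S \<Longrightarrow> coord_update x i t \<in> box S"
  by (simp add: box_def coord_update_def)

lemma slice_sum_empty:
  assumes "x \<in> box S"
  shows "slice_sum S {} f x = f x"
proof -
  have "{z. z \<in> box S \<and> (\<forall>k. k \<notin> {} \<longrightarrow> z $ k = x $ k)} = {x}"
    using assms by (auto simp: vec_eq_iff)
  then show ?thesis by (simp add: slice_sum_def)
qed

lemma slice_sum_UNIV: "slice_sum S UNIV f x = (\<Sum>z\<in>box S. f z)"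
  by (simp add: slice_sum_def)

lemma slice_sum_nonneg: "(\<And>z. 0 \<le> f z) \<Longrightarrow> 0 \<le> slice_sum S T f x"
  unfolding slice_sum_def by (intro sum_nonneg)

lemma slice_sum_coord_update:
  assumes "j \<in> T"
  shows "slice_sum S T f (coord_update x j t) = slice_sum S T f x"
proof -
  have "(\<forall>k. k \<notin> T \<longrightarrow> z $ k = coord_update x j t $ k) \<longleftrightarrow> (\<forall>k. k \<notin> T \<longrightarrow> z $ k = x $ k)" for z
    using assms by (auto simp: coord_update_def)
  then show ?thesis by (simp add: slice_sum_def)
qed

lemma slice_sum_insert:
  assumes S: "finite S" and j: "j \<notin> T"
  shows "slice_sum S (insert j T) f x = (\<Sum>t\<in>S. slice_sum S T f (coord_update x j t))"
proof -
  define Z where "Z t = {z. z \<in> box S \<and> (\<forall>k. k \<notin> T \<longrightarrow> z $ k = coord_update x j t $ k)}" for t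
  have Zj: "z $ j = t" if "z \<in> Z t" for z t using that j by (auto simp: Z_def coord_update_def)
  have "{z. z \<in> box S \<and> (\<forall>k. k \<notin> insert j T \<longrightarrow> z $ k = x $ k)} = (\<Union>t\<in>S. Z t)" (is "?L = ?R")
  proof
    show "?L \<subseteq> ?R"
    proof
      fix z assume z: "z \<in> ?L"
      then have "z \<in> Z (z $ j)" by (auto simp: Z_def coord_update_def)
      moreover have "z $ j \<in> S" using z by (auto simp: box_def)
      ultimately show "z \<in> ?R" by blast
    qed
    show "?R \<subseteq> ?L" by (auto simp: Z_def coord_update_def)
  qed
  then have "slice_sum S (insert j T) f x = sum f (\<Union>t\<in>S. Z t)" by (simp only: slice_sum_def)
  also have "\<dots> = (\<Sum>t\<in>S. sum f (Z t))"
  proof (rule sum.UNION_disjoint[OF S])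
    show "\<forall>t\<in>S. finite (Z t)" using finite_box[OF S] by (auto simp: Z_def)
    show "\<forall>t\<in>S. \<forall>t'\<in>S. t \<noteq> t' \<longrightarrow> Z t \<inter> Z t' = {}" using Zj by blast
  qed
  finally show ?thesis by (simp only: slice_sum_def Z_def)
qed

text \<open>Summing one more coordinate leaves exactly one of the \<open>N\<close> factors constant, so Hoelder's
  inequality applies to the other \<open>N - 1\<close>.\<close>

lemma slice_sum_prod_le:
  fixes g :: "int ^ 'n::finite \<Rightarrow> real"
  assumes S: "finite S" and g: "\<And>z. 0 \<le> g z" and N: "2 \<le> CARD('n)" and x: "x \<in> box S"
  defines "m \<equiv> CARD('n) - 1"
  shows "slice_sum S T (\<lambda>x. \<Prod>i\<in>UNIV. slice_sum S {i} g x powr (1 / m)) x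
    \<le> (\<Prod>i\<in>UNIV. slice_sum S (insert i T) g x powr (1 / m))"
proof -
  have "finite T" by simp
  then show ?thesis using x
  proof (induction T arbitrary: x)
    case empty
    then show ?case by (simp add: slice_sum_empty)
  next
    case (insert j T)
    have m: "card (UNIV - {j}) = m" by (simp add: m_def)
    have ne: "UNIV - {j} \<noteq> {}"
    proof
      assume "UNIV - {j} = {}"
      then have "m = 0" using m by (simp only: card.empty)
      then show False using N by (simp add: m_def)
    qed
    let ?P = "\<lambda>x. \<Prod>i\<in>UNIV. slice_sum S {i} g x powr (1 / m)"
    have "slice_sum S (insert j T) ?P x = (\<Sum>t\<in>S. slice_sum S T ?P (coord_update x j t))"
      by (rule slice_sum_insert[OF S insert.hyps(2)])
    also have "\<dots> \<le> (\<Sum>t\<in>S. \<Prod>i\<in>UNIV. slice_sum S (insert i T) g (coord_update x j t) powr (1 / m))"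
      by (intro sum_mono insert.IH coord_update_box insert.prems)
    also have "\<dots> = (\<Sum>t\<in>S. slice_sum S (insert j T) g x powr (1 / m) *
        (\<Prod>i\<in>UNIV - {j}. slice_sum S (insert i T) g (coord_update x j t) powr (1 / m)))"
      by (subst prod.remove[of UNIV j]) (simp_all add: slice_sum_coord_update)
    also have "\<dots> \<le> slice_sum S (insert j T) g x powr (1 / m) *
        (\<Prod>i\<in>UNIV - {j}. (\<Sum>t\<in>S. slice_sum S (insert i T) g (coord_update x j t)) powr (1 / m))"
      unfolding sum_distrib_left[symmetric]
      using sum_prod_powr_le[of "UNIV - {j}" S "\<lambda>i t. slice_sum S (insert i T) g (coord_update x j t)"]
        ne S g m by (intro mult_left_mono) (auto intro: slice_sum_nonneg)
    also have "(\<Prod>i\<in>UNIV - {j}. (\<Sum>t\<in>S. slice_sum S (insert i T) g (coord_update x j t)) powr (1 / m))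
        = (\<Prod>i\<in>UNIV - {j}. slice_sum S (insert i (insert j T)) g x powr (1 / m))"
    proof (rule prod.cong)
      fix i assume "i \<in> UNIV - {j}"
      then have "j \<notin> insert i T" using insert.hyps by auto
      then show "(\<Sum>t\<in>S. slice_sum S (insert i T) g (coord_update x j t)) powr (1 / m)
        = slice_sum S (insert i (insert j T)) g x powr (1 / m)"
        using slice_sum_insert[OF S, of j "insert i T" g x] by (simp add: insert_commute)
    qed simp
    also have "slice_sum S (insert j T) g x powr (1 / m) *
        (\<Prod>i\<in>UNIV - {j}. slice_sum S (insert i (insert j T)) g x powr (1 / m))
        = (\<Prod>i\<in>UNIV. slice_sum S (insert i (insert j T)) g x powr (1 / m))"
      by (simp add: prod.remove[of UNIV j])
    finally show ?case .
  qed
qed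

text \<open>Telescoping along each coordinate line bounds w x by N different line sums of the
  gradient. The product of these bounds, each to the power 1 / (N - 1), is summed by
  \<open>slice_sum_prod_le\<close> with \<open>T = UNIV\<close>, where every factor has become the
  total variation.\<close>

lemma Gagliardo_Nirenberg:
  fixes w :: "int ^ 'n::finite \<Rightarrow> real"
  defines "N \<equiv> real CARD('n)"
  assumes w: "fin_supp w" "\<And>x. 0 \<le> w x" and N2: "2 \<le> CARD('n)"
  shows "(\<Sum>\<^sub>\<infinity>x. w x powr (N / (N - 1)))
    \<le> (\<Sum>i\<in>UNIV. \<Sum>\<^sub>\<infinity>x. \<bar>w (x + unit_vec i) - w x\<bar>) powr (N / (N - 1))"
proof -
  define g where "g x = (\<Sum>i\<in>UNIV. \<bar>w (x + unit_vec i) - w x\<bar>)" for x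
  have g0: "0 \<le> g x" for x unfolding g_def by (intro sum_nonneg) auto
  have fd: "fin_supp (\<lambda>x. \<bar>w (x + unit_vec i) - w x\<bar>)" for i
    by (rule fin_supp_grad[OF w(1), of abs]) simp
  have fg: "fin_supp g" unfolding g_def by (intro fin_supp_sum fd) simp
  \<comment> \<open>A crude radius, at least the modulus of every coordinate of every support
    point.\<close>
  define R where "R = (\<Sum>y | w y \<noteq> 0. \<Sum>k\<in>UNIV. \<bar>y $ k\<bar>)"
  have R: "\<bar>y $ k\<bar> \<le> R" if "w y \<noteq> 0" for y k
  proof -
    have "\<bar>y $ k\<bar> \<le> (\<Sum>k\<in>UNIV. \<bar>y $ k\<bar>)" by (rule member_le_sum) auto
    also have "\<dots> \<le> R" unfolding R_def
      using w(1) that by (intro member_le_sum sum_nonneg) (auto simp: fin_supp_def)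
    finally show ?thesis .
  qed
  define S where "S = {- R..R}"
  have S: "finite S" by (simp add: S_def)
  have out: "w x = 0" if "x \<notin> box S" for x
  proof (rule ccontr)
    assume "w x \<noteq> 0"
    then have "\<bar>x $ k\<bar> \<le> R" for k by (rule R)
    then have "x \<in> box S" by (auto simp: box_def S_def abs_le_iff minus_le_iff)
    then show False using that by simp
  qed
  define m where "m = CARD('n) - 1"
  have m: "real m = N - 1" "0 < N - 1" using N2 by (auto simp: m_def N_def)
  have line: "w x \<le> slice_sum S {i} g x" if x: "x \<in> box S" for x i
  proof -
    define h where "h t = w (coord_update x i t)" for t
    have xi: "x $ i \<in> S" "coord_update x i (x $ i) = x"
      using x by (auto simp: box_def coord_update_def vec_eq_iff)
    \<comment> \<open>R + 1 is the first coordinate past the box, where \<open>w\<close> vanishes;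
      telescoping up to it uses only differences based at points of \<open>S\<close>.\<close>
    have "h (R + 1) = 0" unfolding h_def
      by (rule out) (auto simp: box_def coord_update_def S_def intro!: exI[of _ i])
    then have "w x = \<bar>h (R + 1) - h (x $ i)\<bar>" using w(2) xi by (simp add: h_def)
    also have "\<dots> \<le> (\<Sum>t\<in>{x $ i..<R + 1}. \<bar>h (t + 1) - h t\<bar>)"
      using xi by (intro telescoping_abs_le) (auto simp: S_def)
    also have "\<dots> \<le> (\<Sum>t\<in>S. \<bar>h (t + 1) - h t\<bar>)"
      using xi by (intro sum_mono2 S) (auto simp: S_def)
    also have "\<dots> \<le> (\<Sum>t\<in>S. g (coord_update x i t))"
    proof (rule sum_mono)
      fix t
      have "coord_update x i (t + 1) = coord_update x i t + unit_vec i"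
        by (auto simp: coord_update_def vec_eq_iff axis_def)
      then show "\<bar>h (t + 1) - h t\<bar> \<le> g (coord_update x i t)"
        unfolding h_def g_def
        using member_le_sum[of i UNIV "\<lambda>i'. \<bar>w (coord_update x i t + unit_vec i') - w (coord_update x i t)\<bar>"]
        by simp
    qed
    also have "\<dots> = (\<Sum>t\<in>S. slice_sum S {} g (coord_update x i t))"
      by (intro sum.cong refl slice_sum_empty[symmetric] coord_update_box x)
    also have "\<dots> = slice_sum S {i} g x" by (rule slice_sum_insert[OF S, symmetric]) simp
    finally show ?thesis .
  qed
  show ?thesis
  proof (cases "box S = ({} :: (int ^ 'n) set)")
    case True
    then have "w x = 0" for x using out[of x] by simp
    then show ?thesis by simp
  next
    case False
    then obtain x0 :: "int ^ 'n" where x0: "x0 \<in> box S" by blast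
    have pw: "(\<Prod>i\<in>(UNIV :: 'n set). a powr (1 / m)) = a powr (N / (N - 1))" if "0 \<le> a" for a :: real
    proof -
      have "(\<Prod>i\<in>(UNIV :: 'n set). a powr (1 / m)) = (a powr (1 / m)) powr N"
        using that m by (simp add: powr_realpow' N_def)
      also have "\<dots> = a powr (N / (N - 1))" using m by (simp add: powr_powr)
      finally show ?thesis .
    qed
    have "(\<Sum>\<^sub>\<infinity>x. w x powr (N / (N - 1))) = (\<Sum>x\<in>box S. w x powr (N / (N - 1)))"
      using out by (intro infsum_eq_sum_supp finite_box S) auto
    also have "\<dots> \<le> (\<Sum>x\<in>box S. \<Prod>i\<in>UNIV. slice_sum S {i} g x powr (1 / m))"
    proof (rule sum_mono)
      fix x :: "int ^ 'n" assume x: "x \<in> box S"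
      have "w x powr (N / (N - 1)) = (\<Prod>i\<in>(UNIV :: 'n set). w x powr (1 / m))"
        using pw w(2) by simp
      also have "\<dots> \<le> (\<Prod>i\<in>UNIV. slice_sum S {i} g x powr (1 / m))"
        using w(2) line[OF x] by (intro prod_mono conjI powr_mono2) auto
      finally show "w x powr (N / (N - 1)) \<le> (\<Prod>i\<in>UNIV. slice_sum S {i} g x powr (1 / m))" .
    qed
    also have "\<dots> \<le> (\<Prod>i\<in>(UNIV :: 'n set). (\<Sum>z\<in>box S. g z) powr (1 / m))"
      using slice_sum_prod_le[OF S g0 N2 x0, of UNIV] by (simp add: slice_sum_UNIV m_def)
    also have "\<dots> = (\<Sum>z\<in>box S. g z) powr (N / (N - 1))" by (rule pw) (intro sum_nonneg g0)
    also have "\<dots> \<le> (\<Sum>\<^sub>\<infinity>z. g z) powr (N / (N - 1))"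
    proof (rule powr_mono2)
      show "(\<Sum>z\<in>box S. g z) \<le> (\<Sum>\<^sub>\<infinity>z. g z)"
        by (intro finite_sum_le_infsum fin_supp_summable fg finite_box S g0) auto
    qed (use m in \<open>auto simp: N_def intro!: sum_nonneg g0\<close>)
    also have "(\<Sum>\<^sub>\<infinity>z. g z) = (\<Sum>i\<in>UNIV. \<Sum>\<^sub>\<infinity>x. \<bar>w (x + unit_vec i) - w x\<bar>)"
      unfolding g_def by (intro infsum_sum fin_supp_summable fd) simp
    finally show ?thesis .
  qed
qed

text \<open>Both end points appear, instead of the larger one, so that the two terms can be summed
  separately and matched by a translation.\<close>

lemma powr_diff_abs_le:
  fixes b c \<gamma> :: real
  assumes "0 \<le> b" "0 \<le> c" "1 < \<gamma>"
  shows "\<bar>c powr \<gamma> - b powr \<gamma>\<bar> \<le> \<gamma> * (c powr (\<gamma> - 1) * \<bar>c - b\<bar> + b powr (\<gamma> - 1) * \<bar>c - b\<bar>)"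
proof -
  have bound: "y powr \<gamma> - x powr \<gamma> \<le> \<gamma> * (y powr (\<gamma> - 1) * \<bar>y - x\<bar>)" if "0 \<le> x" "0 \<le> y" for x y :: real
  proof -
    have "y powr \<gamma> - x powr \<gamma> \<le> \<gamma> * (y powr (\<gamma> - 1) * (y - x))"
      using powr_ge_tangent[OF that(2,1) assms(3)] by (simp add: algebra_simps)
    also have "\<dots> \<le> \<gamma> * (y powr (\<gamma> - 1) * \<bar>y - x\<bar>)"
      using assms(3) by (intro mult_left_mono) auto
    finally show ?thesis .
  qed
  have nn: "0 \<le> \<gamma> * (c powr (\<gamma> - 1) * \<bar>c - b\<bar>)" "0 \<le> \<gamma> * (b powr (\<gamma> - 1) * \<bar>c - b\<bar>)"
    using assms by auto
  show ?thesis
    using bound[OF assms(1,2)] bound[OF assms(2,1)] nn by (simp add: distrib_left abs_minus_commute)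
qed

text \<open>Apply \<open>Gagliardo_Nirenberg\<close> to u^\<gamma>. The choice of \<gamma> makes
  both \<gamma> N / (N - 1) and 2 (\<gamma> - 1) equal to the critical exponent p, so
  Cauchy--Schwarz reproduces sqrt s on the right. Dividing it out leaves the power (N - 1) / N - 1/2
  = 1 / p.\<close>

lemma discrete_Sobolev:
  fixes u :: "int ^ 'n::finite \<Rightarrow> real"
  defines "N \<equiv> real CARD('n)"
  assumes u: "fin_supp u" "\<And>x. 0 \<le> u x" and N3: "3 \<le> CARD('n)"
  shows "power_sum (crit_exp CARD('n)) u powr (1 / crit_exp CARD('n))
    \<le> 4 * (N - 1) / (N - 2) * N * sqrt (\<Sum>i\<in>UNIV. \<Sum>\<^sub>\<infinity>x. (u (x + unit_vec i) - u x)\<^sup>2)"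
proof -
  define p \<gamma> where "p = crit_exp CARD('n)" and "\<gamma> = 2 * (N - 1) / (N - 2)"
  have N: "3 \<le> N" using N3 by (simp add: N_def)
  have p: "p = 2 * N / (N - 2)" by (simp add: p_def crit_exp_def N_def)
  have p0: "0 < p" using N by (simp add: p)
  have cancel: "2 * a / b * (N / a) = 2 * N / b" if "a \<noteq> 0" for a b :: real using that by simp
  have "\<gamma> * (N / (N - 1)) = p" unfolding \<gamma>_def p by (rule cancel) (use N in simp)
  moreover have "1 < \<gamma>" "2 * \<gamma> - 2 = p" using N by (auto simp: \<gamma>_def p field_simps)
  ultimately have \<gamma>: "1 < \<gamma>" "2 * \<gamma> - 2 = p" "\<gamma> * (N / (N - 1)) = p" by simp_all
  define s E where "s = power_sum p u" and "E i = (\<Sum>\<^sub>\<infinity>x. (u (x + unit_vec i) - u x)\<^sup>2)" for i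
  have s_eq: "s = (\<Sum>\<^sub>\<infinity>x. u x powr p)" using u(2) by (simp add: s_def power_sum_def)
  have s0: "0 \<le> s" by (simp add: s_def power_sum_nonneg)
  have E0: "0 \<le> E i" for i unfolding E_def by (intro infsum_nonneg) auto
  have fp: "fin_supp (\<lambda>x. u x powr a)" for a by (rule fin_supp_map[OF u(1)]) simp
  have fg: "fin_supp (\<lambda>x. \<bar>u (x + unit_vec i) - u x\<bar>)" for i by (rule fin_supp_grad[OF u(1), of abs]) simp
  have CS: "(\<Sum>\<^sub>\<infinity>x. v x powr (\<gamma> - 1) * \<bar>u (x + unit_vec i) - u x\<bar>) \<le> sqrt s * sqrt (E i)"
    if v: "fin_supp v" "(\<Sum>\<^sub>\<infinity>x. v x powr p) = s" for v :: "int ^ 'n \<Rightarrow> real" and i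
  proof -
    have "(\<Sum>\<^sub>\<infinity>x. v x powr (\<gamma> - 1) * \<bar>u (x + unit_vec i) - u x\<bar>)\<^sup>2
      \<le> (\<Sum>\<^sub>\<infinity>x. (v x powr (\<gamma> - 1))\<^sup>2) * (\<Sum>\<^sub>\<infinity>x. \<bar>u (x + unit_vec i) - u x\<bar>\<^sup>2)"
      by (intro infsum_Cauchy_Schwarz fg fin_supp_map[OF v(1), of "\<lambda>t. t powr (\<gamma> - 1)"]) simp
    also have "(\<lambda>x. (v x powr (\<gamma> - 1))\<^sup>2) = (\<lambda>x. v x powr p)"
      by (simp add: power2_eq_square \<gamma>(2)[symmetric] flip: powr_add)
    finally have "(\<Sum>\<^sub>\<infinity>x. v x powr (\<gamma> - 1) * \<bar>u (x + unit_vec i) - u x\<bar>)\<^sup>2 \<le> s * E i"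
      using v(2) by (simp add: E_def)
    then show ?thesis by (simp add: real_le_rsqrt flip: real_sqrt_mult)
  qed
  have T: "(\<Sum>\<^sub>\<infinity>x. \<bar>u (x + unit_vec i) powr \<gamma> - u x powr \<gamma>\<bar>) \<le> 2 * \<gamma> * sqrt s * sqrt (\<Sum>i\<in>UNIV. E i)" for i
  proof -
    define a b where "a x = u (x + unit_vec i) powr (\<gamma> - 1) * \<bar>u (x + unit_vec i) - u x\<bar>"
      and "b x = u x powr (\<gamma> - 1) * \<bar>u (x + unit_vec i) - u x\<bar>" for x
    have fs: "fin_supp (\<lambda>x. u (x + unit_vec i))" by (rule fin_supp_shift(1)[OF u(1)])
    have fa: "fin_supp a" unfolding a_def
      by (rule fin_supp_map2[where \<phi> = "\<lambda>s t. s powr (\<gamma> - 1) * t", OF fs fg]) simp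
    have fb: "fin_supp b" unfolding b_def
      by (rule fin_supp_map2[where \<phi> = "\<lambda>s t. s powr (\<gamma> - 1) * t", OF u(1) fg]) simp
    have "(\<Sum>\<^sub>\<infinity>x. \<bar>u (x + unit_vec i) powr \<gamma> - u x powr \<gamma>\<bar>) \<le> (\<Sum>\<^sub>\<infinity>x. \<gamma> * (a x + b x))"
    proof (rule infsum_mono_fin_supp)
      show "fin_supp (\<lambda>x. \<bar>u (x + unit_vec i) powr \<gamma> - u x powr \<gamma>\<bar>)"
        by (rule fin_supp_grad[OF fp, of abs]) simp
      show "fin_supp (\<lambda>x. \<gamma> * (a x + b x))"
        by (rule fin_supp_map2[where \<phi> = "\<lambda>s t. \<gamma> * (s + t)", OF fa fb]) simp
      show "\<bar>u (x + unit_vec i) powr \<gamma> - u x powr \<gamma>\<bar> \<le> \<gamma> * (a x + b x)" for x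
        unfolding a_def b_def using u(2) \<gamma>(1) by (intro powr_diff_abs_le) auto
    qed
    also have "\<dots> = \<gamma> * ((\<Sum>\<^sub>\<infinity>x. a x) + (\<Sum>\<^sub>\<infinity>x. b x))"
      unfolding infsum_cmult_right' by (subst infsum_add) (intro fin_supp_summable fa fb refl)+
    also have "\<dots> \<le> \<gamma> * (sqrt s * sqrt (E i) + sqrt s * sqrt (E i))"
    proof (intro mult_left_mono add_mono)
      show "(\<Sum>\<^sub>\<infinity>x. a x) \<le> sqrt s * sqrt (E i)" unfolding a_def
        using infsum_shift(1)[of "\<lambda>x. u x powr p" "unit_vec i"] by (intro CS fs) (simp add: s_eq)
      show "(\<Sum>\<^sub>\<infinity>x. b x) \<le> sqrt s * sqrt (E i)" unfolding b_def
        by (intro CS u) (simp add: s_eq)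
    qed (use \<gamma> in simp)
    also have "\<dots> = 2 * \<gamma> * sqrt s * sqrt (E i)" by simp
    also have "\<dots> \<le> 2 * \<gamma> * sqrt s * sqrt (\<Sum>i\<in>UNIV. E i)"
      using E0 \<gamma> s0 by (intro mult_left_mono real_sqrt_le_mono member_le_sum) auto
    finally show ?thesis .
  qed
  define D where "D = 2 * \<gamma> * N * sqrt (\<Sum>i\<in>UNIV. E i)"
  have D0: "0 \<le> D" using \<gamma> N E0 by (simp add: D_def sum_nonneg)
  have "s = (\<Sum>\<^sub>\<infinity>x. (u x powr \<gamma>) powr (N / (N - 1)))"
    unfolding powr_powr \<gamma>(3) by (rule s_eq)
  also have "\<dots> \<le> (\<Sum>i\<in>UNIV. \<Sum>\<^sub>\<infinity>x. \<bar>u (x + unit_vec i) powr \<gamma> - u x powr \<gamma>\<bar>) powr (N / (N - 1))"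
    unfolding N_def using N3 by (intro Gagliardo_Nirenberg fp) auto
  also have "\<dots> \<le> (\<Sum>i\<in>(UNIV :: 'n set). 2 * \<gamma> * sqrt s * sqrt (\<Sum>i\<in>UNIV. E i)) powr (N / (N - 1))"
    using N by (intro powr_mono2 sum_mono T sum_nonneg infsum_nonneg) auto
  also have "(\<Sum>i\<in>(UNIV :: 'n set). 2 * \<gamma> * sqrt s * sqrt (\<Sum>i\<in>UNIV. E i)) = sqrt s * D"
    by (simp add: D_def N_def)
  finally have main: "s \<le> (sqrt s * D) powr (N / (N - 1))" .
  have "s powr (1 / p) \<le> D"
  proof (cases "s = 0")
    case True
    then show ?thesis using D0 by simp
  next
    case False
    then have s: "0 < s" using s0 by simp
    have "s powr ((N - 1) / N) \<le> ((sqrt s * D) powr (N / (N - 1))) powr ((N - 1) / N)"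
      using main s N by (intro powr_mono2) auto
    also have "\<dots> = s powr (1 / 2) * D"
      using N s D0 by (simp add: powr_powr powr_half_sqrt)
    finally have "s powr ((N - 1) / N) / s powr (1 / 2) \<le> D"
      using s by (simp add: pos_divide_le_eq mult.commute)
    moreover have "(N - 1) / N - 1 / 2 = 1 / p" using N by (simp add: p field_simps)
    ultimately show ?thesis by (simp flip: powr_diff)
  qed
  also have "D = 4 * (N - 1) / (N - 2) * N * sqrt (\<Sum>i\<in>UNIV. E i)"
    by (simp add: D_def \<gamma>_def)
  finally show ?thesis by (simp only: s_def p_def E_def)
qed

section \<open>Rearrangement\<close>

text \<open>Both a - b and a' - b' lie between a - b' and a' - b, and the two pairs have the same
  sum. Hence - k (a - b) is supermodular, as \<open>riesz\<close> requires.\<close>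

lemma convex_diff_supermodular:
  fixes k :: "real \<Rightarrow> real"
  assumes k: "convex_on UNIV k" and ab: "a \<le> a'" "b \<le> b'"
  shows "k (a - b) + k (a' - b') \<le> k (a - b') + k (a' - b)"
proof (cases "a - b' = a' - b")
  case True
  then have "a = a'" "b = b'" using ab by linarith+
  then show ?thesis by simp
next
  case False
  define L U where "L = a - b'" and "U = a' - b"
  have LU: "L < U" using False ab by (simp add: L_def U_def)
  define l where "l = (b' - b) / (U - L)"
  have l: "0 \<le> l" "0 \<le> 1 - l" "l * (U - L) = b' - b" using LU ab by (auto simp: l_def L_def U_def)
  have x: "a - b = (1 - l) * L + l * U" and y: "a' - b' = l * L + (1 - l) * U"
    using l(3) by (auto simp: L_def U_def algebra_simps)
  have "k (a - b) \<le> (1 - l) * k L + l * k U" "k (a' - b') \<le> l * k L + (1 - l) * k U"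
    unfolding x y using l convex_onD[OF k, of l L U] convex_onD[OF k, of "1 - l" L U] by auto
  then show ?thesis by (simp add: L_def U_def algebra_simps)
qed

text \<open>No finite convex function on the real line extends \<open>born_infeld\<close> beyond \<open>[-1, 1]\<close>, because its
  slope blows up at the end points. The supremum of its tangents with slope at most
  \<open>1 / \<epsilon>\<close> is finite and approximates it from below.\<close>

definition tangent_sup :: "real \<Rightarrow> real \<Rightarrow> real" where
  "tangent_sup \<epsilon> t = (SUP p\<in>{- (1 / \<epsilon>)..1 / \<epsilon>}. p * t + 1 - sqrt (1 + p\<^sup>2))"

lemma bdd_above_tangents:
  "bdd_above ((\<lambda>p. p * t + 1 - sqrt (1 + p\<^sup>2)) ` {- (1 / \<epsilon>)..1 / \<epsilon>})"
proof (rule bdd_aboveI2)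
  fix p assume p: "p \<in> {- (1 / \<epsilon>)..1 / \<epsilon>}"
  have "p * t \<le> \<bar>p\<bar> * \<bar>t\<bar>" by (metis abs_ge_self abs_mult)
  also have "\<dots> \<le> 1 / \<epsilon> * \<bar>t\<bar>" using p by (intro mult_right_mono) auto
  finally show "p * t + 1 - sqrt (1 + p\<^sup>2) \<le> 1 / \<epsilon> * \<bar>t\<bar> + 1"
    using real_sqrt_ge_zero[of "1 + p\<^sup>2"] by (smt (verit) zero_le_power2)
qed

lemma tangent_le_tangent_sup:
  assumes "\<bar>p\<bar> \<le> 1 / \<epsilon>"
  shows "p * t + 1 - sqrt (1 + p\<^sup>2) \<le> tangent_sup \<epsilon> t"
  unfolding tangent_sup_def using assms by (intro cSUP_upper bdd_above_tangents) auto

lemma tangent_sup_leI: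
  assumes "0 < \<epsilon>" "\<And>p. \<bar>p\<bar> \<le> 1 / \<epsilon> \<Longrightarrow> p * t + 1 - sqrt (1 + p\<^sup>2) \<le> c"
  shows "tangent_sup \<epsilon> t \<le> c"
proof -
  have "0 \<le> 1 / \<epsilon>" using assms(1) by simp
  then have "- (1 / \<epsilon>) \<le> 1 / \<epsilon>" by linarith
  then show ?thesis unfolding tangent_sup_def using assms(2) by (intro cSUP_least) auto
qed

lemma tangent_sup_nonneg:
  assumes "0 < \<epsilon>"
  shows "0 \<le> tangent_sup \<epsilon> t"
  using tangent_le_tangent_sup[of 0 \<epsilon> t] assms by simp

lemma tangent_sup_0:
  assumes "0 < \<epsilon>"
  shows "tangent_sup \<epsilon> 0 = 0"
  using tangent_sup_nonneg[OF assms, of 0] by (intro antisym tangent_sup_leI assms) auto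

lemma tangent_sup_minus:
  assumes "0 < \<epsilon>"
  shows "tangent_sup \<epsilon> (- t) = tangent_sup \<epsilon> t"
proof -
  have "tangent_sup \<epsilon> (- t) \<le> tangent_sup \<epsilon> t" for t
  proof (rule tangent_sup_leI[OF assms])
    fix p :: real assume "\<bar>p\<bar> \<le> 1 / \<epsilon>"
    then show "p * - t + 1 - sqrt (1 + p\<^sup>2) \<le> tangent_sup \<epsilon> t"
      using tangent_le_tangent_sup[of "- p" \<epsilon> t] by simp
  qed
  from this[of t] this[of "- t"] show ?thesis by simp
qed

lemma convex_tangent_sup:
  assumes "0 < \<epsilon>"
  shows "convex_on UNIV (tangent_sup \<epsilon>)"
proof (rule convex_onI)
  fix l x y :: real assume l: "0 < l" "l < 1"
  show "tangent_sup \<epsilon> ((1 - l) *\<^sub>R x + l *\<^sub>R y) \<le> (1 - l) * tangent_sup \<epsilon> x + l * tangent_sup \<epsilon> y"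
  proof (rule tangent_sup_leI[OF assms])
    fix p :: real assume p: "\<bar>p\<bar> \<le> 1 / \<epsilon>"
    have "p * ((1 - l) *\<^sub>R x + l *\<^sub>R y) + 1 - sqrt (1 + p\<^sup>2)
      = (1 - l) * (p * x + 1 - sqrt (1 + p\<^sup>2)) + l * (p * y + 1 - sqrt (1 + p\<^sup>2))"
      by (simp add: algebra_simps)
    also have "\<dots> \<le> (1 - l) * tangent_sup \<epsilon> x + l * tangent_sup \<epsilon> y"
      using l p by (intro add_mono mult_left_mono tangent_le_tangent_sup) auto
    finally show "p * ((1 - l) *\<^sub>R x + l *\<^sub>R y) + 1 - sqrt (1 + p\<^sup>2)
      \<le> (1 - l) * tangent_sup \<epsilon> x + l * tangent_sup \<epsilon> y" .
  qed
qed simp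

text \<open>Fenchel's inequality for \<open>born_infeld\<close>, whose conjugate is sqrt (1 + p^2) -
  1; it amounts to Cauchy--Schwarz for the vectors (p, 1) and (t, sqrt (1 - t^2)).\<close>

lemma tangent_sup_le_born_infeld:
  assumes "0 < \<epsilon>" "\<bar>t\<bar> \<le> 1"
  shows "tangent_sup \<epsilon> t \<le> born_infeld t"
proof (rule tangent_sup_leI[OF assms(1)])
  fix p :: real
  define r where "r = sqrt (1 - t\<^sup>2)"
  have r: "r\<^sup>2 = 1 - t\<^sup>2" using assms(2) by (simp add: r_def abs_square_le_1)
  have "(p * t + r)\<^sup>2 + (p * r - t)\<^sup>2 = (1 + p\<^sup>2) * (t\<^sup>2 + r\<^sup>2)"
    by (simp add: power2_eq_square algebra_simps)
  also have "\<dots> = 1 + p\<^sup>2" by (simp add: r)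
  finally have "(p * t + r)\<^sup>2 \<le> 1 + p\<^sup>2" using zero_le_power2[of "p * r - t"] by linarith
  then have "p * t + r \<le> sqrt (1 + p\<^sup>2)" by (rule real_le_rsqrt)
  then show "p * t + 1 - sqrt (1 + p\<^sup>2) \<le> born_infeld t" by (simp add: born_infeld_def r_def)
qed

text \<open>The extreme tangent, of slope 1 / \<epsilon>, penalises differences above 1 without
  bound as \<epsilon> tends to 0.\<close>

lemma tangent_sup_ge_slope:
  assumes "0 < \<epsilon>"
  shows "(\<bar>t\<bar> - 1) / \<epsilon> \<le> tangent_sup \<epsilon> t"
proof -
  have "(\<bar>t\<bar> - 1) / \<epsilon> \<le> tangent_sup \<epsilon> \<bar>t\<bar>"
  proof -
    have "sqrt (1 + (1 / \<epsilon>)\<^sup>2) \<le> 1 + 1 / \<epsilon>"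
      using assms by (intro real_le_lsqrt) (auto simp: power2_eq_square algebra_simps)
    then show ?thesis using tangent_le_tangent_sup[of "1 / \<epsilon>" \<epsilon> "\<bar>t\<bar>"] assms
      by (simp add: diff_divide_distrib)
  qed
  then show ?thesis using tangent_sup_minus[OF assms, of t] by (cases "0 \<le> t") auto
qed

text \<open>Contracting by \<open>\<theta>\<close> moves \<open>t\<close> to a point
  \<open>s\<close> where the slope \<open>p\<close> of \<open>born_infeld\<close> is at most 1 /
  \<epsilon> in modulus, so the tangent at \<open>s\<close> belongs to the supremum. Evaluated at
  \<open>t\<close> instead of \<open>s\<close> it can only be larger.\<close>

lemma tangent_sup_ge_born_infeld:
  assumes \<epsilon>: "0 < \<epsilon>" and t: "\<bar>t\<bar> \<le> 1"
  shows "born_infeld (t / sqrt (1 + \<epsilon>\<^sup>2)) \<le> tangent_sup \<epsilon> t"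
proof -
  define \<theta> s where "\<theta> = 1 / sqrt (1 + \<epsilon>\<^sup>2)" and "s = \<theta> * t"
  have e2: "0 < \<epsilon>\<^sup>2" "0 < 1 + \<epsilon>\<^sup>2" using \<epsilon> by (auto intro: add_pos_pos)
  then have "1 \<le> sqrt (1 + \<epsilon>\<^sup>2)" by simp
  then have \<theta>: "0 < \<theta>" "\<theta> \<le> 1" "\<theta>\<^sup>2 = 1 / (1 + \<epsilon>\<^sup>2)"
    using e2 by (auto simp: \<theta>_def power_divide)
  have "s\<^sup>2 \<le> \<theta>\<^sup>2 * 1" using t unfolding s_def power_mult_distrib
    by (intro mult_left_mono) (auto simp: abs_square_le_1)
  then have s2: "s\<^sup>2 \<le> 1 / (1 + \<epsilon>\<^sup>2)" using \<theta> by simp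
  also have "\<dots> < 1" using e2 by simp
  finally have s1: "0 < 1 - s\<^sup>2" by simp
  define r where "r = sqrt (1 - s\<^sup>2)"
  have r: "0 < r" "r\<^sup>2 = 1 - s\<^sup>2" using s1 by (auto simp: r_def)
  define p where "p = s / r"
  have p1: "1 + p\<^sup>2 = (1 / r)\<^sup>2" using r by (simp add: p_def power_divide field_simps)
  have p: "\<bar>p\<bar> \<le> 1 / \<epsilon>"
  proof -
    have "s\<^sup>2 * (1 + \<epsilon>\<^sup>2) \<le> 1" using s2 e2 by (simp add: pos_le_divide_eq)
    then have "s\<^sup>2 * \<epsilon>\<^sup>2 \<le> r\<^sup>2" by (simp add: r algebra_simps)
    then have "p\<^sup>2 \<le> (1 / \<epsilon>)\<^sup>2"
      using r(1) \<epsilon> by (simp add: p_def power_divide pos_divide_le_eq pos_le_divide_eq)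
    then show ?thesis using \<epsilon> abs_le_square_iff[of p "1 / \<epsilon>"] by simp
  qed
  have "p * s \<le> p * t"
  proof -
    have "p * t - p * s = t\<^sup>2 * \<theta> * (1 - \<theta>) / r" using r
      by (simp add: p_def s_def power2_eq_square field_simps)
    also have "0 \<le> \<dots>" using \<theta> r by simp
    finally show ?thesis by simp
  qed
  moreover have "p * s + 1 - sqrt (1 + p\<^sup>2) = 1 - r"
  proof -
    have "sqrt (1 + p\<^sup>2) = 1 / r" unfolding p1 using r by simp
    moreover have "p * s - 1 / r = - r"
    proof -
      have "p * s - 1 / r = (s\<^sup>2 - 1) / r" by (simp add: p_def power2_eq_square diff_divide_distrib)
      also have "\<dots> = - (r\<^sup>2) / r" by (simp add: r)
      also have "\<dots> = - r" using r(1) by (simp add: power2_eq_square)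
      finally show ?thesis .
    qed
    ultimately show ?thesis by simp
  qed
  moreover have "born_infeld (t / sqrt (1 + \<epsilon>\<^sup>2)) = 1 - r"
    by (simp add: born_infeld_def r_def s_def \<theta>_def)
  ultimately show ?thesis using tangent_le_tangent_sup[OF p, of t] by linarith
qed

section \<open>Edge energies and the Riesz inequality\<close>

lemma infsum_neighbour_pairs:
  fixes v :: "int ^ 'n::finite \<Rightarrow> real" and G :: "real \<Rightarrow> real \<Rightarrow> real"
  assumes v: "fin_supp v" and G: "G 0 0 = 0"
  shows "(\<Sum>\<^sub>\<infinity>(x, y)\<in>{(x, y). gdist x y \<le> 1}. G (v x) (v y))
    = (\<Sum>\<^sub>\<infinity>x. G (v x) (v x) + (\<Sum>y | adj x y. G (v x) (v y)))"
proof -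
  define B where "B x = insert x {y. adj x y}" for x :: "int ^ 'n"
  have set_eq: "{(x, y). gdist x y \<le> 1} = Sigma UNIV B"
    unfolding gdist_le_1_iff B_def by auto
  define S where "S = {x. v x \<noteq> 0} \<union> (\<Union>y\<in>{y. v y \<noteq> 0}. {x. adj x y})"
  have "finite S" using v finite_neighbours unfolding S_def fin_supp_def
    by (auto simp: adj_sym[of _ "y" for y])
  then have fin: "finite (Sigma S B)" by (auto simp: B_def)
  have "{p \<in> Sigma UNIV B. (case p of (x, y) \<Rightarrow> G (v x) (v y)) \<noteq> 0} \<subseteq> Sigma S B"
  proof
    fix p assume "p \<in> {p \<in> Sigma UNIV B. (case p of (x, y) \<Rightarrow> G (v x) (v y)) \<noteq> 0}"
    then obtain x y where p: "p = (x, y)" "y \<in> B x" "G (v x) (v y) \<noteq> 0" by auto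
    then have "v x \<noteq> 0 \<or> v y \<noteq> 0" using G by auto
    then have "x \<in> S" using p(2) by (auto simp: S_def B_def)
    then show "p \<in> Sigma S B" using p by simp
  qed
  then have "(\<lambda>(x, y). G (v x) (v y)) summable_on Sigma UNIV B"
    using fin by (intro finite_nonzero_values_imp_summable_on) (rule finite_subset)
  then have outer: "(\<Sum>\<^sub>\<infinity>(x, y)\<in>Sigma UNIV B. G (v x) (v y)) = (\<Sum>\<^sub>\<infinity>x. \<Sum>\<^sub>\<infinity>y\<in>B x. G (v x) (v y))"
    by (rule infsum_Sigma'_banach[symmetric])
  have inner: "(\<Sum>\<^sub>\<infinity>y\<in>B x. G (v x) (v y)) = G (v x) (v x) + (\<Sum>y | adj x y. G (v x) (v y))" for x
  proof -
    have "\<not> adj x x" by (simp add: adj_def)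
    then show ?thesis by (simp add: B_def)
  qed
  show ?thesis by (simp only: set_eq outer inner)
qed

context schwarz_rearrangement
begin

lemma fin_supp_C0_plus: "fin_supp u \<Longrightarrow> (\<And>x. 0 \<le> u x) \<Longrightarrow> u \<in> C0_plus"
  unfolding C0_plus_def fin_supp_def by (auto elim: rev_finite_subset)

lemma star_nonneg:
  assumes "fin_supp u" "\<And>x. 0 \<le> u x"
  shows "0 \<le> star u x"
  using star_C0_plus[OF fin_supp_C0_plus[OF assms]] by (simp add: C0_plus_def)

lemma fin_supp_star:
  assumes u: "fin_supp u" "\<And>x. 0 \<le> u x"
  shows "fin_supp (star u)"
proof -
  have "{x. star u x \<noteq> 0} \<subseteq> set_star {x. u x \<noteq> 0}"
  proof
    fix x assume "x \<in> {x. star u x \<noteq> 0}"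
    then have pos: "0 < star u x" using star_nonneg[OF u, of x] by simp
    \<comment> \<open>\<open>level_sets\<close> asks for a positive level; half the value is one
      that lies strictly below the value.\<close>
    have "x \<in> {y. star u x / 2 < star u y}" using pos by simp
    also have "\<dots> = set_star {y. star u x / 2 < u y}"
      using pos by (intro level_sets fin_supp_C0_plus u) simp
    also have "\<dots> \<subseteq> set_star {x. u x \<noteq> 0}"
      using u(1) pos by (intro set_star_mono) (auto simp: fin_supp_def)
    finally show "x \<in> set_star {x. u x \<noteq> 0}" .
  qed
  then show ?thesis using u(1) finite_set_star unfolding fin_supp_def by (meson finite_subset)
qed

text \<open>A function \<open>G\<close> of its first argument alone is supermodular.\<close>

lemma power_sum_star_ge:
  assumes u: "fin_supp u" "\<And>x. 0 \<le> u x" and \<alpha>: "0 < \<alpha>"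
  shows "power_sum \<alpha> u \<le> power_sum \<alpha> (star u)"
proof -
  \<comment> \<open>The pair sum counts each point 2 N + 1 times: once for itself and once per
    neighbour.\<close>
  have pairs: "(\<Sum>\<^sub>\<infinity>(x, y)\<in>{(x, y). gdist x y \<le> 1}. v x powr \<alpha>) = (1 + 2 * real CARD('n)) * power_sum \<alpha> v"
    if v: "fin_supp v" "\<And>x. 0 \<le> v x" for v :: "int ^ 'n \<Rightarrow> real"
  proof -
    have "(\<Sum>\<^sub>\<infinity>(x, y)\<in>{(x, y). gdist x y \<le> 1}. v x powr \<alpha>)
      = (\<Sum>\<^sub>\<infinity>x. v x powr \<alpha> + (\<Sum>y | adj x y. v x powr \<alpha>))"
      by (rule infsum_neighbour_pairs[OF v(1), of "\<lambda>a b. a powr \<alpha>"]) simp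
    also have "\<dots> = (\<Sum>\<^sub>\<infinity>x. (1 + 2 * real CARD('n)) * \<bar>v x\<bar> powr \<alpha>)"
      unfolding sum_neighbours using v(2) by (intro infsum_cong) (simp add: algebra_simps)
    finally show ?thesis by (simp only: infsum_cmult_right' power_sum_def)
  qed
  have "(\<Sum>\<^sub>\<infinity>(x, y)\<in>{(x, y). gdist x y \<le> 1}. u x powr \<alpha>)
    \<le> (\<Sum>\<^sub>\<infinity>(x, y)\<in>{(x, y). gdist x y \<le> 1}. star u x powr \<alpha>)"
  proof (rule riesz[of "\<lambda>a b. a powr \<alpha>"])
    show "continuous_on ({0..} \<times> {0..}) (\<lambda>(a, b :: real). a powr \<alpha>)"
      unfolding case_prod_unfold using \<alpha> by (intro continuous_on_powr' continuous_intros) auto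
  qed (use u in auto)
  then have "(1 + 2 * real CARD('n)) * power_sum \<alpha> u \<le> (1 + 2 * real CARD('n)) * power_sum \<alpha> (star u)"
    by (simp only: pairs u fin_supp_star[OF u] star_nonneg[OF u])
  then show ?thesis by (rule mult_left_le_imp_le) simp
qed

text \<open>\<open>riesz\<close> with the integrand - k (a - b) and both functions equal to
  \<open>u\<close>. The integrand must be finite and continuous on the whole quadrant, and nothing
  is known yet about the slopes of \<open>star u\<close>; hence \<open>tangent_sup\<close> in place
  of \<open>born_infeld\<close>.\<close>

lemma tangent_sup_energy_star_le:
  assumes u: "fin_supp u" "\<And>x. 0 \<le> u x" and \<epsilon>: "0 < \<epsilon>"
  shows "(\<Sum>\<^sub>\<infinity>x. \<Sum>i\<in>UNIV. tangent_sup \<epsilon> (star u (x + unit_vec i) - star u x))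
    \<le> (\<Sum>\<^sub>\<infinity>x. \<Sum>i\<in>UNIV. tangent_sup \<epsilon> (u (x + unit_vec i) - u x))"
proof -
  define k where "k = tangent_sup \<epsilon>"
  have k0: "k 0 = 0" "k (- t) = k t" for t
    using tangent_sup_0[OF \<epsilon>] tangent_sup_minus[OF \<epsilon>] by (auto simp: k_def)
  have cvx: "convex_on UNIV k" unfolding k_def by (rule convex_tangent_sup[OF \<epsilon>])
  have pairs: "(\<Sum>\<^sub>\<infinity>(x, y)\<in>{(x, y). gdist x y \<le> 1}. - k (v x - v y))
      = - 2 * (\<Sum>\<^sub>\<infinity>x. \<Sum>i\<in>UNIV. k (v (x + unit_vec i) - v x))"
    if v: "fin_supp v" for v :: "int ^ 'n \<Rightarrow> real"
  proof -
    have "(\<Sum>\<^sub>\<infinity>(x, y)\<in>{(x, y). gdist x y \<le> 1}. - k (v x - v y))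
      = (\<Sum>\<^sub>\<infinity>x. - k (v x - v x) + (\<Sum>y | adj x y. - k (v x - v y)))"
      by (rule infsum_neighbour_pairs[OF v, of "\<lambda>a b. - k (a - b)"]) (simp add: k0)
    also have "\<dots> = (\<Sum>\<^sub>\<infinity>x. - (\<Sum>y | adj x y. k (grad v x y)))"
    proof (rule infsum_cong)
      fix x
      have "k (v x - v y) = k (grad v x y)" for y
        using k0(2)[of "grad v x y"] by (simp add: grad_def)
      then show "- k (v x - v x) + (\<Sum>y | adj x y. - k (v x - v y)) = - (\<Sum>y | adj x y. k (grad v x y))"
        by (simp add: k0 sum_negf)
    qed
    also have "\<dots> = - 2 * (\<Sum>\<^sub>\<infinity>x. \<Sum>i\<in>UNIV. k (v (x + unit_vec i) - v x))"
      unfolding infsum_uminus infsum_neighbours[OF v, of k, OF k0] by simp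
    finally show ?thesis .
  qed
  have "(\<Sum>\<^sub>\<infinity>(x, y)\<in>{(x, y). gdist x y \<le> 1}. - k (u x - u y))
    \<le> (\<Sum>\<^sub>\<infinity>(x, y)\<in>{(x, y). gdist x y \<le> 1}. - k (star u x - star u y))"
  proof (rule riesz[of "\<lambda>a b. - k (a - b)"])
    have "continuous_on UNIV k" by (rule convex_on_continuous[OF open_UNIV cvx])
    then have "continuous_on ({0..} \<times> {0..}) (\<lambda>p. k (fst p - snd p))"
      by (rule continuous_on_compose2) (auto intro!: continuous_intros)
    then show "continuous_on ({0..} \<times> {0..}) (\<lambda>(a, b). - k (a - b))"
      unfolding case_prod_unfold by (rule continuous_on_minus)
    show "- k (a - b') + - k (a' - b) \<le> - k (a - b) + - k (a' - b')"
      if "0 \<le> a" "a \<le> a'" "0 \<le> b" "b \<le> b'" for a a' b b'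
      using convex_diff_supermodular[OF cvx that(2,4)] by simp
  qed (use u k0 in auto)
  then have "- 2 * (\<Sum>\<^sub>\<infinity>x. \<Sum>i\<in>UNIV. k (u (x + unit_vec i) - u x))
    \<le> - 2 * (\<Sum>\<^sub>\<infinity>x. \<Sum>i\<in>UNIV. k (star u (x + unit_vec i) - star u x))"
    by (simp only: pairs[OF u(1)] pairs[OF fin_supp_star[OF u]])
  then show ?thesis by (simp add: k_def)
qed

lemma tangent_sup_energy_star_le_J:
  assumes u: "admissible u" and \<epsilon>: "0 < \<epsilon>"
  shows "(\<Sum>i\<in>UNIV. \<Sum>\<^sub>\<infinity>x. tangent_sup \<epsilon> (star u (x + unit_vec i) - star u x)) \<le> J u"
proof -
  have u': "fin_supp u" "0 \<le> u x" "slope_bounded u" for x using u by (auto simp: admissible_def)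
  have fk: "fin_supp (\<lambda>x. tangent_sup \<epsilon> (v (x + unit_vec i) - v x))"
    if "fin_supp v" for i and v :: "int ^ 'n \<Rightarrow> real"
    by (rule fin_supp_grad[OF that]) (rule tangent_sup_0[OF \<epsilon>])
  have swap: "(\<Sum>\<^sub>\<infinity>x. \<Sum>i\<in>UNIV. tangent_sup \<epsilon> (v (x + unit_vec i) - v x))
      = (\<Sum>i\<in>UNIV. \<Sum>\<^sub>\<infinity>x. tangent_sup \<epsilon> (v (x + unit_vec i) - v x))"
    if "fin_supp v" for v :: "int ^ 'n \<Rightarrow> real"
    by (intro infsum_sum fin_supp_summable fk that) simp
  have "(\<Sum>i\<in>UNIV. \<Sum>\<^sub>\<infinity>x. tangent_sup \<epsilon> (star u (x + unit_vec i) - star u x))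
      \<le> (\<Sum>i\<in>UNIV. \<Sum>\<^sub>\<infinity>x. tangent_sup \<epsilon> (u (x + unit_vec i) - u x))"
    using tangent_sup_energy_star_le[OF u'(1,2) \<epsilon>] by (simp only: swap u' fin_supp_star)
  also have "\<dots> \<le> J u"
    unfolding J_fin_supp[OF u'(1)]
    by (intro sum_mono infsum_mono_fin_supp fk u' fin_supp_grad tangent_sup_le_born_infeld \<epsilon>
        slope_boundedD) auto
  finally show ?thesis .
qed

text \<open>An edge of slope above 1 would cost an amount of order 1 / \<epsilon>, while the
  rearranged energy stays below \<open>J u\<close> for every \<epsilon>.\<close>

lemma slope_bounded_star:
  assumes u: "admissible u"
  shows "slope_bounded (star u)"
  unfolding slope_bounded_def
proof (intro allI)
  fix x i
  have u': "fin_supp u" "0 \<le> u x" for x using u by (auto simp: admissible_def)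
  define t where "t = star u (x + unit_vec i) - star u x"
  have bound: "(\<bar>t\<bar> - 1) / \<epsilon> \<le> J u" if \<epsilon>: "0 < \<epsilon>" for \<epsilon>
  proof -
    define K where "K i x = tangent_sup \<epsilon> (star u (x + unit_vec i) - star u x)" for i x
    have K0: "0 \<le> K i x" for i x unfolding K_def by (rule tangent_sup_nonneg[OF \<epsilon>])
    have fK: "fin_supp (K i)" for i unfolding K_def
      by (intro fin_supp_grad fin_supp_star u' tangent_sup_0[OF \<epsilon>])
    have "(\<bar>t\<bar> - 1) / \<epsilon> \<le> K i x" unfolding K_def t_def by (rule tangent_sup_ge_slope[OF \<epsilon>])
    also have "\<dots> \<le> (\<Sum>\<^sub>\<infinity>x. K i x)"
      using finite_sum_le_infsum[of "K i" UNIV "{x}"] fin_supp_summable[OF fK] K0 by simp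
    also have "\<dots> \<le> (\<Sum>i\<in>UNIV. \<Sum>\<^sub>\<infinity>x. K i x)"
      by (intro member_le_sum infsum_nonneg K0) auto
    also have "\<dots> \<le> J u" unfolding K_def by (rule tangent_sup_energy_star_le_J[OF u \<epsilon>])
    finally show ?thesis .
  qed
  show "\<bar>star u (x + unit_vec i) - star u x\<bar> \<le> 1"
  proof (rule ccontr)
    assume "\<not> ?thesis"
    then have t: "0 < \<bar>t\<bar> - 1" by (simp add: t_def)
    \<comment> \<open>Chosen so that the edge alone would cost J u + 1.\<close>
    define \<epsilon> where "\<epsilon> = (\<bar>t\<bar> - 1) / (J u + 1)"
    have J: "0 < J u + 1" using J_nonneg[of u] by linarith
    have "(\<bar>t\<bar> - 1) / \<epsilon> \<le> J u" by (rule bound) (use t J in \<open>simp add: \<epsilon>_def\<close>)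
    moreover have "(\<bar>t\<bar> - 1) / \<epsilon> = J u + 1" using t J by (simp add: \<epsilon>_def)
    ultimately show False by simp
  qed
qed

lemma admissible_star:
  assumes "admissible u"
  shows "admissible (star u)"
  using assms slope_bounded_star[OF assms] by (auto simp: admissible_def intro: fin_supp_star star_nonneg)

text \<open>Let \<epsilon> tend to 0 in the contracted energies, finite sums over the edges where
  \<open>star u\<close> changes. The lower bound by \<open>born_infeld\<close> asks for slopes at
  most 1, which is why \<open>slope_bounded_star\<close> comes first.\<close>

lemma J_star_le:
  assumes u: "admissible u"
  shows "J (star u) \<le> J u"
proof -
  have fs: "fin_supp (star u)" and sl: "slope_bounded (star u)"
    using admissible_star[OF u] by (auto simp: admissible_def)
  define d where "d i x = star u (x + unit_vec i) - star u x" for i x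
  have fd: "fin_supp (d i)" for i unfolding d_def using fin_supp_grad[OF fs, of "\<lambda>t. t"] by simp
  define E where "E \<epsilon> = (\<Sum>i\<in>UNIV. \<Sum>x | d i x \<noteq> 0. born_infeld (d i x / sqrt (1 + \<epsilon>\<^sup>2)))" for \<epsilon>
  have sum_eq: "(\<Sum>\<^sub>\<infinity>x. \<phi> (d i x)) = (\<Sum>x | d i x \<noteq> 0. \<phi> (d i x))" if "\<phi> 0 = 0" for \<phi> :: "real \<Rightarrow> real" and i
    using fd[of i] that by (intro infsum_eq_sum_supp) (auto simp: fin_supp_def)
  have E_le: "E \<epsilon> \<le> J u" if \<epsilon>: "0 < \<epsilon>" for \<epsilon>
  proof -
    have "E \<epsilon> \<le> (\<Sum>i\<in>UNIV. \<Sum>x | d i x \<noteq> 0. tangent_sup \<epsilon> (d i x))"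
      unfolding E_def
    proof (intro sum_mono tangent_sup_ge_born_infeld[OF \<epsilon>])
      show "\<bar>d i x\<bar> \<le> 1" for i x using slope_boundedD[OF sl] by (simp add: d_def)
    qed
    also have "\<dots> = (\<Sum>i\<in>UNIV. \<Sum>\<^sub>\<infinity>x. tangent_sup \<epsilon> (d i x))"
      by (simp add: sum_eq tangent_sup_0[OF \<epsilon>])
    also have "\<dots> \<le> J u" unfolding d_def by (rule tangent_sup_energy_star_le_J[OF u \<epsilon>])
    finally show ?thesis .
  qed
  have "(\<lambda>n. E (inverse (real (Suc n)))) \<longlonglongrightarrow> E 0"
    unfolding E_def born_infeld_def
    by (intro tendsto_intros LIMSEQ_inverse_real_of_nat) auto
  moreover have "E 0 = J (star u)"
    unfolding E_def J_fin_supp[OF fs] d_def[symmetric] by (simp add: sum_eq)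
  ultimately show ?thesis using E_le by (intro LIMSEQ_le_const2) auto
qed

end

section \<open>Truncation and membership in the function spaces\<close>

lemma finite_superlevel_lq:
  assumes "u \<in> lq p" "0 < p" "0 < c"
  shows "finite {x. c < \<bar>u x\<bar>}"
proof (rule ccontr)
  assume inf: "infinite {x. c < \<bar>u x\<bar>}"
  have "(\<lambda>x. \<bar>u x\<bar> powr p) summable_on {x. c < \<bar>u x\<bar>}"
    using assms(1) unfolding lq_def by (auto intro: summable_on_subset_banach)
  then have "(\<lambda>x. c powr p) summable_on {x. c < \<bar>u x\<bar>}"
    by (rule summable_on_comparison_test) (use assms in \<open>auto intro!: powr_mono2\<close>)
  moreover have "c powr p \<noteq> 0" using assms by simp
  ultimately show False using infsum_diverge_constant[OF inf] by blast
qed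

text \<open>One map serves three purposes: it passes to the modulus, makes the support of an l^q
  function finite and increases no difference.\<close>

definition truncation :: "real \<Rightarrow> ('a \<Rightarrow> real) \<Rightarrow> 'a \<Rightarrow> real" where
  "truncation c u x = max (\<bar>u x\<bar> - c) 0"

lemma truncation_nonneg: "0 \<le> truncation c u x"
  by (simp add: truncation_def)

lemma abs_truncation_diff_le: "\<bar>truncation c u y - truncation c u x\<bar> \<le> \<bar>u y - u x\<bar>"
  unfolding truncation_def by linarith

lemma fin_supp_truncation:
  assumes "u \<in> lq p" "0 < p" "0 < c"
  shows "fin_supp (truncation c u)"
  unfolding fin_supp_def
  by (rule finite_subset[OF _ finite_superlevel_lq[OF assms]]) (auto simp: truncation_def)

text \<open>A finite set already carries more than \<open>K\<close>; on it c may tend to 0 term by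
  term.\<close>

lemma power_sum_truncation_approx:
  assumes u: "u \<in> lq \<alpha>" and \<alpha>: "0 < \<alpha>" and K: "K < power_sum \<alpha> u"
  obtains c where "0 < c" "K < power_sum \<alpha> (truncation c u)"
proof -
  define f where "f x = \<bar>u x\<bar> powr \<alpha>" for x
  have sm: "f summable_on UNIV" using u by (simp add: lq_def f_def[abs_def])
  have "0 < (power_sum \<alpha> u - K) / 2" using K by simp
  then obtain F where F: "finite F" "dist (sum f F) (infsum f UNIV) \<le> (power_sum \<alpha> u - K) / 2"
    using infsum_finite_approximation[OF sm] by blast
  define I where "I = infsum f UNIV"
  have "power_sum \<alpha> u = I" by (simp add: power_sum_def f_def[abs_def] I_def)
  then have "\<bar>sum f F - I\<bar> \<le> (I - K) / 2" "K < I"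
    using K F(2) by (simp_all add: dist_real_def I_def)
  moreover have "I - sum f F \<le> \<bar>sum f F - I\<bar>" by simp
  ultimately have KF: "K < sum f F" by argo
  have "(\<lambda>n. \<Sum>x\<in>F. \<bar>truncation (inverse (real (Suc n))) u x\<bar> powr \<alpha>)
      \<longlonglongrightarrow> (\<Sum>x\<in>F. \<bar>max (\<bar>u x\<bar> - 0) 0\<bar> powr \<alpha>)"
    unfolding truncation_def using \<alpha>
    by (intro tendsto_sum tendsto_powr' tendsto_rabs tendsto_max tendsto_diff tendsto_const
        LIMSEQ_inverse_real_of_nat) auto
  then have "(\<lambda>n. \<Sum>x\<in>F. \<bar>truncation (inverse (real (Suc n))) u x\<bar> powr \<alpha>) \<longlonglongrightarrow> sum f F"
    by (simp add: f_def)
  from order_tendstoD(1)[OF this KF]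
  obtain n where n: "K < (\<Sum>x\<in>F. \<bar>truncation (inverse (real (Suc n))) u x\<bar> powr \<alpha>)"
    by (auto simp: eventually_sequentially)
  have "fin_supp (\<lambda>x. \<bar>truncation (inverse (real (Suc n))) u x\<bar> powr \<alpha>)"
    by (rule fin_supp_map[OF fin_supp_truncation[OF u \<alpha>], of _ "\<lambda>t. \<bar>t\<bar> powr \<alpha>"]) auto
  then have "(\<Sum>x\<in>F. \<bar>truncation (inverse (real (Suc n))) u x\<bar> powr \<alpha>)
      \<le> power_sum \<alpha> (truncation (inverse (real (Suc n))) u)"
    unfolding power_sum_def using F(1) by (intro finite_sum_le_infsum fin_supp_summable) auto
  with n show thesis by (intro that[of "inverse (real (Suc n))"]) auto
qed

section \<open>Finite energy and membership in \<open>X_space\<close>\<close>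

lemma finite_energy_fin_supp:
  assumes "fin_supp \<phi>"
  shows "finite_energy \<phi>"
proof -
  have "fin_supp (\<lambda>x. \<Sum>i\<in>UNIV. (\<phi> (x + unit_vec i) - \<phi> x)\<^sup>2)"
    by (intro fin_supp_sum fin_supp_grad assms) auto
  moreover have "fin_supp (\<lambda>x. \<Sum>i\<in>UNIV. (\<phi> (x - unit_vec i) - \<phi> x)\<^sup>2)"
    by (intro fin_supp_sum fin_supp_map2[where \<phi> = "\<lambda>a b. (a - b)\<^sup>2"] fin_supp_shift assms) auto
  ultimately have "fin_supp (\<lambda>x. (\<Sum>i\<in>UNIV. (\<phi> (x + unit_vec i) - \<phi> x)\<^sup>2) + (\<Sum>i\<in>UNIV. (\<phi> (x - unit_vec i) - \<phi> x)\<^sup>2))"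
    by (rule fin_supp_map2) simp
  then show ?thesis
    unfolding finite_energy_def sum_neighbours grad_def by (simp add: fin_supp_summable)
qed

lemma finite_energy_add:
  assumes "finite_energy u" "finite_energy v"
  shows "finite_energy (\<lambda>x. u x + v x)"
proof -
  define e where "e w x = (\<Sum>y | adj x y. \<bar>grad w x y\<bar>\<^sup>2)" for w :: "int ^ 'a \<Rightarrow> real" and x
  have "(\<lambda>x. 2 * e u x + 2 * e v x) summable_on UNIV"
    using assms unfolding finite_energy_def e_def by (intro summable_on_add summable_on_cmult_right)
  then have "e (\<lambda>x. u x + v x) summable_on UNIV"
  proof (rule summable_on_comparison_test)
    show "e (\<lambda>x. u x + v x) x \<le> 2 * e u x + 2 * e v x" for x
      unfolding e_def sum_distrib_left sum.distrib[symmetric]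
    proof (rule sum_mono)
      fix y
      have "(grad (\<lambda>x. u x + v x) x y)\<^sup>2 + (grad u x y - grad v x y)\<^sup>2 = 2 * (grad u x y)\<^sup>2 + 2 * (grad v x y)\<^sup>2"
        by (simp add: grad_def power2_eq_square algebra_simps)
      then show "\<bar>grad (\<lambda>x. u x + v x) x y\<bar>\<^sup>2 \<le> 2 * \<bar>grad u x y\<bar>\<^sup>2 + 2 * \<bar>grad v x y\<bar>\<^sup>2"
        using zero_le_power2[of "grad u x y - grad v x y"] by (simp only: power2_abs)
    qed
    show "0 \<le> e (\<lambda>x. u x + v x) x" for x unfolding e_def by (intro sum_nonneg) auto
  qed
  then show ?thesis by (simp add: finite_energy_def e_def[abs_def])
qed

lemma finite_energy_D12:
  assumes "u \<in> D12"
  shows "finite_energy u"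
proof -
  obtain \<phi> where \<phi>: "fin_supp \<phi>" "finite_energy (\<lambda>x. u x - \<phi> x)"
    using assms unfolding D12_def by blast
  show ?thesis using finite_energy_add[OF \<phi>(2) finite_energy_fin_supp[OF \<phi>(1)]] by simp
qed

lemma summable_born_infeld:
  assumes "finite_energy u" "\<And>x y. adj x y \<Longrightarrow> \<bar>grad u x y\<bar> \<le> 1"
  shows "(\<lambda>x. \<Sum>y | adj x y. born_infeld (grad u x y)) summable_on UNIV"
proof (rule summable_on_comparison_test)
  show "(\<lambda>x. \<Sum>y | adj x y. \<bar>grad u x y\<bar>\<^sup>2) summable_on UNIV"
    using assms(1) by (simp add: finite_energy_def)
  show "(\<Sum>y | adj x y. born_infeld (grad u x y)) \<le> (\<Sum>y | adj x y. \<bar>grad u x y\<bar>\<^sup>2)" for x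
    using assms(2) by (intro sum_mono) (simp add: born_infeld_le_square)
  show "0 \<le> (\<Sum>y | adj x y. born_infeld (grad u x y))" for x
    by (intro sum_nonneg born_infeld_nonneg)
qed

lemma J_born_infeld: "J u = 1 / 2 * (\<Sum>\<^sub>\<infinity>x. \<Sum>y | adj x y. born_infeld (grad u x y))"
  by (simp add: J_def born_infeld_def)

lemma slope_bounded_iff:
  fixes u :: "int ^ 'n::finite \<Rightarrow> real"
  shows "slope_bounded u \<longleftrightarrow> (\<forall>x y. adj x y \<longrightarrow> \<bar>grad u x y\<bar> \<le> 1)"
proof
  assume s: "slope_bounded u"
  show "\<forall>x y. adj x y \<longrightarrow> \<bar>grad u x y\<bar> \<le> 1"
  proof (intro allI impI)
    fix x y :: "int ^ 'n" assume "adj x y"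
    then obtain i where "y = x + unit_vec i \<or> y = x - unit_vec i" by (auto simp: adj_iff)
    then show "\<bar>grad u x y\<bar> \<le> 1"
      using slope_boundedD[OF s, of x i] slope_boundedD[OF s, of "x - unit_vec i" i]
      by (auto simp: grad_def abs_minus_commute)
  qed
next
  assume "\<forall>x y. adj x y \<longrightarrow> \<bar>grad u x y\<bar> \<le> 1"
  then show "slope_bounded u"
    unfolding slope_bounded_def grad_def by (auto intro: adj_plus_unit_vec)
qed

lemma J_le_of_grad_le:
  assumes u: "finite_energy u" "slope_bounded u"
    and le: "\<And>x y. \<bar>grad v x y\<bar> \<le> \<bar>grad u x y\<bar>" and v: "fin_supp v"
  shows "J v \<le> J u" "slope_bounded v"
proof -
  show s: "slope_bounded v"
    unfolding slope_bounded_iff using u(2) le by (meson order_trans slope_bounded_iff)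
  have "(\<Sum>\<^sub>\<infinity>x. \<Sum>y | adj x y. born_infeld (grad v x y)) \<le> (\<Sum>\<^sub>\<infinity>x. \<Sum>y | adj x y. born_infeld (grad u x y))"
  proof (rule infsum_mono)
    show "(\<lambda>x. \<Sum>y | adj x y. born_infeld (grad v x y)) summable_on UNIV"
      "(\<lambda>x. \<Sum>y | adj x y. born_infeld (grad u x y)) summable_on UNIV"
      using u s finite_energy_fin_supp[OF v] by (auto intro!: summable_born_infeld simp: slope_bounded_iff)
  qed (intro sum_mono born_infeld_mono le)
  then show "J v \<le> J u" unfolding J_born_infeld by simp
qed

lemma admissible_truncation:
  assumes u: "u \<in> X_space" "u \<in> lq \<alpha>" "0 < \<alpha>" and c: "0 < c"
  shows "admissible (truncation c u)" "J (truncation c u) \<le> J u"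
proof -
  have e: "finite_energy u" "slope_bounded u"
    using u(1) by (auto simp: X_space_def slope_bounded_iff intro: finite_energy_D12)
  have f: "fin_supp (truncation c u)" by (rule fin_supp_truncation[OF u(2,3) c])
  have le: "\<bar>grad (truncation c u) x y\<bar> \<le> \<bar>grad u x y\<bar>" for x y
    unfolding grad_def by (rule abs_truncation_diff_le)
  show "admissible (truncation c u)" "J (truncation c u) \<le> J u"
    using J_le_of_grad_le[OF e le f] f by (auto simp: admissible_def truncation_nonneg)
qed

text \<open>The truncations of \<open>u\<close> serve as approximants. What they remove is the
  minimum of \<open>u\<close> and \<open>c k\<close>, whose differences are bounded by those of
  \<open>u\<close> and by \<open>c k\<close>: the first bound controls the energy outside a finite
  set, the second makes it vanish on that set.\<close>

lemma X_spaceI: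
  fixes u :: "int ^ 'n::finite \<Rightarrow> real"
  assumes u: "\<And>x. 0 \<le> u x" "u \<in> lq (crit_exp CARD('n))" "finite_energy u" "slope_bounded u"
    and p: "0 < crit_exp CARD('n)"
  shows "u \<in> X_space"
proof -
  define c :: "nat \<Rightarrow> real" where "c k = inverse (real (Suc k))" for k
  have c: "0 < c k" for k by (simp add: c_def)
  define \<psi> where "\<psi> k x = u x - truncation (c k) u x" for k x
  define e where "e w x = (\<Sum>y | adj x y. \<bar>grad w x y\<bar>\<^sup>2)" for w :: "int ^ 'n \<Rightarrow> real" and x
  have e0: "0 \<le> e w x" for w x unfolding e_def by (intro sum_nonneg) auto
  have eu: "e u summable_on UNIV" using u(3) by (simp add: finite_energy_def e_def[abs_def])
  have \<psi>: "\<psi> k x = min (u x) (c k)" for k x using u(1)[of x] by (simp add: \<psi>_def truncation_def)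
  have le1: "e (\<psi> k) x \<le> e u x" for k x
    unfolding e_def
  proof (rule sum_mono)
    fix y
    have "\<bar>grad (\<psi> k) x y\<bar> \<le> \<bar>grad u x y\<bar>" unfolding grad_def \<psi> by linarith
    then show "\<bar>grad (\<psi> k) x y\<bar>\<^sup>2 \<le> \<bar>grad u x y\<bar>\<^sup>2" by (intro power_mono) auto
  qed
  have le2: "e (\<psi> k) x \<le> real (card {y. adj x y}) * (c k)\<^sup>2" for k x
    unfolding e_def
  proof (rule sum_bounded_above)
    fix y
    have "\<bar>grad (\<psi> k) x y\<bar> \<le> c k" unfolding grad_def \<psi> using u(1)[of x] u(1)[of y] c[of k] by linarith
    then show "\<bar>grad (\<psi> k) x y\<bar>\<^sup>2 \<le> (c k)\<^sup>2" by (intro power_mono) auto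
  qed
  have e\<psi>: "e (\<psi> k) summable_on UNIV" for k
    by (rule summable_on_comparison_test[OF eu le1 e0])
  have "(\<lambda>k. \<Sum>\<^sub>\<infinity>x. e (\<psi> k) x) \<longlonglongrightarrow> 0"
  proof (rule LIMSEQ_I)
    fix r :: real assume r: "0 < r"
    then have "0 < r / 2" by simp
    then obtain F where F: "finite F" "dist (sum (e u) F) (infsum (e u) UNIV) \<le> r / 2"
      using infsum_finite_approximation[OF eu] by blast
    have tail: "infsum (e w) UNIV = sum (e w) F + infsum (e w) (- F)" if "e w summable_on UNIV" for w
    proof -
      have "infsum (e w) (F \<union> - F) = infsum (e w) F + infsum (e w) (- F)"
        using that F(1) by (intro infsum_Un_disjoint) (auto intro: summable_on_subset_banach)
      then show ?thesis using F(1) by simp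
    qed
    have tl: "infsum (e (\<psi> k)) (- F) \<le> r / 2" for k
    proof -
      have "infsum (e (\<psi> k)) (- F) \<le> infsum (e u) (- F)"
        using e\<psi> eu by (intro infsum_mono le1) (auto intro: summable_on_subset_banach)
      then show ?thesis using F(2) tail[OF eu] by (simp add: dist_real_def)
    qed
    have "(\<lambda>k. \<Sum>x\<in>F. real (card {y. adj x y}) * (c k)\<^sup>2) \<longlonglongrightarrow> (\<Sum>x\<in>F. real (card {y. adj x y}) * 0\<^sup>2)"
      unfolding c_def by (intro tendsto_intros LIMSEQ_inverse_real_of_nat)
    then have "(\<lambda>k. \<Sum>x\<in>F. real (card {y. adj x y}) * (c k)\<^sup>2) \<longlonglongrightarrow> 0" by simp
    then have "eventually (\<lambda>k. (\<Sum>x\<in>F. real (card {y. adj x y}) * (c k)\<^sup>2) < r / 2) sequentially"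
      using r by (intro order_tendstoD(2)[where y = 0]) auto
    then obtain k0 where k0: "\<And>k. k0 \<le> k \<Longrightarrow> (\<Sum>x\<in>F. real (card {y. adj x y}) * (c k)\<^sup>2) < r / 2"
      by (auto simp: eventually_sequentially)
    have "norm ((\<Sum>\<^sub>\<infinity>x. e (\<psi> k) x) - 0) < r" if "k0 \<le> k" for k
    proof -
      have "sum (e (\<psi> k)) F \<le> (\<Sum>x\<in>F. real (card {y. adj x y}) * (c k)\<^sup>2)" by (intro sum_mono le2)
      then have "(\<Sum>\<^sub>\<infinity>x. e (\<psi> k) x) < r" using k0[OF that] tl[of k] tail[OF e\<psi>] by simp
      moreover have "0 \<le> (\<Sum>\<^sub>\<infinity>x. e (\<psi> k) x)" by (intro infsum_nonneg e0)
      ultimately show ?thesis by simp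
    qed
    then show "\<exists>no. \<forall>k\<ge>no. norm ((\<Sum>\<^sub>\<infinity>x. e (\<psi> k) x) - 0) < r" by blast
  qed
  then have "(\<lambda>k. sqrt (1 / 2 * (\<Sum>\<^sub>\<infinity>x. e (\<psi> k) x))) \<longlonglongrightarrow> sqrt (1 / 2 * 0)"
    by (intro tendsto_intros)
  then have "(\<lambda>k. D12_norm (\<psi> k)) \<longlonglongrightarrow> 0" by (simp add: D12_norm_def e_def)
  moreover have "finite_energy (\<psi> k)" for k using e\<psi> by (simp add: finite_energy_def e_def[abs_def])
  moreover have "fin_supp (truncation (c k) u)" for k by (rule fin_supp_truncation[OF u(2) p c])
  ultimately have "u \<in> D12"
    unfolding D12_def \<psi>_def using u(2) by (auto intro!: exI[of _ "\<lambda>k. truncation (c k) u"])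
  then show ?thesis using u(4) by (auto simp: X_space_def slope_bounded_iff)
qed

section \<open>Convergence\<close>

text \<open>A substitute for Minkowski's inequality; the weights tend to \<open>1\<close> and \<open>\<infinity>\<close> as \<open>l\<close> tends to \<open>0\<close>.\<close>

lemma powr_add_le:
  fixes a b l \<alpha> :: real
  assumes "0 \<le> a" "0 \<le> b" "0 < l" "l < 1" "1 < \<alpha>"
  shows "(a + b) powr \<alpha> \<le> (1 - l) powr (1 - \<alpha>) * a powr \<alpha> + l powr (1 - \<alpha>) * b powr \<alpha>"
proof -
  define m where "m = a + b"
  have m: "0 \<le> m" using assms by (simp add: m_def)
  have "(1 - l) * (m powr \<alpha> + \<alpha> * m powr (\<alpha> - 1) * (a / (1 - l) - m))
      + l * (m powr \<alpha> + \<alpha> * m powr (\<alpha> - 1) * (b / l - m))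
    \<le> (1 - l) * (a / (1 - l)) powr \<alpha> + l * (b / l) powr \<alpha>"
    using assms m by (intro add_mono mult_left_mono powr_ge_tangent) auto
  also have "(1 - l) * (m powr \<alpha> + \<alpha> * m powr (\<alpha> - 1) * (a / (1 - l) - m))
      + l * (m powr \<alpha> + \<alpha> * m powr (\<alpha> - 1) * (b / l - m))
    = m powr \<alpha> + \<alpha> * m powr (\<alpha> - 1) * ((1 - l) * (a / (1 - l)) + l * (b / l) - m)"
    by (simp add: algebra_simps)
  also have "\<dots> = m powr \<alpha>" using assms by (simp add: m_def)
  also have "(1 - l) * (a / (1 - l)) powr \<alpha> = (1 - l) powr (1 - \<alpha>) * a powr \<alpha>"
    using assms by (simp add: powr_divide powr_diff)
  also have "l * (b / l) powr \<alpha> = l powr (1 - \<alpha>) * b powr \<alpha>"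
    using assms by (simp add: powr_divide powr_diff)
  finally show ?thesis by (simp add: m_def)
qed

lemma lq_diff:
  assumes "f \<in> lq \<alpha>" "g \<in> lq \<alpha>" "1 < \<alpha>"
  shows "(\<lambda>x. f x - g x) \<in> lq \<alpha>"
proof -
  define k where "k = (1 / 2) powr (1 - \<alpha>)"
  have "(\<lambda>x. k * \<bar>f x\<bar> powr \<alpha> + k * \<bar>g x\<bar> powr \<alpha>) summable_on UNIV"
    using assms by (intro summable_on_add summable_on_cmult_right) (auto simp: lq_def)
  then have "(\<lambda>x. \<bar>f x - g x\<bar> powr \<alpha>) summable_on UNIV"
  proof (rule summable_on_comparison_test)
    fix x
    have "\<bar>f x - g x\<bar> powr \<alpha> \<le> (\<bar>f x\<bar> + \<bar>g x\<bar>) powr \<alpha>" using assms by (intro powr_mono2) auto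
    also have "\<dots> \<le> k * \<bar>f x\<bar> powr \<alpha> + k * \<bar>g x\<bar> powr \<alpha>"
      using powr_add_le[of "\<bar>f x\<bar>" "\<bar>g x\<bar>" "1 / 2" \<alpha>] assms by (simp add: k_def)
    finally show "\<bar>f x - g x\<bar> powr \<alpha> \<le> k * \<bar>f x\<bar> powr \<alpha> + k * \<bar>g x\<bar> powr \<alpha>" .
  qed auto
  then show ?thesis by (simp add: lq_def)
qed

lemma lq_converges_power_sum_diff:
  assumes "lq_converges \<alpha> f u" "1 < \<alpha>"
  shows "(\<lambda>k. power_sum \<alpha> (\<lambda>x. f k x - u x)) \<longlonglongrightarrow> 0"
proof -
  have "(\<lambda>k. lq_norm \<alpha> (\<lambda>x. f k x - u x) powr \<alpha>) \<longlonglongrightarrow> 0 powr \<alpha>"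
    using assms by (intro tendsto_powr' tendsto_const) (auto simp: lq_converges_def lq_norm_def)
  moreover have "lq_norm \<alpha> w powr \<alpha> = power_sum \<alpha> w" for w :: "'a \<Rightarrow> real"
    using assms(2) power_sum_nonneg[of \<alpha> w] by (simp add: lq_norm_def power_sum_def powr_powr)
  ultimately show ?thesis using assms(2) by simp
qed

lemma abs_powr_le_power_sum:
  assumes "w \<in> lq \<alpha>"
  shows "\<bar>w x\<bar> powr \<alpha> \<le> power_sum \<alpha> w"
  using finite_sum_le_infsum[of "\<lambda>x. \<bar>w x\<bar> powr \<alpha>" UNIV "{x}"] assms
  by (simp add: power_sum_def lq_def)

lemma lq_converges_pointwise:
  assumes "lq_converges \<alpha> f u" "1 < \<alpha>"
  shows "(\<lambda>k. f k x) \<longlonglongrightarrow> u x"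
proof -
  have lq: "(\<lambda>x. f k x - u x) \<in> lq \<alpha>" for k
    using assms by (intro lq_diff) (auto simp: lq_converges_def)
  have "(\<lambda>k. power_sum \<alpha> (\<lambda>x. f k x - u x) powr (1 / \<alpha>)) \<longlonglongrightarrow> 0 powr (1 / \<alpha>)"
    using assms by (intro tendsto_powr' tendsto_const lq_converges_power_sum_diff)
      (auto simp: power_sum_nonneg)
  then have lim: "(\<lambda>k. power_sum \<alpha> (\<lambda>x. f k x - u x) powr (1 / \<alpha>)) \<longlonglongrightarrow> 0" by simp
  have "\<bar>f k x - u x\<bar> \<le> power_sum \<alpha> (\<lambda>x. f k x - u x) powr (1 / \<alpha>)" for k
  proof -
    have "(\<bar>f k x - u x\<bar> powr \<alpha>) powr (1 / \<alpha>) \<le> power_sum \<alpha> (\<lambda>x. f k x - u x) powr (1 / \<alpha>)"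
      using abs_powr_le_power_sum[OF lq, of k x] assms(2) by (intro powr_mono2) auto
    then show ?thesis using assms(2) by (simp add: powr_powr)
  qed
  then have "(\<lambda>k. f k x - u x) \<longlonglongrightarrow> 0"
    by (intro Lim_null_comparison[OF _ lim]) auto
  then show ?thesis by (rule LIM_zero_cancel)
qed

text \<open>Upper semicontinuity has two uses: J <= q F^A passes to the limit, and the lower bound
  on F prevents the limit from being 0. The weight \<open>c\<close> is fixed first, so small that
  the factor of the limit is harmless; then \<open>k\<close> removes the difference term.\<close>

lemma lq_converges_power_sum_upper:
  assumes conv: "lq_converges \<alpha> f u" and \<alpha>: "1 < \<alpha>" and K: "power_sum \<alpha> u < K"
  shows "eventually (\<lambda>k. power_sum \<alpha> (f k) < K) sequentially"
proof -
  define l :: "nat \<Rightarrow> real" where "l n = inverse (real (Suc n))" for n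
  have "(\<lambda>n. (1 - l n) powr (1 - \<alpha>) * power_sum \<alpha> u) \<longlonglongrightarrow> (1 - 0) powr (1 - \<alpha>) * power_sum \<alpha> u"
    unfolding l_def by (intro tendsto_intros LIMSEQ_inverse_real_of_nat) auto
  then have "(\<lambda>n. (1 - l n) powr (1 - \<alpha>) * power_sum \<alpha> u) \<longlonglongrightarrow> power_sum \<alpha> u" by simp
  from order_tendstoD(2)[OF this K]
  obtain n0 where n0: "\<And>n. n0 \<le> n \<Longrightarrow> (1 - l n) powr (1 - \<alpha>) * power_sum \<alpha> u < K"
    by (auto simp: eventually_sequentially)
  \<comment> \<open>The successor keeps \<open>c\<close> below 1, since l 0 = 1.\<close>
  define c where "c = l (Suc n0)"
  have c: "0 < c" "c < 1" by (auto simp: c_def l_def inverse_less_1_iff)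
  have cK: "(1 - c) powr (1 - \<alpha>) * power_sum \<alpha> u < K" unfolding c_def by (rule n0) simp
  have u: "u \<in> lq \<alpha>" and f: "f k \<in> lq \<alpha>" for k using conv by (auto simp: lq_converges_def)
  have bound: "power_sum \<alpha> (f k) \<le> (1 - c) powr (1 - \<alpha>) * power_sum \<alpha> u
      + c powr (1 - \<alpha>) * power_sum \<alpha> (\<lambda>x. f k x - u x)" for k
  proof -
    have su: "(\<lambda>x. (1 - c) powr (1 - \<alpha>) * \<bar>u x\<bar> powr \<alpha>) summable_on UNIV"
      using u by (intro summable_on_cmult_right) (simp add: lq_def)
    have sd: "(\<lambda>x. c powr (1 - \<alpha>) * \<bar>f k x - u x\<bar> powr \<alpha>) summable_on UNIV"
      using lq_diff[OF f u \<alpha>] by (intro summable_on_cmult_right) (simp add: lq_def)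
    have "power_sum \<alpha> (f k) \<le> (\<Sum>\<^sub>\<infinity>x. (1 - c) powr (1 - \<alpha>) * \<bar>u x\<bar> powr \<alpha>
        + c powr (1 - \<alpha>) * \<bar>f k x - u x\<bar> powr \<alpha>)"
      unfolding power_sum_def
    proof (rule infsum_mono)
      show "(\<lambda>x. \<bar>f k x\<bar> powr \<alpha>) summable_on UNIV" using f by (simp add: lq_def)
      fix x
      have "\<bar>f k x\<bar> powr \<alpha> \<le> (\<bar>u x\<bar> + \<bar>f k x - u x\<bar>) powr \<alpha>" using \<alpha> by (intro powr_mono2) auto
      also have "\<dots> \<le> (1 - c) powr (1 - \<alpha>) * \<bar>u x\<bar> powr \<alpha> + c powr (1 - \<alpha>) * \<bar>f k x - u x\<bar> powr \<alpha>"
        using c \<alpha> by (intro powr_add_le) auto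
      finally show "\<bar>f k x\<bar> powr \<alpha> \<le> (1 - c) powr (1 - \<alpha>) * \<bar>u x\<bar> powr \<alpha> + c powr (1 - \<alpha>) * \<bar>f k x - u x\<bar> powr \<alpha>" .
    qed (intro summable_on_add su sd)
    also have "\<dots> = (1 - c) powr (1 - \<alpha>) * power_sum \<alpha> u + c powr (1 - \<alpha>) * power_sum \<alpha> (\<lambda>x. f k x - u x)"
      unfolding infsum_add[OF su sd] by (simp only: infsum_cmult_right' power_sum_def)
    finally show ?thesis .
  qed
  have "(\<lambda>k. (1 - c) powr (1 - \<alpha>) * power_sum \<alpha> u + c powr (1 - \<alpha>) * power_sum \<alpha> (\<lambda>x. f k x - u x))
      \<longlonglongrightarrow> (1 - c) powr (1 - \<alpha>) * power_sum \<alpha> u + c powr (1 - \<alpha>) * 0"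
    by (intro tendsto_intros lq_converges_power_sum_diff[OF conv \<alpha>])
  then have "(\<lambda>k. (1 - c) powr (1 - \<alpha>) * power_sum \<alpha> u + c powr (1 - \<alpha>) * power_sum \<alpha> (\<lambda>x. f k x - u x))
      \<longlonglongrightarrow> (1 - c) powr (1 - \<alpha>) * power_sum \<alpha> u" by simp
  from order_tendstoD(2)[OF this cK] show ?thesis
    by (rule eventually_mono) (rule le_less_trans[OF bound])
qed

lemma fin_supp_lq: "fin_supp u \<Longrightarrow> u \<in> lq p"
  unfolding lq_def by (auto intro!: fin_supp_summable fin_supp_map[of u "\<lambda>t. \<bar>t\<bar> powr p"])

lemma power_sum_embedding:
  assumes u: "fin_supp u" and p: "0 < p" "p \<le> \<alpha>"
  shows "power_sum \<alpha> u \<le> power_sum p u powr (\<alpha> / p)"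
proof -
  define S where "S = power_sum p u"
  have f: "fin_supp (\<lambda>x. \<bar>u x\<bar> powr a)" for a by (rule fin_supp_map[OF u, of "\<lambda>t. \<bar>t\<bar> powr a"]) simp
  have S0: "0 \<le> S" by (simp add: S_def power_sum_nonneg)
  have "power_sum \<alpha> u \<le> (\<Sum>\<^sub>\<infinity>x. S powr (\<alpha> / p - 1) * \<bar>u x\<bar> powr p)"
    unfolding power_sum_def
  proof (rule infsum_mono_fin_supp[OF f])
    show "fin_supp (\<lambda>x. S powr (\<alpha> / p - 1) * \<bar>u x\<bar> powr p)" by (rule fin_supp_map[OF f]) simp
    fix x
    have "(\<bar>u x\<bar> powr p) powr (\<alpha> / p - 1) \<le> S powr (\<alpha> / p - 1)"
      unfolding S_def using p abs_powr_le_power_sum[OF fin_supp_lq[OF u]] by (intro powr_mono2) auto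
    then have "(\<bar>u x\<bar> powr p) powr (\<alpha> / p - 1) * \<bar>u x\<bar> powr p \<le> S powr (\<alpha> / p - 1) * \<bar>u x\<bar> powr p"
      by (rule mult_right_mono) simp
    moreover have "(\<bar>u x\<bar> powr p) powr (\<alpha> / p - 1) * \<bar>u x\<bar> powr p = \<bar>u x\<bar> powr \<alpha>"
      using p by (simp add: powr_powr right_diff_distrib flip: powr_add)
    ultimately show "\<bar>u x\<bar> powr \<alpha> \<le> S powr (\<alpha> / p - 1) * \<bar>u x\<bar> powr p" by simp
  qed
  also have "\<dots> = S powr (\<alpha> / p - 1) * S" by (simp only: infsum_cmult_right' S_def power_sum_def)
  also have "\<dots> = S powr (\<alpha> / p)" using S0 by (cases "S = 0") (auto simp: powr_diff)
  finally show ?thesis by (simp add: S_def)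
qed

text \<open>\<open>J\<close> controls the Dirichlet energy because t^2 / 2 <= born_infeld t, whence
  the sqrt 2 in the constant.\<close>

lemma Sobolev_J:
  assumes "3 \<le> CARD('n::finite)"
  obtains C where "0 < C" "\<And>u :: int ^ 'n \<Rightarrow> real. admissible u \<Longrightarrow>
    power_sum (crit_exp CARD('n)) u powr (1 / crit_exp CARD('n)) \<le> C * sqrt (J u)"
proof -
  define N where "N = real CARD('n)"
  define C where "C = 4 * (N - 1) / (N - 2) * N * sqrt 2"
  have N: "3 \<le> N" using assms by (simp add: N_def)
  have "power_sum (crit_exp CARD('n)) u powr (1 / crit_exp CARD('n)) \<le> C * sqrt (J u)"
    if u: "admissible u" for u :: "int ^ 'n \<Rightarrow> real"
  proof -
    have u': "fin_supp u" "0 \<le> u x" "slope_bounded u" for x using u by (auto simp: admissible_def)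
    have "power_sum (crit_exp CARD('n)) u powr (1 / crit_exp CARD('n))
        \<le> 4 * (N - 1) / (N - 2) * N * sqrt (\<Sum>i\<in>UNIV. \<Sum>\<^sub>\<infinity>x. (u (x + unit_vec i) - u x)\<^sup>2)"
      unfolding N_def by (rule discrete_Sobolev) (use u' assms in auto)
    also have "\<dots> \<le> 4 * (N - 1) / (N - 2) * N * sqrt (2 * J u)"
    proof (intro mult_left_mono real_sqrt_le_mono)
      show "(\<Sum>i\<in>UNIV. \<Sum>\<^sub>\<infinity>x. (u (x + unit_vec i) - u x)\<^sup>2) \<le> 2 * J u"
        unfolding J_fin_supp[OF u'(1)] sum_distrib_left infsum_cmult_right'[symmetric]
      proof (intro sum_mono infsum_mono_fin_supp)
        fix i x
        show "fin_supp (\<lambda>x. (u (x + unit_vec i) - u x)\<^sup>2)"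
          by (rule fin_supp_grad[OF u'(1)]) simp
        show "fin_supp (\<lambda>x. 2 * born_infeld (u (x + unit_vec i) - u x))"
          by (rule fin_supp_grad[OF u'(1), of "\<lambda>t. 2 * born_infeld t"]) simp
        show "(u (x + unit_vec i) - u x)\<^sup>2 \<le> 2 * born_infeld (u (x + unit_vec i) - u x)"
          using born_infeld_ge_half_square[OF slope_boundedD[OF u'(3)], of x i] by simp
      qed
    qed (use N in auto)
    also have "\<dots> = C * sqrt (J u)" by (simp add: C_def real_sqrt_mult)
    finally show ?thesis .
  qed
  moreover have "0 < C" using N by (simp add: C_def)
  ultimately show thesis by (intro that)
qed

section \<open>Existence of a minimizer\<close>

lemma crit_exp_gt_2: "3 \<le> N \<Longrightarrow> 2 < crit_exp N"
  by (simp add: crit_exp_def field_simps)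

lemma alpha_term_eq:
  fixes u :: "int ^ 'n::finite \<Rightarrow> real"
  shows "alpha_term \<alpha> u = power_sum \<alpha> u powr (real CARD('n) / (real CARD('n) + \<alpha>))"
  by (simp add: alpha_term_def power_sum_def)

lemma power_sum_pos:
  assumes "u \<in> lq \<alpha>" "u \<noteq> (\<lambda>_. 0)"
  shows "0 < power_sum \<alpha> u"
proof -
  obtain x where "u x \<noteq> 0" using assms(2) by auto
  then have "0 < \<bar>u x\<bar> powr \<alpha>" by simp
  also have "\<dots> \<le> power_sum \<alpha> u" by (rule abs_powr_le_power_sum[OF assms(1)])
  finally show ?thesis .
qed

lemma admissible_X_space:
  fixes u :: "int ^ 'n::finite \<Rightarrow> real"
  assumes "admissible u" "3 \<le> CARD('n)"
  shows "u \<in> X_space"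
  using assms crit_exp_gt_2[OF assms(2)]
  by (intro X_spaceI fin_supp_lq finite_energy_fin_supp) (auto simp: admissible_def)

lemma sum_born_infeld_le_J:
  fixes u :: "int ^ 'n::finite \<Rightarrow> real"
  assumes "admissible u" "finite F"
  shows "(\<Sum>x\<in>F. \<Sum>y | adj x y. born_infeld (grad u x y)) \<le> 2 * J u"
proof -
  have u: "fin_supp u" "slope_bounded u" using assms by (auto simp: admissible_def)
  have "(\<Sum>x\<in>F. \<Sum>y | adj x y. born_infeld (grad u x y)) \<le> (\<Sum>\<^sub>\<infinity>x. \<Sum>y | adj x y. born_infeld (grad u x y))"
    using u assms(2) finite_energy_fin_supp
    by (intro finite_sum_le_infsum summable_born_infeld sum_nonneg born_infeld_nonneg)
      (auto simp: slope_bounded_iff)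
  then show ?thesis by (simp add: J_born_infeld)
qed

section \<open>Pointwise limits of admissible functions\<close>

context
  fixes w :: "nat \<Rightarrow> int ^ 'n::finite \<Rightarrow> real" and u :: "int ^ 'n \<Rightarrow> real"
  assumes w: "\<And>n. admissible (w n)" and lim: "\<And>x. (\<lambda>n. w n x) \<longlonglongrightarrow> u x"
begin

lemma pointwise_limit_slope_bounded: "slope_bounded u"
  unfolding slope_bounded_def
proof (intro allI)
  fix x i
  have "(\<lambda>n. \<bar>w n (x + unit_vec i) - w n x\<bar>) \<longlonglongrightarrow> \<bar>u (x + unit_vec i) - u x\<bar>"
    by (intro tendsto_intros lim)
  then show "\<bar>u (x + unit_vec i) - u x\<bar> \<le> 1"
    by (rule LIMSEQ_le_const2) (use w in \<open>auto simp: admissible_def slope_bounded_def\<close>)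
qed

text \<open>The finite form of Fatou's lemma. The bound \<open>b\<close> varies with n because the
  quotient bounds of a minimizing sequence do.\<close>

lemma pointwise_limit_sum_born_infeld_le:
  assumes F: "finite F" and b: "eventually (\<lambda>n. J (w n) \<le> b n) sequentially" "b \<longlonglongrightarrow> B"
  shows "(\<Sum>x\<in>F. \<Sum>y | adj x y. born_infeld (grad u x y)) \<le> 2 * B"
proof (rule tendsto_le[OF trivial_limit_sequentially])
  show "(\<lambda>n. 2 * b n) \<longlonglongrightarrow> 2 * B" by (intro tendsto_intros b)
  show "(\<lambda>n. \<Sum>x\<in>F. \<Sum>y | adj x y. born_infeld (grad (w n) x y))
      \<longlonglongrightarrow> (\<Sum>x\<in>F. \<Sum>y | adj x y. born_infeld (grad u x y))"
    unfolding born_infeld_def grad_def by (intro tendsto_intros lim)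
  show "eventually (\<lambda>n. (\<Sum>x\<in>F. \<Sum>y | adj x y. born_infeld (grad (w n) x y)) \<le> 2 * b n) sequentially"
    using b(1)
  proof (rule eventually_mono)
    fix n assume "J (w n) \<le> b n"
    then show "(\<Sum>x\<in>F. \<Sum>y | adj x y. born_infeld (grad (w n) x y)) \<le> 2 * b n"
      using sum_born_infeld_le_J[OF w F, of n] by linarith
  qed
qed

lemma pointwise_limit_finite_energy:
  assumes b: "\<And>n. J (w n) \<le> B"
  shows "finite_energy u"
  unfolding finite_energy_def
proof (rule nonneg_bdd_above_summable_on)
  have "(\<Sum>x\<in>F. \<Sum>y | adj x y. \<bar>grad u x y\<bar>\<^sup>2) \<le> 4 * B" if F: "finite F" for F
  proof -
    have "\<bar>grad u x y\<bar>\<^sup>2 \<le> 2 * born_infeld (grad u x y)" if "adj x y" for x y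
      using born_infeld_ge_half_square[of "grad u x y"] pointwise_limit_slope_bounded that
      by (simp add: slope_bounded_iff)
    then have "(\<Sum>x\<in>F. \<Sum>y | adj x y. \<bar>grad u x y\<bar>\<^sup>2)
        \<le> (\<Sum>x\<in>F. \<Sum>y | adj x y. 2 * born_infeld (grad u x y))"
      by (intro sum_mono) simp
    also have "\<dots> = 2 * (\<Sum>x\<in>F. \<Sum>y | adj x y. born_infeld (grad u x y))"
      by (simp add: sum_distrib_left)
    also have "\<dots> \<le> 2 * (2 * B)"
      using pointwise_limit_sum_born_infeld_le[OF F, of "\<lambda>_. B" B] b by (intro mult_left_mono) auto
    finally show ?thesis by simp
  qed
  then show "bdd_above (sum (\<lambda>x. \<Sum>y | adj x y. \<bar>grad u x y\<bar>\<^sup>2) ` {F. F \<subseteq> UNIV \<and> finite F})"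
    by (intro bdd_aboveI2[where M = "4 * B"]) auto
qed (intro sum_nonneg, simp)

lemma pointwise_limit_J_le:
  assumes "\<And>n. J (w n) \<le> B'" and b: "eventually (\<lambda>n. J (w n) \<le> b n) sequentially" "b \<longlonglongrightarrow> B"
  shows "J u \<le> B"
proof -
  have "(\<Sum>\<^sub>\<infinity>x. \<Sum>y | adj x y. born_infeld (grad u x y)) \<le> 2 * B"
    using pointwise_limit_slope_bounded pointwise_limit_finite_energy[OF assms(1)]
    by (intro infsum_le_finite_sums summable_born_infeld pointwise_limit_sum_born_infeld_le[OF _ b])
      (auto simp: slope_bounded_iff)
  then show ?thesis by (simp add: J_born_infeld)
qed

lemma pointwise_limit_lq:
  assumes p: "0 < p" and b: "\<And>n. power_sum p (w n) \<le> B"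
  shows "u \<in> lq p"
  unfolding lq_def mem_Collect_eq
proof (rule nonneg_bdd_above_summable_on)
  have "(\<Sum>x\<in>F. \<bar>u x\<bar> powr p) \<le> B" if F: "finite F" for F
  proof (rule LIMSEQ_le_const2)
    show "(\<lambda>n. \<Sum>x\<in>F. \<bar>w n x\<bar> powr p) \<longlonglongrightarrow> (\<Sum>x\<in>F. \<bar>u x\<bar> powr p)"
      using p by (intro tendsto_sum tendsto_powr' tendsto_rabs lim tendsto_const) auto
    have "(\<Sum>x\<in>F. \<bar>w n x\<bar> powr p) \<le> power_sum p (w n)" for n
      unfolding power_sum_def using w[of n] fin_supp_lq[of "w n" p] F
      by (intro finite_sum_le_infsum) (auto simp: admissible_def lq_def)
    then show "\<exists>N. \<forall>n\<ge>N. (\<Sum>x\<in>F. \<bar>w n x\<bar> powr p) \<le> B" using b order_trans by blast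
  qed
  then show "bdd_above (sum (\<lambda>x. \<bar>u x\<bar> powr p) ` {F. F \<subseteq> UNIV \<and> finite F})"
    by (intro bdd_aboveI2[where M = B]) auto
qed simp

end

text \<open>The embedding, Sobolev's inequality and the bound on \<open>J u\<close> give
  s^(1/\<alpha>) <= C sqrt q s^(A/2). The exponent on the right is the larger one exactly when
  \<alpha> > 2 N / (N - 2), so s cannot be small. This excludes vanishing of a minimizing
  sequence.\<close>

lemma power_sum_lower_bound:
  fixes \<alpha> q C :: real
  assumes N3: "3 \<le> CARD('n::finite)" and \<alpha>: "crit_exp CARD('n) < \<alpha>" and q: "0 < q"
  defines "A \<equiv> real CARD('n) / (real CARD('n) + \<alpha>)"
  obtains \<eta> where "0 < \<eta>" "\<And>u :: int ^ 'n \<Rightarrow> real. admissible u \<Longrightarrow> 0 < power_sum \<alpha> u \<Longrightarrow>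
    J u \<le> q * power_sum \<alpha> u powr A \<Longrightarrow> \<eta> \<le> power_sum \<alpha> u"
proof -
  define N p where "N = real CARD('n)" and "p = crit_exp CARD('n)"
  have N: "3 \<le> N" using N3 by (simp add: N_def)
  have p: "2 < p" "p < \<alpha>" using crit_exp_gt_2[OF N3] \<alpha> by (auto simp: p_def)
  obtain C where C: "0 < C" "\<And>u :: int ^ 'n \<Rightarrow> real. admissible u \<Longrightarrow> power_sum p u powr (1 / p) \<le> C * sqrt (J u)"
    using Sobolev_J[OF N3] unfolding p_def by blast
  define d where "d = A / 2 - 1 / \<alpha>"
  have d: "0 < d"
  proof -
    have "2 * N < \<alpha> * (N - 2)"
      using \<alpha> N by (simp add: crit_exp_def N_def[symmetric] divide_less_eq)
    moreover have "d = (\<alpha> * (N - 2) - 2 * N) / (2 * \<alpha> * (N + \<alpha>))"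
      using N p unfolding d_def A_def N_def[symmetric] by (simp add: field_simps)
    ultimately show ?thesis using N p by simp
  qed
  define \<eta> where "\<eta> = (1 / (C * sqrt q)) powr (1 / d)"
  have "\<eta> \<le> power_sum \<alpha> u"
    if u: "admissible u" "0 < power_sum \<alpha> u" "J u \<le> q * power_sum \<alpha> u powr A" for u :: "int ^ 'n \<Rightarrow> real"
  proof -
    define s where "s = power_sum \<alpha> u"
    have s: "0 < s" using u by (simp add: s_def)
    have "s powr (1 / \<alpha>) \<le> (power_sum p u powr (\<alpha> / p)) powr (1 / \<alpha>)"
      unfolding s_def using p u(1) power_sum_nonneg[of \<alpha> u]
      by (intro powr_mono2 power_sum_embedding) (auto simp: admissible_def)
    also have "\<dots> = power_sum p u powr (1 / p)" using p by (simp add: powr_powr)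
    also have "\<dots> \<le> C * sqrt (J u)" by (rule C(2)[OF u(1)])
    also have "\<dots> \<le> C * sqrt (q * s powr A)"
      unfolding s_def using C(1) u(3) by (intro mult_left_mono real_sqrt_le_mono) auto
    also have "\<dots> = C * sqrt q * s powr (A / 2)"
      using s by (simp add: real_sqrt_mult powr_half_sqrt_powr)
    finally have "1 / (C * sqrt q) \<le> s powr (A / 2) / s powr (1 / \<alpha>)"
      using C(1) q s by (simp add: field_simps)
    then have "1 / (C * sqrt q) \<le> s powr d" by (simp add: d_def powr_diff)
    then have "(1 / (C * sqrt q)) powr (1 / d) \<le> (s powr d) powr (1 / d)"
      using C(1) q d by (intro powr_mono2) auto
    also have "\<dots> = s" using s d by (simp add: powr_powr)
    finally show ?thesis by (simp add: s_def \<eta>_def)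
  qed
  moreover have "0 < \<eta>" using C(1) q by (simp add: \<eta>_def)
  ultimately show thesis by (intro that)
qed

context schwarz_rearrangement
begin

lemma schwarz_symmetric_star:
  assumes "fin_supp u" "\<And>x. 0 \<le> u x"
  shows "schwarz_symmetric star (star u)"
  using star_C0_plus star_idem fin_supp_C0_plus[OF assms] by (auto simp: schwarz_symmetric_def)

lemma minimizer_exists:
  assumes N3: "3 \<le> CARD('n)" and \<alpha>: "crit_exp CARD('n) < \<alpha>"
  shows "\<exists>u0 \<in> X_space - {\<lambda>_. 0}. (\<forall>x. 0 \<le> u0 x) \<and> schwarz_symmetric star u0 \<and>
        J u0 = opt_const TYPE('n) \<alpha> * alpha_term \<alpha> u0"
proof -
  define N A C p where "N = real CARD('n)" and "A = N / (N + \<alpha>)"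
    and "C = opt_const TYPE('n) \<alpha>" and "p = crit_exp CARD('n)"
  have p: "2 < p" "p < \<alpha>" using crit_exp_gt_2[OF N3] \<alpha> by (auto simp: p_def)
  have A: "0 < A" using p by (simp add: A_def N_def)
  have at: "alpha_term \<alpha> u = power_sum \<alpha> u powr A" for u :: "int ^ 'n \<Rightarrow> real"
    by (simp add: alpha_term_eq A_def N_def)
  define S where "S = (X_space \<inter> lq \<alpha>) - {\<lambda>_ :: int ^ 'n. 0 :: real}"
  have C_eq: "C = (INF u\<in>S. J u / alpha_term \<alpha> u)" by (simp add: C_def opt_const_def S_def)
  have quot0: "0 \<le> J u / alpha_term \<alpha> u" for u :: "int ^ 'n \<Rightarrow> real"
    by (simp add: at J_nonneg)
  have bdd: "bdd_below ((\<lambda>u. J u / alpha_term \<alpha> u) ` S)" by (rule bdd_belowI2[OF quot0])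
  have "S \<noteq> {}"
  proof -
    \<comment> \<open>The unit point mass has slopes at most 1, so the infimum is over a nonempty
      set.\<close>
    define \<delta> :: "int ^ 'n \<Rightarrow> real" where "\<delta> x = (if x = 0 then 1 else 0)" for x
    have "admissible \<delta>" by (auto simp: admissible_def fin_supp_def slope_bounded_def \<delta>_def)
    moreover have "\<delta> 0 \<noteq> 0" by (simp add: \<delta>_def)
    ultimately have "\<delta> \<in> S"
      using admissible_X_space[OF _ N3, of \<delta>] fin_supp_lq[of \<delta>] by (auto simp: S_def admissible_def)
    then show ?thesis by blast
  qed
  then have C0: "0 \<le> C" unfolding C_eq by (intro cINF_greatest quot0)
  have A': "A = real CARD('n) / (real CARD('n) + \<alpha>)" by (simp add: A_def N_def)
  have "2 < \<alpha>" "0 \<le> C + 1" using p C0 by auto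
  \<comment> \<open>The choice Q = C + 1 bounds all quotients \<open>q n\<close> to come, so
    \<open>M\<close> and \<open>B\<close> serve for the whole sequence.\<close>
  from descend_to_bounded_power_sum[OF this A'] obtain M where M:
    "\<And>q (u :: int ^ 'n \<Rightarrow> real). 0 \<le> q \<Longrightarrow> q \<le> C + 1 \<Longrightarrow> admissible u \<Longrightarrow> 0 < power_sum \<alpha> u \<Longrightarrow>
      J u \<le> q * power_sum \<alpha> u powr A \<Longrightarrow>
      \<exists>v :: int ^ 'n \<Rightarrow> real. admissible v \<and> 0 < power_sum \<alpha> v \<and> power_sum \<alpha> v \<le> M
        \<and> J v \<le> q * power_sum \<alpha> v powr A"
    by blast
  define B where "B = (C + 1) * M powr A"
  have ex: "\<exists>w. admissible w \<and> schwarz_symmetric star w \<and> 0 < power_sum \<alpha> w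
      \<and> J w \<le> q * power_sum \<alpha> w powr A \<and> J w \<le> B" if q: "C < q" "q \<le> C + 1" for q
  proof -
    have q0: "0 < q" using q C0 by simp
    obtain u where u: "u \<in> S" "J u / alpha_term \<alpha> u < q"
      using q(1) \<open>S \<noteq> {}\<close> bdd unfolding C_eq by (auto simp: cINF_less_iff)
    then have uX: "u \<in> X_space" "u \<in> lq \<alpha>" "u \<noteq> (\<lambda>_. 0)" by (auto simp: S_def)
    have pos: "0 < power_sum \<alpha> u" by (rule power_sum_pos[OF uX(2,3)])
    \<comment> \<open>The power sum at which q K^A equals J u. That the quotient of \<open>u\<close>
      is below q says that its power sum exceeds \<open>K\<close>, and the strict inequality leaves
      room for truncation.\<close>
    define K where "K = (J u / q) powr (1 / A)"
    have KA: "q * K powr A = J u"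
      using q0 A J_nonneg[of u] by (simp add: K_def powr_powr)
    have "K < (power_sum \<alpha> u powr A) powr (1 / A)"
      unfolding K_def using u(2) pos q0 A J_nonneg[of u]
      by (intro powr_less_mono2) (auto simp: at field_simps)
    then have "K < power_sum \<alpha> u" using pos A by (simp add: powr_powr)
    then obtain c where c: "0 < c" "K < power_sum \<alpha> (truncation c u)"
      using power_sum_truncation_approx[OF uX(2), of K] p by auto
    define v where "v = truncation c u"
    have v: "admissible v" "J v \<le> J u"
      unfolding v_def using admissible_truncation[OF uX(1,2) _ c(1)] p by auto
    have K0: "0 \<le> K" by (simp add: K_def)
    have "J v \<le> q * K powr A" using v(2) KA by simp
    also have "\<dots> \<le> q * power_sum \<alpha> v powr A"
      using q0 c(2) A K0 by (intro mult_left_mono powr_mono2) (auto simp: v_def)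
    finally have "J v \<le> q * power_sum \<alpha> v powr A" .
    moreover have "0 < power_sum \<alpha> v" using c(2) K0 by (simp add: v_def)
    ultimately obtain t :: "int ^ 'n \<Rightarrow> real" where t: "admissible t" "0 < power_sum \<alpha> t" "power_sum \<alpha> t \<le> M"
        "J t \<le> q * power_sum \<alpha> t powr A"
      using M[of q v] v(1) q q0 by auto
    have t': "fin_supp t" "0 \<le> t x" for x using t(1) by (auto simp: admissible_def)
    have ge: "power_sum \<alpha> t \<le> power_sum \<alpha> (star t)" using p by (intro power_sum_star_ge t') auto
    have "J (star t) \<le> q * power_sum \<alpha> t powr A" using J_star_le[OF t(1)] t(4) by simp
    moreover have "q * power_sum \<alpha> t powr A \<le> q * power_sum \<alpha> (star t) powr A"
      using q0 ge A t(2) by (intro mult_left_mono powr_mono2) auto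
    \<comment> \<open>\<open>power_sum_star_ge\<close> gives no upper bound for the power sum of
      \<open>star t\<close>, so its energy is bounded through \<open>t\<close>, where
      \<open>M\<close> applies.\<close>
    moreover have "q * power_sum \<alpha> t powr A \<le> B"
      unfolding B_def using q q0 t A C0 by (intro mult_mono powr_mono2) auto
    ultimately show ?thesis
      using admissible_star[OF t(1)] schwarz_symmetric_star[OF t'] ge t(2) by (intro exI[of _ "star t"]) auto
  qed
  define q where "q n = C + inverse (real (Suc n))" for n
  have q: "C < q n" "q n \<le> C + 1" for n by (auto simp: q_def inverse_le_1_iff)
  have qlim: "q \<longlonglongrightarrow> C"
    unfolding q_def[abs_def] using tendsto_add[OF tendsto_const LIMSEQ_inverse_real_of_nat] by fastforce
  from ex[OF q] obtain w where w: "\<And>n. admissible (w n)" "\<And>n. schwarz_symmetric star (w n)"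
    "\<And>n. 0 < power_sum \<alpha> (w n)" "\<And>n. J (w n) \<le> q n * power_sum \<alpha> (w n) powr A" "\<And>n. J (w n) \<le> B"
    by metis
  have wf: "fin_supp (w n)" for n using w(1)[of n] by (simp add: admissible_def)
  obtain K where K: "0 < K" "\<And>u :: int ^ 'n \<Rightarrow> real. admissible u \<Longrightarrow> power_sum p u powr (1 / p) \<le> K * sqrt (J u)"
    using Sobolev_J[OF N3] unfolding p_def by blast
  have norm_bound: "power_sum p (w n) powr (1 / p) \<le> K * sqrt B" for n
    using K(2)[OF w(1), of n] mult_left_mono[OF real_sqrt_le_mono[OF w(5)[of n]], of K] K(1) by linarith
  have "\<exists>r u. strict_mono r \<and> (\<forall>q > crit_exp CARD('n). lq_converges q (w \<circ> r) u)"
    using norm_bound by (intro symmetric_compact[where M = "K * sqrt B"] w fin_supp_lq wf)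
      (simp add: lq_norm_def power_sum_def p_def)
  then obtain r u where r: "strict_mono r" and conv: "lq_converges \<alpha> (w \<circ> r) u" using \<alpha> by blast
  have \<alpha>1: "1 < \<alpha>" using p by simp
  have sym: "schwarz_symmetric star u"
    by (rule symmetric_closed[OF _ _ conv]) (use w \<alpha>1 in auto)
  then have u0: "0 \<le> u x" for x by (simp add: schwarz_symmetric_def C0_plus_def)
  have wr: "admissible ((w \<circ> r) n)" for n by (simp add: w)
  have lim: "(\<lambda>n. (w \<circ> r) n x) \<longlonglongrightarrow> u x" for x by (rule lq_converges_pointwise[OF conv \<alpha>1])
  have JB: "J ((w \<circ> r) n) \<le> B" for n by (simp add: w)
  \<comment> \<open>\<open>symmetric_compact\<close> gives convergence only above the critical
    exponent; membership at the critical exponent itself follows from the uniform bound by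
    Fatou.\<close>
  have "u \<in> lq p"
  proof (rule pointwise_limit_lq[OF wr lim])
    show "power_sum p ((w \<circ> r) n) \<le> (K * sqrt B) powr p" for n
    proof -
      have "(power_sum p (w (r n)) powr (1 / p)) powr p \<le> (K * sqrt B) powr p"
        using norm_bound p by (intro powr_mono2) auto
      then show ?thesis using p power_sum_nonneg[of p "w (r n)"] by (simp add: powr_powr)
    qed
  qed (use p in simp)
  then have uX: "u \<in> X_space"
    using p u0 pointwise_limit_finite_energy[OF wr lim JB] pointwise_limit_slope_bounded[OF wr lim]
    by (intro X_spaceI) (auto simp: p_def)
  have ulq: "u \<in> lq \<alpha>" using conv by (simp add: lq_converges_def)
  have "0 < C + 1" using C0 by simp
  from power_sum_lower_bound[OF N3 \<alpha> this] obtain \<eta> where \<eta>: "0 < \<eta>"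
    "\<And>v :: int ^ 'n \<Rightarrow> real. admissible v \<Longrightarrow> 0 < power_sum \<alpha> v \<Longrightarrow>
      J v \<le> (C + 1) * power_sum \<alpha> v powr A \<Longrightarrow> \<eta> \<le> power_sum \<alpha> v"
    unfolding A' by blast
  have w\<eta>: "\<eta> \<le> power_sum \<alpha> (w n)" for n
  proof (rule \<eta>(2)[OF w(1,3)])
    show "J (w n) \<le> (C + 1) * power_sum \<alpha> (w n) powr A"
      using w(4)[of n] mult_right_mono[OF q(2)[of n], of "power_sum \<alpha> (w n) powr A"] by simp
  qed
  have u_pos: "0 < power_sum \<alpha> u"
  proof (rule ccontr)
    assume "\<not> ?thesis"
    then have "power_sum \<alpha> u < \<eta>" using \<eta>(1) by simp
    from lq_converges_power_sum_upper[OF conv \<alpha>1 this] w\<eta> show False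
      by (auto simp: eventually_sequentially not_less[symmetric])
  qed
  \<comment> \<open>The power sums of the sequence are only known to be eventually below each G
    above the limit value, so such G are treated first and then decreased to that value.\<close>
  have Jle: "J u \<le> C * G powr A" if G: "power_sum \<alpha> u < G" for G
  proof (rule pointwise_limit_J_le[OF wr lim JB])
    show "(\<lambda>n. q (r n) * G powr A) \<longlonglongrightarrow> C * G powr A"
      using LIMSEQ_subseq_LIMSEQ[OF qlim r] by (intro tendsto_intros) (simp add: o_def)
    show "eventually (\<lambda>n. J ((w \<circ> r) n) \<le> q (r n) * G powr A) sequentially"
      using lq_converges_power_sum_upper[OF conv \<alpha>1 G]
    proof (rule eventually_mono)
      fix n assume "power_sum \<alpha> ((w \<circ> r) n) < G"
      then have "q (r n) * power_sum \<alpha> (w (r n)) powr A \<le> q (r n) * G powr A"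
        using A C0 q(1)[of "r n"] power_sum_nonneg[of \<alpha> "w (r n)"]
        by (intro mult_left_mono powr_mono2) auto
      then show "J ((w \<circ> r) n) \<le> q (r n) * G powr A" using w(4)[of "r n"] by simp
    qed
  qed
  have "J u \<le> C * power_sum \<alpha> u powr A"
  proof (rule LIMSEQ_le_const)
    have "(\<lambda>n. C * (power_sum \<alpha> u + inverse (real (Suc n))) powr A) \<longlonglongrightarrow> C * (power_sum \<alpha> u + 0) powr A"
      using u_pos by (intro tendsto_intros LIMSEQ_inverse_real_of_nat) auto
    then show "(\<lambda>n. C * (power_sum \<alpha> u + inverse (real (Suc n))) powr A) \<longlonglongrightarrow> C * power_sum \<alpha> u powr A"
      by simp
    show "\<exists>N. \<forall>n\<ge>N. J u \<le> C * (power_sum \<alpha> u + inverse (real (Suc n))) powr A"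
      by (intro exI allI impI Jle) simp
  qed
  moreover have uS: "u \<in> S"
    using uX ulq u_pos by (auto simp: S_def power_sum_def)
  moreover have "C \<le> J u / alpha_term \<alpha> u" unfolding C_eq by (rule cINF_lower[OF bdd uS])
  then have "C * power_sum \<alpha> u powr A \<le> J u"
    using u_pos by (simp add: at pos_le_divide_eq)
  ultimately show ?thesis
    using sym u0 uX by (intro bexI[of _ u]) (auto simp: S_def at C_def)
qed

end

theorem theorem1p3:
  assumes "CARD('n::finite) \<ge> 3"
  shows "\<exists>\<epsilon>0 > 0. \<forall>set_star (star :: (int ^ 'n \<Rightarrow> real) \<Rightarrow> (int ^ 'n \<Rightarrow> real)).
    schwarz_rearrangement set_star star \<longrightarrow>
    (\<forall>\<alpha>. crit_exp CARD('n) < \<alpha> \<and> \<alpha> < crit_exp CARD('n) + \<epsilon>0 \<longrightarrow>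
      (\<exists>u0 \<in> X_space - {\<lambda>_. 0}.
        (\<forall>x. 0 \<le> u0 x) \<and> schwarz_symmetric star u0 \<and>
        J u0 = opt_const TYPE('n) \<alpha> * alpha_term \<alpha> u0))"
  \<comment> \<open>The witness 1 is an arbitrary positive number: \<open>minimizer_exists\<close>
    treats all exponents above \<open>crit_exp\<close> at once.\<close>
  using schwarz_rearrangement.minimizer_exists[OF _ assms] by (intro exI[of _ 1]) auto

end
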